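(* Let $X$, $f$, $D$, $\mu>0$ and $h$ satisfy the majorization-minimization assumption described in the context, with envelope $F$ and iteration map $p$. If $F$ is a KL-function (with concave desingularizers), then any bounded MM sequence converges to a point $x^*\in X$ where the objective has zero slope: $|\nabla f|(x^* )=0$. The hypothesis that $F$ is a KL-function holds in particular if $X$ is a semi-algebraic subset of a Euclidean space and the approximating mapping $D$ (i.e. its graph) and the modeling function $h$ are semi-algebraic.
   Context: Metric notions. A metric space is proper if all its closed balls are compact. A geodesic in a metric space $\bar X$ is an isometry from a compact real interval into $\bar X$ (often identified with its image); its endpoints are the images of the interval's endpoints. $\bar X$ is a geodesic space if every pair of points are the endpoints of a geodesic. A subset $D\subset\bar X$ is geodesically convex if it contains all geodesics whose endpoints lie in $D$; in that case a function $g\colon D\to\mathbf{R}$ is geodesically $\mu$-strongly convex ($\mu>0$) if its composition with every geodesic in $D$ is $\mu$-strongly convex (i.e. $t\mapsto g(\gamma(t))-\frac{\mu}{2}t^2$ is convex). Approximator: a locally Lipschitz function $h\colon X^2\to\mathbf{R}$ such that for each $\bar x\in X$ there is $\gamma\ge0$ such that all $x,y,z\in X$ near $\bar x$ satisfy $|h(x,y)-h(z,y)|\le\gamma\, d(x,z)\big(d(x,y)+d(z,y)\big)$. Majorization-minimization assumption. $X$ is a proper metric space that is a metric subspace (with inherited metric $d$) of a geodesic space $\bar X$; $f\colon X\to\mathbf{R}$ is bounded below; $D$ (the approximating mapping) is a set-valued map assigning to each $x\in X$ a closed and geodesically convex (in $\bar X$) subset $D(x)\subset X$ containing $x$; $\mu>0$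 is a constant and $h\colon X^2\to\mathbf{R}$ (the modeling function) is such that for each $x\in X$ the function $h_x:=h(x,\cdot)|_{D(x)}$ is geodesically $\mu$-strongly convex on $D(x)$ and satisfies $h_x(y)\ge f(y)$ for $y\in D(x)$, with equality if $y=x$; and both $h$ and $(x,y)\mapsto\mathrm{dist}_{D(x)}(y)=\inf_{w\in D(x)}d(y,w)$ are approximators on $X$. In the semi-algebraic case, $\bar X$ is a Euclidean space $\mathbf{R}^n$ with its Euclidean metric. Envelope and iteration: $F(x)=\inf_{D(x)}h_x$ and $p(x)=\mathrm{argmin}_{D(x)}h_x$. An MM sequence is a sequence with $x_{k+1}\in p(x_k)$ for all $k$. Slope: for a function $g$ on a metric space $(X,d)$ and a point $x$ with $g(x)$ finite, $|\nabla g|(x)$ is the infimum of those $\epsilon>0$ for which $x$ is a local minimizer of $y\mapsto g(y)+\epsilon\,d(x,y)$. A desingularizer is a continuous $\phi\colon[0,\infty)\to[0,\infty)$ with $\phi(0)=0$ and continuous, strictly positive derivative on $(0,\infty)$ (set $\phi(t)=0$ for $t<0$). A lower semicontinuous function $F\colon X\to\mathbf{R}$ is a KL-function if for every $\bar x\in X$ there exist a concave desingularizer $\phi$ and $\rho>0$ such that, for all $x\in X$, $d(x,\bar x)<\rho$ and $0<F(x)-F(\bar x)<\rho$ imply $|\nabla(\phi\circ(F-F(\bar x)))|(x)\ge1$. *)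

theory Defs
  imports "HOL-Analysis.Analysis"
begin

text \<open>
  A metric space \<open>X\<close> is a set in a type of class \<^class>\<open>metric_space\<close>, with the inherited metric.
  The geodesic space containing \<open>X\<close> is the whole type. Functions on \<open>X\<close> are total functions, and
  every notion below depends only on their values on \<open>X\<close>.
\<close>

definition proper_metric :: "'a::metric_space set \<Rightarrow> bool" where
  "proper_metric X \<longleftrightarrow> (\<forall>x\<in>X. \<forall>r. compact (X \<inter> cball x r))"

definition geodesic :: "real \<Rightarrow> real \<Rightarrow> (real \<Rightarrow> 'a::metric_space) \<Rightarrow> bool" where
  "geodesic a b \<gamma> \<longleftrightarrow> a \<le> b \<and> (\<forall>s\<in>{a..b}. \<forall>t\<in>{a..b}. dist (\<gamma> s) (\<gamma> t) = \<bar>s - t\<bar>)"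

definition geodesic_space :: "'a::metric_space itself \<Rightarrow> bool" where
  "geodesic_space _ \<longleftrightarrow> (\<forall>x y :: 'a. \<exists>a b \<gamma>. geodesic a b \<gamma> \<and> \<gamma> a = x \<and> \<gamma> b = y)"

definition geodesically_convex :: "'a::metric_space set \<Rightarrow> bool" where
  "geodesically_convex C \<longleftrightarrow>
     (\<forall>a b \<gamma>. geodesic a b \<gamma> \<and> \<gamma> a \<in> C \<and> \<gamma> b \<in> C \<longrightarrow> \<gamma> ` {a..b} \<subseteq> C)"

definition geodesically_strongly_convex_on ::
    "real \<Rightarrow> 'a::metric_space set \<Rightarrow> ('a \<Rightarrow> real) \<Rightarrow> bool" where
  "geodesically_strongly_convex_on \<mu> C g \<longleftrightarrow>
     (\<forall>a b \<gamma>. geodesic a b \<gamma> \<and> \<gamma> ` {a..b} \<subseteq> C \<longrightarrow>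
        convex_on {a..b} (\<lambda>t. g (\<gamma> t) - \<mu> / 2 * t\<^sup>2))"

definition locally_lipschitz_on ::
    "'a::metric_space set \<Rightarrow> ('a \<Rightarrow> 'b::metric_space) \<Rightarrow> bool" where
  "locally_lipschitz_on S g \<longleftrightarrow> (\<forall>p\<in>S. \<exists>r>0. \<exists>L. L-lipschitz_on (S \<inter> ball p r) g)"

definition approximator :: "'a::metric_space set \<Rightarrow> ('a \<Rightarrow> 'a \<Rightarrow> real) \<Rightarrow> bool" where
  "approximator X h \<longleftrightarrow>
     locally_lipschitz_on (X \<times> X) (\<lambda>(x, y). h x y) \<and>
     (\<forall>x0\<in>X. \<exists>\<gamma>\<ge>0. \<exists>r>0. \<forall>x \<in> X \<inter> ball x0 r. \<forall>y \<in> X \<inter> ball x0 r. \<forall>z \<in> X \<inter> ball x0 r.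
        \<bar>h x y - h z y\<bar> \<le> \<gamma> * dist x z * (dist x y + dist z y))"

definition mm_assumption ::
    "'a::metric_space set \<Rightarrow> ('a \<Rightarrow> real) \<Rightarrow> ('a \<Rightarrow> 'a set) \<Rightarrow> real \<Rightarrow> ('a \<Rightarrow> 'a \<Rightarrow> real) \<Rightarrow> bool" where
  "mm_assumption X f D \<mu> h \<longleftrightarrow>
     geodesic_space TYPE('a) \<and> proper_metric X \<and>
     bdd_below (f ` X) \<and>
     (\<forall>x\<in>X. D x \<subseteq> X \<and> x \<in> D x \<and> closed (D x) \<and> geodesically_convex (D x)) \<and>
     0 < \<mu> \<and>
     (\<forall>x\<in>X. geodesically_strongly_convex_on \<mu> (D x) (h x) \<and>
        (\<forall>y\<in>D x. f y \<le> h x y) \<and> h x x = f x) \<and>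
     approximator X h \<and>
     approximator X (\<lambda>x y. infdist y (D x))"

text \<open>
  Under \<open>mm_assumption\<close>, for \<open>x \<in> X\<close> the infimum below is over a nonempty set on which \<open>h x\<close> is
  bounded below by \<open>inf f\<close>, so it is a genuine real infimum.
\<close>

definition envelope :: "('a \<Rightarrow> 'a set) \<Rightarrow> ('a \<Rightarrow> 'a \<Rightarrow> real) \<Rightarrow> 'a \<Rightarrow> real" where
  "envelope D h x = (INF y\<in>D x. h x y)"

definition iteration_map :: "('a \<Rightarrow> 'a set) \<Rightarrow> ('a \<Rightarrow> 'a \<Rightarrow> real) \<Rightarrow> 'a \<Rightarrow> 'a set" where
  "iteration_map D h x = {y. is_arg_min (h x) (\<lambda>y. y \<in> D x) y}"

definition mm_sequence ::
    "'a set \<Rightarrow> ('a \<Rightarrow> 'a set) \<Rightarrow> ('a \<Rightarrow> 'a \<Rightarrow> real) \<Rightarrow> (nat \<Rightarrow> 'a) \<Rightarrow> bool" where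
  "mm_sequence X D h x \<longleftrightarrow> (\<forall>k. x k \<in> X) \<and> (\<forall>k. x (Suc k) \<in> iteration_map D h (x k))"

text \<open>The slope is extended-real valued: it is \<open>\<infinity>\<close> when no \<open>\<epsilon>\<close> qualifies.\<close>

definition slope :: "'a::metric_space set \<Rightarrow> ('a \<Rightarrow> real) \<Rightarrow> 'a \<Rightarrow> ereal" where
  "slope X g x = Inf {ereal \<epsilon> | \<epsilon>. 0 < \<epsilon> \<and>
     (\<exists>r>0. \<forall>y \<in> X \<inter> ball x r. g x + \<epsilon> * dist x x \<le> g y + \<epsilon> * dist x y)}"

text \<open>The clause on negative arguments is the extension of \<open>\<phi>\<close> by zero.\<close>

definition desingularizer :: "(real \<Rightarrow> real) \<Rightarrow> bool" where
  "desingularizer \<phi> \<longleftrightarrow>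
     continuous_on {0..} \<phi> \<and> (\<forall>t\<ge>0. 0 \<le> \<phi> t) \<and> \<phi> 0 = 0 \<and>
     (\<exists>\<phi>'. continuous_on {0<..} \<phi>' \<and>
        (\<forall>t>0. (\<phi> has_real_derivative \<phi>' t) (at t) \<and> 0 < \<phi>' t)) \<and>
     (\<forall>t<0. \<phi> t = 0)"

definition lower_semicontinuous_on :: "'a::topological_space set \<Rightarrow> ('a \<Rightarrow> real) \<Rightarrow> bool" where
  "lower_semicontinuous_on X g \<longleftrightarrow> (\<forall>x\<in>X. \<forall>c<g x. eventually (\<lambda>y. c < g y) (at x within X))"

definition KL_function :: "'a::metric_space set \<Rightarrow> ('a \<Rightarrow> real) \<Rightarrow> bool" where
  "KL_function X F \<longleftrightarrow>
     lower_semicontinuous_on X F \<and>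
     (\<forall>x0\<in>X. \<exists>\<phi> \<rho>. desingularizer \<phi> \<and> concave_on {0..} \<phi> \<and> 0 < \<rho> \<and>
        (\<forall>x\<in>X. dist x x0 < \<rho> \<and> 0 < F x - F x0 \<and> F x - F x0 < \<rho> \<longrightarrow>
           1 \<le> slope X (\<lambda>y. \<phi> (F y - F x0)) x))"

text \<open>
  A semi-algebraic set is a finite union of sets, each the solution set of finitely many polynomial
  equations and strict inequalities. On a Euclidean space, \<^const>\<open>real_polynomial_function\<close>
  describes exactly the functions that are polynomials in the coordinates.
\<close>

definition semialgebraic :: "'a::euclidean_space set \<Rightarrow> bool" where
  "semialgebraic S \<longleftrightarrow>
     (\<exists>\<F> :: (('a \<Rightarrow> real) set \<times> ('a \<Rightarrow> real) set) set. finite \<F> \<and>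
        (\<forall>(P, Q)\<in>\<F>. finite P \<and> finite Q \<and> (\<forall>p \<in> P \<union> Q. real_polynomial_function p)) \<and>
        S = (\<Union>(P, Q)\<in>\<F>. {x. (\<forall>p\<in>P. p x = 0) \<and> (\<forall>q\<in>Q. 0 < q x)}))"

definition semialgebraic_mapping :: "'a::euclidean_space set \<Rightarrow> ('a \<Rightarrow> 'a set) \<Rightarrow> bool" where
  "semialgebraic_mapping X D \<longleftrightarrow> semialgebraic {(x, y). x \<in> X \<and> y \<in> D x}"

definition semialgebraic_function2 ::
    "'a::euclidean_space set \<Rightarrow> ('a \<Rightarrow> 'a \<Rightarrow> real) \<Rightarrow> bool" where
  "semialgebraic_function2 X h \<longleftrightarrow> semialgebraic {((x, y), t). x \<in> X \<and> y \<in> X \<and> t = h x y}"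

end

theory Submission
  imports Defs
begin

text \<open>
  Convergence. Write \<open>s = 2 * sqrt ((f - F) / \<mu>)\<close> (\<open>gap\<close> below). Strong convexity bounds the step from \<open>x\<^sub>k\<close> by
  \<open>s x\<^sub>k\<close> and yields \<open>F x\<^sub>k - F x\<^sub>k\<^sub>+\<^sub>1 \<ge> \<mu> / 4 * (s x\<^sub>k\<^sub>+\<^sub>1)\<^sup>2\<close>. Projecting the minimizer at \<open>x'\<close> onto \<open>D x\<close>, the
  two approximator inequalities give \<open>F x \<le> F x' + C * d x x' * (d x x' + 2 * s x')\<close> near a cluster point,
  so \<open>F\<close> has slope at most \<open>2 * C * s x\<close> there. With a desingularizer \<open>\<phi>\<close> at the cluster point \<open>x\<^sup>*\<close>,
  the potential \<open>\<Psi>\<^sub>k = 2 * s x\<^sub>k + B * \<phi> (F x\<^sub>k - F x\<^sup>*)\<close> then drops by at least the length of each step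
  taken near \<open>x\<^sup>*\<close>, which traps the sequence.

  Semialgebraic case. By the Tarski--Seidenberg theorem the continuous function \<open>F\<close> is semialgebraic.
  Let \<open>M t\<close> be the infimal slope of \<open>F\<close> on the level \<open>F x\<^sub>0 + t\<close> near \<open>x\<^sub>0\<close>. If \<open>M t\<close> were at most \<open>C * t\<close> for all
  small \<open>t\<close>, a bounded semialgebraic curve \<open>\<xi>\<close> through points of such slope, parametrized by the level,
  would have finite length because its coordinates are eventually monotone; yet its length dominates
  a multiple of the variation of \<open>ln t\<close>, which is infinite. Hence \<open>t / M t\<close> tends to \<open>0\<close>; being algebraic over the
  polynomials it is at most \<open>t powr (1 / N)\<close>, and \<open>t \<mapsto> N * root N t\<close> is a desingularizer.
\<close>

section \<open>Matching the sign diagrams of real polynomials\<close>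

text \<open>Neither cell decomposition nor Puiseux series enter. Quantifier elimination is proved by
  comparison: no sign diagram is computed, it is only shown that parameters at which finitely many
  polynomials agree in sign have order isomorphic sign diagrams, so that a projection is a finite
  union of sign cells. In one variable everything rests on finite frontiers, by which a definable
  property holds or fails throughout some interval beside a point. A level may carry no point near
  \<open>x0\<close>, so the sets of slopes are padded by the value \<open>1\<close>. That
  \<open>M t / t\<close> is unbounded, and not merely bounded below, is what makes
  \<open>t / M t\<close> vanish at \<open>0\<close>; for an algebraic function vanishing there, the
  lowest-order terms of its equation give a power bound. In the convergence part, the KL inequality
  concerns the composition of \<open>\<phi>\<close> with \<open>F\<close>, while an iteration lowers
  \<open>F\<close> itself. Concavity of \<open>\<phi>\<close> translates one into the other, at the
  price of a product of the gap and the drop of \<open>\<phi>\<close>; the inequality of arithmetic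
  and geometric means splits it into a sum that telescopes.\<close>

lemma strict_mono_extension:
  fixes f :: "real \<Rightarrow> real"
  assumes "finite S" "strict_mono_on S f"
  shows "\<exists>g. strict_mono g \<and> surj g \<and> (\<forall>x\<in>S. g x = f x)"
  using assms
proof (induction S rule: finite_linorder_max_induct)
  case empty
  have "strict_mono (id::real\<Rightarrow>real)" "surj (id::real\<Rightarrow>real)" by (auto simp: strict_mono_def)
  then show ?case by blast
next
  case (insert a S)
  then have "strict_mono_on S f" by (auto simp: strict_mono_on_def)
  then obtain g where g: "strict_mono g" "surj g" "\<forall>x\<in>S. g x = f x" using insert by blast
  show ?case
  proof (cases "S = {}")
    case True
    have "strict_mono (\<lambda>x. x + (f a - a))" by (auto simp: strict_mono_def)
    moreover have "surj (\<lambda>x::real. x + (f a - a))"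
      by (rule surjI[where f="\<lambda>y. y - (f a - a)"]) simp
    ultimately show ?thesis using True by (intro exI[of _ "\<lambda>x. x + (f a - a)"]) auto
  next
    case False
    define b where "b = Max S"
    have b: "b \<in> S" "\<forall>x\<in>S. x \<le> b" using False insert by (auto simp: b_def)
    have ba: "b < a" using b insert by auto
    have fba: "f b < f a" using insert.prems ba b by (auto simp: strict_mono_on_def)
    define c where "c = (f a - f b) / (a - b)"
    have c: "c > 0" using ba fba by (simp add: c_def)
    have ca: "f b + c * (a - b) = f a" using ba by (simp add: c_def)
    \<comment> \<open>To the right of the old maximum \<open>b\<close>, \<open>g\<close> is replaced
      by the ray through \<open>(b, f b)\<close> and \<open>(a, f a)\<close>; its positive slope
      gives monotonicity and, since it is unbounded, surjectivity.\<close>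
    define k where "k x = (if x \<le> b then g x else f b + c * (x - b))" for x
    have gb: "g b = f b" using g b by auto
    have "strict_mono k"
    proof (rule strict_monoI)
      fix x y :: real assume xy: "x < y"
      show "k x < k y"
      proof (cases "x \<le> b")
        case x: True
        show ?thesis
        proof (cases "y \<le> b")
          case True then show ?thesis using x xy g by (auto simp: k_def strict_mono_def)
        next
          case False
          have "g x \<le> g b" using x g(1) by (simp add: strict_mono_less_eq)
          moreover have "0 < c * (y - b)" using c False by simp
          ultimately show ?thesis using x False gb by (simp add: k_def)
        qed
      next
        case False
        then show ?thesis using xy c by (simp add: k_def)
      qed
    qed
    moreover have "surj k"
    proof -
      have "\<exists>x. k x = y" for y
      proof (cases "y \<le> f b")
        case True
        obtain x where x: "g x = y" using g(2) by (metis surjD)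
        then have "g x \<le> g b" using True gb by simp
        then have "x \<le> b" using g(1) by (simp add: strict_mono_less_eq)
        then show ?thesis using x by (auto simp: k_def)
      next
        case False
        define x where "x = b + (y - f b) / c"
        have "x > b" using False c by (simp add: x_def)
        moreover have "f b + c * (x - b) = y" using c by (simp add: x_def)
        ultimately show ?thesis by (intro exI[of _ x]) (simp add: k_def)
      qed
      then show ?thesis by (metis surjI)
    qed
    moreover have "\<forall>x\<in>insert a S. k x = f x"
      using g(3) b ba ca by (auto simp: k_def)
    ultimately show ?thesis by blast
  qed
qed

lemma sgn_poly_eq_between:
  fixes p :: "real poly"
  assumes "\<And>z. min x y \<le> z \<Longrightarrow> z \<le> max x y \<Longrightarrow> poly p z \<noteq> 0"
  shows "sgn (poly p x) = sgn (poly p y)"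
proof -
  have *: "sgn (poly p u) = sgn (poly p v)"
    if uv: "u \<le> v" "\<And>z. u \<le> z \<Longrightarrow> z \<le> v \<Longrightarrow> poly p z \<noteq> 0" for u v
  proof (cases "u = v")
    case False
    then have "u < v" using uv by simp
    have "\<not> poly p u * poly p v < 0"
      using poly_IVT[OF \<open>u < v\<close>] uv by (meson less_imp_le)
    moreover have "poly p u \<noteq> 0" "poly p v \<noteq> 0" using uv by auto
    ultimately show ?thesis by (auto simp: sgn_real_def mult_less_0_iff)
  qed auto
  show ?thesis
  proof (cases "x \<le> y")
    case True then show ?thesis using assms by (intro *) (auto simp: min_def max_def)
  next
    case False then show ?thesis using assms by (intro *[symmetric]) (auto simp: min_def max_def)
  qed
qed

lemma poly_less_if_pderiv_pos:
  fixes p :: "real poly"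
  assumes "x < y" "\<And>z. x < z \<Longrightarrow> z < y \<Longrightarrow> 0 < poly (pderiv p) z"
  shows "poly p x < poly p y"
proof -
  obtain z where z: "x < z" "z < y" "poly p y - poly p x = (y - x) * poly (pderiv p) z"
    using poly_MVT[OF assms(1)] by blast
  then have "(y - x) * poly (pderiv p) z > 0" using assms by simp
  then show ?thesis using z by linarith
qed

text \<open>The polynomial is nonconstant, hence unbounded at minus infinity; as it increases up to
  \<open>x\<close>, large absolute values there can only be negative.\<close>

lemma poly_neg_on_left_if_pderiv_pos:
  fixes p :: "real poly"
  assumes "\<And>z. z < x \<Longrightarrow> 0 < poly (pderiv p) z"
  shows "\<exists>c<x. poly p c < 0"
proof -
  have "pderiv p \<noteq> 0" using assms[of "x - 1"] by auto
  then have "degree p > 0" by (simp add: pderiv_eq_0_iff)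
  then have "filterlim (poly p) at_infinity at_infinity" by (rule filterlim_poly_at_infinity)
  then have "filterlim (poly p) at_infinity at_bot"
    by (rule filterlim_mono) (auto simp: at_bot_le_at_infinity)
  then have "\<forall>\<^sub>F t in at_bot. \<bar>poly p x\<bar> + 1 \<le> norm (poly p t)"
    using filterlim_at_infinity[of 0 "poly p" at_bot] by auto
  moreover have "\<forall>\<^sub>F t in at_bot. t < x" by (rule eventually_gt_at_bot)
  ultimately have "\<forall>\<^sub>F t in at_bot. t < x \<and> \<bar>poly p x\<bar> + 1 \<le> norm (poly p t)" by eventually_elim auto
  then obtain t where t: "t < x" "\<bar>poly p x\<bar> + 1 \<le> norm (poly p t)"
    using eventually_happens by fastforce
  have "poly p t < poly p x" using t(1) assms by (intro poly_less_if_pderiv_pos) auto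
  then show ?thesis using t by (intro exI[of _ t]) auto
qed

lemma poly_pos_on_right_if_pderiv_pos:
  fixes p :: "real poly"
  assumes "\<And>z. x < z \<Longrightarrow> 0 < poly (pderiv p) z"
  shows "\<exists>c>x. 0 < poly p c"
proof -
  \<comment> \<open>The point reflection \<open>- p (- x)\<close> keeps the derivative positive and
    exchanges the two ends of the line.\<close>
  have "\<exists>c< -x. poly (- pcompose p [:0, -1:]) c < 0"
    by (rule poly_neg_on_left_if_pderiv_pos)
      (use assms in \<open>simp add: pderiv_minus pderiv_pcompose pderiv_pCons poly_pcompose\<close>)
  then obtain c where "c < -x" "0 < poly p (- c)" by (auto simp: poly_pcompose)
  then show ?thesis by (intro exI[of _ "- c"]) auto
qed

lemma finite_pred_below:
  fixes Z :: "'a::linorder set"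
  assumes "finite Z" "\<exists>a\<in>Z. a < x"
  shows "\<exists>a\<in>Z. a < x \<and> (\<forall>z\<in>Z. z < x \<longrightarrow> z \<le> a)"
proof -
  have "Max {z\<in>Z. z < x} \<in> {z\<in>Z. z < x}" using assms by (intro Max_in) auto
  moreover have "\<forall>z\<in>Z. z < x \<longrightarrow> z \<le> Max {z\<in>Z. z < x}" using assms by auto
  ultimately show ?thesis by blast
qed

lemma finite_succ_above:
  fixes Z :: "'a::linorder set"
  assumes "finite Z" "\<exists>a\<in>Z. x < a"
  shows "\<exists>a\<in>Z. x < a \<and> (\<forall>z\<in>Z. x < z \<longrightarrow> a \<le> z)"
proof -
  have "Min {z\<in>Z. x < z} \<in> {z\<in>Z. x < z}" using assms by (intro Min_in) auto
  moreover have "\<forall>z\<in>Z. x < z \<longrightarrow> Min {z\<in>Z. x < z} \<le> z" using assms by auto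
  ultimately show ?thesis by blast
qed

section \<open>Transfer of roots and signs between matched gaps\<close>

text \<open>For \<open>x \<in> Z\<close> this forces \<open>x' = f x\<close>; otherwise, with
  \<open>f\<close> increasing, it places \<open>x\<close> and \<open>x'\<close> in corresponding
  gaps.\<close>

definition same_position :: "real set \<Rightarrow> (real \<Rightarrow> real) \<Rightarrow> real \<Rightarrow> real \<Rightarrow> bool" where
  "same_position Z f x x' \<longleftrightarrow> (\<forall>z\<in>Z. (z < x \<longleftrightarrow> f z < x') \<and> (x < z \<longleftrightarrow> x' < f z))"

lemma pderiv_pos_on_gap:
  fixes p :: "real poly"
  assumes "\<And>x. poly (pderiv p) x = 0 \<Longrightarrow> x \<in> Z" "0 < poly (pderiv p) x"
    and "\<And>z. z \<in> Z \<Longrightarrow> min t x \<le> z \<Longrightarrow> z \<le> max t x \<Longrightarrow> False"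
  shows "0 < poly (pderiv p) t"
proof -
  have "sgn (poly (pderiv p) t) = sgn (poly (pderiv p) x)"
    by (rule sgn_poly_eq_between) (use assms in blast)
  then show ?thesis using assms(2) by (auto simp: sgn_real_def split: if_splits)
qed

text \<open>An interval free of images of \<open>Z\<close> pulls back along \<open>\<theta>\<close>
  to one free of \<open>Z\<close>, where the derivative of \<open>p\<close> keeps its sign.\<close>

lemma pderiv_pos_on_matched_gap:
  fixes p q :: "real poly"
  assumes \<theta>: "strict_mono \<theta>" "surj \<theta>"
    and der: "\<And>x. sgn (poly (pderiv p) x) = sgn (poly (pderiv q) (\<theta> x))"
    and Z0: "\<And>x. poly (pderiv p) x = 0 \<Longrightarrow> x \<in> Z" and x: "0 < poly (pderiv p) x"
    and no_Z: "\<And>z. z \<in> Z \<Longrightarrow> min t' (\<theta> x) \<le> \<theta> z \<Longrightarrow> \<theta> z \<le> max t' (\<theta> x) \<Longrightarrow> False"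
  shows "0 < poly (pderiv q) t'"
proof -
  obtain t where t: "t' = \<theta> t" using \<theta> by (metis surjD)
  have "0 < poly (pderiv p) t"
  proof (rule pderiv_pos_on_gap[OF Z0 x])
    fix z assume z: "z \<in> Z" "min t x \<le> z" "z \<le> max t x"
    have "min t' (\<theta> x) \<le> \<theta> z" "\<theta> z \<le> max t' (\<theta> x)"
      using z(2,3) \<theta>(1) unfolding t
      by (auto simp: min_le_iff_disj le_max_iff_disj strict_mono_less_eq)
    then show False using no_Z z by blast
  qed
  then show ?thesis using der[of t] t by (auto simp: sgn_real_def split: if_splits)
qed

text \<open>The root \<open>\<xi>\<close> lies in a gap of \<open>Z\<close> on which
  \<open>p\<close> increases, and \<open>q\<close> increases on the matching gap. The sign of
  \<open>q\<close> at \<open>\<theta> \<xi>\<close> tells on which side its root must lie; the sign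
  at the adjacent mark, or the behaviour at infinity, guarantees it.\<close>

lemma transfer_root_pos:
  fixes p q :: "real poly"
  assumes \<theta>: "strict_mono \<theta>" "surj \<theta>" and fin: "finite Z"
    and der: "\<And>x. sgn (poly (pderiv p) x) = sgn (poly (pderiv q) (\<theta> x))"
    and Z0: "\<And>x. poly (pderiv p) x = 0 \<Longrightarrow> x \<in> Z"
    and Z: "\<And>z. z \<in> Z \<Longrightarrow> sgn (poly p z) = sgn (poly q (\<theta> z))"
    and \<xi>: "\<xi> \<notin> Z" "poly p \<xi> = 0" "0 < poly (pderiv p) \<xi>"
  shows "\<exists>\<xi>'. poly q \<xi>' = 0 \<and> same_position Z \<theta> \<xi> \<xi>'"
proof -
  have less: "\<theta> x < \<theta> y \<longleftrightarrow> x < y" for x y using \<theta> by (simp add: strict_mono_less)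
  note gap = pderiv_pos_on_gap[OF Z0 \<xi>(3)]
  note gap' = pderiv_pos_on_matched_gap[OF \<theta> der Z0 \<xi>(3)]
  consider "poly q (\<theta> \<xi>) = 0" | "poly q (\<theta> \<xi>) > 0" | "poly q (\<theta> \<xi>) < 0" by linarith
  then show ?thesis
  proof cases
    case 1
    then show ?thesis using less by (auto simp: same_position_def)
  next
    case 2
    show ?thesis
    proof (cases "\<exists>a\<in>Z. a < \<xi>")
      case True
      obtain a where a: "a \<in> Z" "a < \<xi>" "\<And>z. z \<in> Z \<Longrightarrow> z < \<xi> \<Longrightarrow> z \<le> a"
        using finite_pred_below[OF fin] True by blast
      have "poly p a < poly p \<xi>"
      proof (rule poly_less_if_pderiv_pos[OF a(2)], rule gap)
        fix s z assume "a < s" "s < \<xi>" "z \<in> Z" "min s \<xi> \<le> z" "z \<le> max s \<xi>"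
        then show False using a(3)[of z] \<xi>(1) by (cases "z = \<xi>") auto
      qed
      \<comment> \<open>The signs of \<open>p\<close> and \<open>q\<close> agree at marks, and
        \<open>p\<close> has increased from \<open>a\<close> to its root; so a root of
        \<open>q\<close> is caught between \<open>\<theta> a\<close> and
        \<open>\<theta> \<xi>\<close>.\<close>
      then have "poly q (\<theta> a) < 0" using Z[OF a(1)] \<xi> by (auto simp: sgn_real_def split: if_splits)
      then obtain w where w: "\<theta> a < w" "w < \<theta> \<xi>" "poly q w = 0"
        using poly_IVT_pos[of "\<theta> a" "\<theta> \<xi>" q] 2 a(2) less by auto
      have "same_position Z \<theta> \<xi> w"
        unfolding same_position_def
      proof (intro ballI)
        fix z assume z: "z \<in> Z"
        then consider "z \<le> a" "z < \<xi>" | "\<xi> < z" using a(3)[of z] \<xi>(1) a(2) by (cases z \<xi> rule: linorder_cases) auto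
        then show "(z < \<xi>) = (\<theta> z < w) \<and> (\<xi> < z) = (w < \<theta> z)"
        proof cases
          case 1
          then have "\<theta> z \<le> \<theta> a" using \<theta>(1) by (simp add: strict_mono_less_eq)
          then show ?thesis using 1 w by auto
        next
          case 2
          then have "\<theta> \<xi> < \<theta> z" using less by auto
          then show ?thesis using 2 w by auto
        qed
      qed
      then show ?thesis using w by blast
    next
      case False
      then have all: "\<And>z. z \<in> Z \<Longrightarrow> \<xi> < z" using \<xi>(1) by (metis linorder_neqE)
      \<comment> \<open>With no mark to the left, the gap extends to minus infinity and
        \<open>q\<close> increases on the whole half-line.\<close>
      have "\<exists>c<\<theta> \<xi>. poly q c < 0"
      proof (rule poly_neg_on_left_if_pderiv_pos, rule gap')
        fix s z assume "s < \<theta> \<xi>" "z \<in> Z" "min s (\<theta> \<xi>) \<le> \<theta> z" "\<theta> z \<le> max s (\<theta> \<xi>)"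
        then show False using all[of z] less[of \<xi> z] by auto
      qed
      then obtain c where c: "c < \<theta> \<xi>" "poly q c < 0" by auto
      then obtain w where w: "c < w" "w < \<theta> \<xi>" "poly q w = 0"
        using poly_IVT_pos[of c "\<theta> \<xi>" q] 2 by auto
      have "same_position Z \<theta> \<xi> w"
        unfolding same_position_def
      proof (intro ballI)
        fix z assume "z \<in> Z"
        then have "\<xi> < z" "\<theta> \<xi> < \<theta> z" using all less by auto
        then show "(z < \<xi>) = (\<theta> z < w) \<and> (\<xi> < z) = (w < \<theta> z)" using w by auto
      qed
      then show ?thesis using w by blast
    qed
  next
    case 3
    show ?thesis
    proof (cases "\<exists>a\<in>Z. \<xi> < a")
      case True
      obtain a where a: "a \<in> Z" "\<xi> < a" "\<And>z. z \<in> Z \<Longrightarrow> \<xi> < z \<Longrightarrow> a \<le> z"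
        using finite_succ_above[OF fin] True by blast
      have "poly p \<xi> < poly p a"
      proof (rule poly_less_if_pderiv_pos[OF a(2)], rule gap)
        fix s z assume "\<xi> < s" "s < a" "z \<in> Z" "min s \<xi> \<le> z" "z \<le> max s \<xi>"
        then show False using a(3)[of z] \<xi>(1) by (cases "z = \<xi>") auto
      qed
      then have "poly q (\<theta> a) > 0" using Z[OF a(1)] \<xi> by (auto simp: sgn_real_def split: if_splits)
      then obtain w where w: "\<theta> \<xi> < w" "w < \<theta> a" "poly q w = 0"
        using poly_IVT_pos[of "\<theta> \<xi>" "\<theta> a" q] 3 a(2) less by auto
      have "same_position Z \<theta> \<xi> w"
        unfolding same_position_def
      proof (intro ballI)
        fix z assume z: "z \<in> Z"
        then consider "a \<le> z" "\<xi> < z" | "z < \<xi>" using a(3)[of z] \<xi>(1) a(2) by (cases z \<xi> rule: linorder_cases) auto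
        then show "(z < \<xi>) = (\<theta> z < w) \<and> (\<xi> < z) = (w < \<theta> z)"
        proof cases
          case 1
          then have "\<theta> a \<le> \<theta> z" using \<theta>(1) by (simp add: strict_mono_less_eq)
          then show ?thesis using 1 w by auto
        next
          case 2
          then have "\<theta> z < \<theta> \<xi>" using less by auto
          then show ?thesis using 2 w by auto
        qed
      qed
      then show ?thesis using w by blast
    next
      case False
      then have all: "\<And>z. z \<in> Z \<Longrightarrow> z < \<xi>" using \<xi>(1) by (metis linorder_neqE)
      have "\<exists>c>\<theta> \<xi>. 0 < poly q c"
      proof (rule poly_pos_on_right_if_pderiv_pos, rule gap')
        fix s z assume "\<theta> \<xi> < s" "z \<in> Z" "min s (\<theta> \<xi>) \<le> \<theta> z" "\<theta> z \<le> max s (\<theta> \<xi>)"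
        then show False using all[of z] less[of z \<xi>] by auto
      qed
      then obtain c where c: "\<theta> \<xi> < c" "0 < poly q c" by auto
      then obtain w where w: "\<theta> \<xi> < w" "w < c" "poly q w = 0"
        using poly_IVT_pos[of "\<theta> \<xi>" c q] 3 by auto
      have "same_position Z \<theta> \<xi> w"
        unfolding same_position_def
      proof (intro ballI)
        fix z assume "z \<in> Z"
        then have "z < \<xi>" "\<theta> z < \<theta> \<xi>" using all less by auto
        then show "(z < \<xi>) = (\<theta> z < w) \<and> (\<xi> < z) = (w < \<theta> z)" using w by auto
      qed
      then show ?thesis using w by blast
    qed
  qed
qed

lemma transfer_root:
  fixes p q :: "real poly"
  assumes \<theta>: "strict_mono \<theta>" "surj \<theta>" and fin: "finite Z"
    and der: "\<And>x. sgn (poly (pderiv p) x) = sgn (poly (pderiv q) (\<theta> x))"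
    and Z0: "\<And>x. poly (pderiv p) x = 0 \<Longrightarrow> x \<in> Z"
    and Z: "\<And>z. z \<in> Z \<Longrightarrow> sgn (poly p z) = sgn (poly q (\<theta> z))"
    and \<xi>: "\<xi> \<notin> Z" "poly p \<xi> = 0"
  shows "\<exists>\<xi>'. poly q \<xi>' = 0 \<and> same_position Z \<theta> \<xi> \<xi>'"
proof (cases "0 < poly (pderiv p) \<xi>")
  case True
  show ?thesis by (rule transfer_root_pos[OF \<theta> fin der Z0 Z \<xi> True])
next
  case False
  moreover have "poly (pderiv p) \<xi> \<noteq> 0" using Z0 \<xi>(1) by blast
  ultimately have pos: "0 < poly (pderiv (-p)) \<xi>" by (simp add: pderiv_minus)
  have "\<exists>\<xi>'. poly (-q) \<xi>' = 0 \<and> same_position Z \<theta> \<xi> \<xi>'"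
    by (rule transfer_root_pos[OF \<theta> fin _ _ _ \<xi>(1) _ pos])
      (simp_all add: pderiv_minus sgn_minus der Z Z0 \<xi>(2))
  then show ?thesis by simp
qed

text \<open>Now \<open>Z\<close> also contains the roots of \<open>p\<close>. If \<open>p\<close> is
  positive at \<open>x\<close>, it cannot be negative at the mark before \<open>x\<close>, so
  \<open>q\<close> is nonnegative at the image of that mark and increases from there. Without such a
  mark \<open>p\<close> would become negative far to the left and have a root before
  \<open>x\<close>. The other sign is symmetric.\<close>

lemma transfer_sign_pos:
  fixes p q :: "real poly"
  assumes \<theta>: "strict_mono \<theta>" "surj \<theta>" and fin: "finite Z"
    and der: "\<And>x. sgn (poly (pderiv p) x) = sgn (poly (pderiv q) (\<theta> x))"
    and Z0: "\<And>x. poly (pderiv p) x = 0 \<Longrightarrow> x \<in> Z" "\<And>x. poly p x = 0 \<Longrightarrow> x \<in> Z"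
    and Z: "\<And>z. z \<in> Z \<Longrightarrow> sgn (poly p z) = sgn (poly q (\<theta> z))"
    and x: "x \<notin> Z" "0 < poly (pderiv p) x"
  shows "sgn (poly p x) = sgn (poly q (\<theta> x))"
proof -
  have less: "\<theta> x < \<theta> y \<longleftrightarrow> x < y" for x y using \<theta> by (simp add: strict_mono_less)
  note gap = pderiv_pos_on_gap[OF Z0(1) x(2)]
  note gap' = pderiv_pos_on_matched_gap[OF \<theta> der Z0(1) x(2)]
  have "poly p x \<noteq> 0" using Z0 x by auto
  then consider "poly p x > 0" | "poly p x < 0" by linarith
  then show ?thesis
  proof cases
    case 1
    show ?thesis
    proof (cases "\<exists>a\<in>Z. a < x")
      case True
      obtain a where a: "a \<in> Z" "a < x" "\<And>z. z \<in> Z \<Longrightarrow> z < x \<Longrightarrow> z \<le> a"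
        using finite_pred_below[OF fin] True by blast
      have "\<not> poly p a < 0"
      proof
        assume "poly p a < 0"
        then obtain w where "a < w" "w < x" "poly p w = 0" using poly_IVT_pos[OF a(2)] 1 by blast
        then show False using Z0(2)[of w] a(3)[of w] by auto
      qed
      then have "0 \<le> poly q (\<theta> a)" using Z[OF a(1)] by (auto simp: sgn_real_def split: if_splits)
      also have "\<dots> < poly q (\<theta> x)"
      proof (rule poly_less_if_pderiv_pos, use a less in blast, rule gap')
        fix s z assume s: "\<theta> a < s" "s < \<theta> x" "z \<in> Z" "min s (\<theta> x) \<le> \<theta> z" "\<theta> z \<le> max s (\<theta> x)"
        then have "\<theta> a < \<theta> z" "\<theta> z \<le> \<theta> x" by auto
        then have "a < z" "z \<le> x" using less by (auto simp: less not_less[symmetric])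
        then show False using a(3)[of z] s x(1) by (cases "z = x") auto
      qed
      finally show ?thesis using 1 by (simp add: sgn_real_def)
    next
      case False
      then have all: "\<And>z. z \<in> Z \<Longrightarrow> x < z" using x(1) by (metis linorder_neqE)
      have "\<exists>c<x. poly p c < 0"
        by (rule poly_neg_on_left_if_pderiv_pos, rule gap) (auto dest!: all simp: le_max_iff_disj min_le_iff_disj)
      then obtain c where "c < x" "poly p c < 0" by auto
      then obtain w where "w < x" "poly p w = 0" using poly_IVT_pos[of c x p] 1 by auto
      then show ?thesis using Z0(2) all by fastforce
    qed
  next
    case 2
    show ?thesis
    proof (cases "\<exists>a\<in>Z. x < a")
      case True
      obtain a where a: "a \<in> Z" "x < a" "\<And>z. z \<in> Z \<Longrightarrow> x < z \<Longrightarrow> a \<le> z"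
        using finite_succ_above[OF fin] True by blast
      have "\<not> 0 < poly p a"
      proof
        assume "0 < poly p a"
        then obtain w where "x < w" "w < a" "poly p w = 0" using poly_IVT_pos[OF a(2)] 2 by blast
        then show False using Z0(2)[of w] a(3)[of w] by auto
      qed
      then have *: "poly q (\<theta> a) \<le> 0" using Z[OF a(1)] by (auto simp: sgn_real_def split: if_splits)
      have "poly q (\<theta> x) < poly q (\<theta> a)"
      proof (rule poly_less_if_pderiv_pos, use a less in blast, rule gap')
        fix s z assume s: "\<theta> x < s" "s < \<theta> a" "z \<in> Z" "min s (\<theta> x) \<le> \<theta> z" "\<theta> z \<le> max s (\<theta> x)"
        then have "\<theta> x \<le> \<theta> z" "\<theta> z < \<theta> a" by auto
        then have "x \<le> z" "z < a" using less by (auto simp: less not_less[symmetric])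
        then show False using a(3)[of z] s x(1) by (cases "z = x") auto
      qed
      then show ?thesis using 2 * by (simp add: sgn_real_def)
    next
      case False
      then have all: "\<And>z. z \<in> Z \<Longrightarrow> z < x" using x(1) by (metis linorder_neqE)
      have "\<exists>c>x. 0 < poly p c"
        by (rule poly_pos_on_right_if_pderiv_pos, rule gap) (auto dest!: all simp: le_max_iff_disj min_le_iff_disj)
      then obtain c where "x < c" "0 < poly p c" by auto
      then obtain w where "x < w" "poly p w = 0" using poly_IVT_pos[of x c p] 2 by auto
      then show ?thesis using Z0(2) all by fastforce
    qed
  qed
qed

lemma transfer_sign:
  fixes p q :: "real poly"
  assumes \<theta>: "strict_mono \<theta>" "surj \<theta>" and fin: "finite Z"
    and der: "\<And>x. sgn (poly (pderiv p) x) = sgn (poly (pderiv q) (\<theta> x))"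
    and Z0: "\<And>x. poly (pderiv p) x = 0 \<Longrightarrow> x \<in> Z" "\<And>x. poly p x = 0 \<Longrightarrow> x \<in> Z"
    and Z: "\<And>z. z \<in> Z \<Longrightarrow> sgn (poly p z) = sgn (poly q (\<theta> z))"
  shows "sgn (poly p x) = sgn (poly q (\<theta> x))"
proof (cases "x \<in> Z")
  case True then show ?thesis by (rule Z)
next
  case x: False
  show ?thesis
  proof (cases "0 < poly (pderiv p) x")
    case True
    show ?thesis by (rule transfer_sign_pos[OF \<theta> fin der Z0 Z x True])
  next
    case False
    moreover have "poly (pderiv p) x \<noteq> 0" using Z0(1) x by blast
    ultimately have pos: "0 < poly (pderiv (-p)) x" by (simp add: pderiv_minus)
    have "sgn (poly (-p) x) = sgn (poly (-q) (\<theta> x))"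
      by (rule transfer_sign_pos[OF \<theta> fin _ _ _ _ x pos])
        (simp_all add: pderiv_minus sgn_minus der Z Z0)
    then show ?thesis by (simp add: sgn_minus)
  qed
qed

text \<open>
  The induction step of the Cohen--Hoermander algorithm: between consecutive roots of the old polynomials
  \<open>p\<close> is strictly monotone, so its sign diagram is determined by its signs at these roots.
\<close>

lemma sign_matching_insert:
  fixes p q :: "real poly"
  assumes \<theta>: "strict_mono \<theta>" "surj \<theta>" and fin: "finite M"
    and M: "\<And>a b x. (a, b) \<in> M \<Longrightarrow> sgn (poly a x) = sgn (poly b (\<theta> x))"
    and der: "(pderiv p, pderiv q) \<in> M" "pderiv p \<noteq> 0"
    and roots: "\<And>a b x. (a, b) \<in> M \<Longrightarrow> a \<noteq> 0 \<Longrightarrow> poly a x = 0 \<Longrightarrow> sgn (poly p x) = sgn (poly q (\<theta> x))"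
  shows "\<exists>\<eta>. strict_mono \<eta> \<and> surj \<eta> \<and> (\<forall>(a, b)\<in>insert (p, q) M. \<forall>x. sgn (poly a x) = sgn (poly b (\<eta> x)))"
proof -
  have less: "\<theta> x < \<theta> y \<longleftrightarrow> x < y" for x y using \<theta> by (simp add: strict_mono_less)
  \<comment> \<open>The zero polynomial is left out to keep the set of marks finite.\<close>
  define Z where "Z = (\<Union>(a, b)\<in>M. if a = 0 then {} else {x. poly a x = 0})"
  have ZI: "x \<in> Z" if "(a, b) \<in> M" "a \<noteq> 0" "poly a x = 0" for a b x
    using that by (force simp: Z_def)
  have finZ: "finite Z" unfolding Z_def using fin by (auto intro: poly_roots_finite)
  have Zpq: "sgn (poly p z) = sgn (poly q (\<theta> z))" if "z \<in> Z" for z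
    using that roots by (auto simp: Z_def split: if_splits)
  have derZ: "x \<in> Z" if "poly (pderiv p) x = 0" for x using ZI der that by blast
  have p0: "p \<noteq> 0" using der(2) by auto
  define S where "S = Z \<union> {x. poly p x = 0}"
  have finS: "finite S" using finZ p0 by (simp add: S_def poly_roots_finite)
  \<comment> \<open>A new root of \<open>p\<close> goes to a root of \<open>q\<close> in the
    matching gap. This may differ from \<open>\<theta> x\<close>, so the matching map has to be
    rebuilt from its values on the marks.\<close>
  define f where "f x = (if x \<in> Z then \<theta> x else SOME w. poly q w = 0 \<and> same_position Z \<theta> x w)" for x
  have fZ: "f x = \<theta> x" if "x \<in> Z" for x using that by (simp add: f_def)
  have f_new: "poly q (f x) = 0 \<and> same_position Z \<theta> x (f x)" if "x \<notin> Z" "poly p x = 0" for x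
  proof -
    have "\<exists>w. poly q w = 0 \<and> same_position Z \<theta> x w"
      by (rule transfer_root[OF \<theta> finZ M[OF der(1)] derZ Zpq that])
    then have "poly q (SOME w. poly q w = 0 \<and> same_position Z \<theta> x w) = 0 \<and>
        same_position Z \<theta> x (SOME w. poly q w = 0 \<and> same_position Z \<theta> x w)"
      by (rule someI_ex)
    then show ?thesis using that by (simp add: f_def)
  qed
  have f_pos: "same_position Z \<theta> x (f x)" if "x \<in> S" for x
    using that f_new[of x] fZ[of x] less by (cases "x \<in> Z") (auto simp: S_def same_position_def)
  have f_sgn: "sgn (poly p x) = sgn (poly q (f x))" if "x \<in> S" for x
    using that f_new[of x] fZ[of x] Zpq[of x] by (cases "x \<in> Z") (auto simp: S_def)
  have "strict_mono_on S f"
  proof (rule strict_mono_onI)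
    fix u v assume uv: "u \<in> S" "v \<in> S" "u < v"
    show "f u < f v"
    \<comment> \<open>A mark between \<open>u\<close> and \<open>v\<close> orders their images.
      Without one, both are roots of \<open>p\<close>, and the mean value theorem would put a
      critical point, hence a mark, between them.\<close>
    proof (cases "\<exists>z\<in>Z. u \<le> z \<and> z \<le> v")
      case True
      then obtain z where z: "z \<in> Z" "u \<le> z" "z \<le> v" by blast
      have "f u \<le> \<theta> z" using f_pos[OF uv(1)] z fZ[of z] unfolding same_position_def
        by (cases "u = z") force+
      moreover have "\<theta> z \<le> f v" using f_pos[OF uv(2)] z fZ[of z] unfolding same_position_def
        by (cases "v = z") force+
      moreover have "f u < \<theta> z \<or> \<theta> z < f v"
        using f_pos[OF uv(1)] f_pos[OF uv(2)] z uv(3) unfolding same_position_def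
        by (metis order_le_less_trans order_less_le)
      ultimately show ?thesis by auto
    next
      case False
      then have "poly p u = 0" "poly p v = 0" using uv by (auto simp: S_def)
      then obtain w where "u < w" "w < v" "poly (pderiv p) w = 0"
        using poly_MVT[OF uv(3), of p] uv(3) by auto
      then show ?thesis using derZ[of w] False by (meson less_imp_le)
    qed
  qed
  then obtain \<eta> where \<eta>: "strict_mono \<eta>" "surj \<eta>" and \<eta>f: "\<And>x. x \<in> S \<Longrightarrow> \<eta> x = f x"
    using strict_mono_extension[OF finS] by blast
  have less\<eta>: "\<eta> x < \<eta> y \<longleftrightarrow> x < y" for x y using \<eta> by (simp add: strict_mono_less)
  have \<eta>Z: "\<eta> z = \<theta> z" if "z \<in> Z" for z using that \<eta>f fZ by (simp add: S_def)
  have old: "sgn (poly a x) = sgn (poly b (\<eta> x))" if ab: "(a, b) \<in> M" for a b x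
  proof (cases "a = 0 \<or> x \<in> Z")
    case True
    then show ?thesis
    proof
      assume "a = 0"
      obtain w where "\<theta> w = \<eta> x" using \<theta>(2) by (metis surjD)
      then show ?thesis using M[OF ab, of w] \<open>a = 0\<close> by simp
    next
      assume "x \<in> Z"
      then show ?thesis using M[OF ab, of x] \<eta>Z by simp
    qed
  next
    case False
    \<comment> \<open>Roots of \<open>b\<close> are images of marks, on which
      \<open>\<theta>\<close> and \<open>\<eta>\<close> agree; so no root separates
      \<open>\<theta> x\<close> from \<open>\<eta> x\<close>.\<close>
    have "sgn (poly b (\<theta> x)) = sgn (poly b (\<eta> x))"
    proof (rule sgn_poly_eq_between)
      fix w assume w: "min (\<theta> x) (\<eta> x) \<le> w" "w \<le> max (\<theta> x) (\<eta> x)"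
      show "poly b w \<noteq> 0"
      proof
        assume b0: "poly b w = 0"
        obtain z where z: "\<theta> z = w" using \<theta>(2) by (metis surjD)
        have "poly a z = 0" using M[OF ab, of z] z b0 by (simp add: sgn_zero_iff)
        then have zZ: "z \<in> Z" using ZI ab False by blast
        then have "\<eta> z = w" "z \<noteq> x" using z \<eta>Z False by auto
        then show False using w z less[of z x] less[of x z] less\<eta>[of z x] less\<eta>[of x z]
          by (cases z x rule: linorder_cases) auto
      qed
    qed
    then show ?thesis using M[OF ab, of x] by simp
  qed
  have new: "sgn (poly p x) = sgn (poly q (\<eta> x))" for x
  proof (rule transfer_sign[OF \<eta> finS old[OF der(1)]])
    show "sgn (poly p z) = sgn (poly q (\<eta> z))" if "z \<in> S" for z
      using f_sgn[OF that] \<eta>f[OF that] by simp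
  qed (use derZ in \<open>auto simp: S_def\<close>)
  show ?thesis using \<eta> old new by blast
qed

section \<open>Elimination for families with polynomial coefficients\<close>

text \<open>The bound \<open>n\<close> is formal: at special parameters the degree of
  \<open>P y\<close> may be smaller, and the elimination separates these cases by the signs of
  coefficients.\<close>

definition parametric_poly :: "nat \<Rightarrow> ('a::real_normed_vector \<Rightarrow> real poly) \<Rightarrow> bool" where
  "parametric_poly n P \<longleftrightarrow>
     (\<forall>y. \<forall>i>n. coeff (P y) i = 0) \<and> (\<forall>i. real_polynomial_function (\<lambda>y. coeff (P y) i))"

definition sign_equivalent :: "('a \<Rightarrow> real poly) set \<Rightarrow> 'a \<Rightarrow> 'a \<Rightarrow> bool" where
  "sign_equivalent \<P> y y' \<longleftrightarrow>
     (\<exists>\<theta>. strict_mono \<theta> \<and> surj \<theta> \<and> (\<forall>P\<in>\<P>. \<forall>x. sgn (poly (P y) x) = sgn (poly (P y') (\<theta> x))))"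

definition sign_determined :: "('a::real_normed_vector \<Rightarrow> real poly) set \<Rightarrow> bool" where
  "sign_determined \<P> \<longleftrightarrow>
     (\<exists>C. finite C \<and> (\<forall>c\<in>C. real_polynomial_function c) \<and>
        (\<forall>y y'. (\<forall>c\<in>C. sgn (c y) = sgn (c y')) \<longrightarrow> sign_equivalent \<P> y y'))"

lemma parametric_poly_mono: "parametric_poly m P \<Longrightarrow> m \<le> n \<Longrightarrow> parametric_poly n P"
  by (auto simp: parametric_poly_def)

lemma parametric_poly_add:
  "parametric_poly n P \<Longrightarrow> parametric_poly n Q \<Longrightarrow> parametric_poly n (\<lambda>y. P y + Q y)"
  by (auto simp: parametric_poly_def)

text \<open>
  One step of pseudo-division of \<open>P\<close> by the part of \<open>R\<close> of degree at most \<open>m\<close>. The factor of \<open>P\<close> is a square,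
  so that signs at the roots of \<open>R\<close> are preserved. A single step suffices because only the degree
  bound has to drop.
\<close>

definition pseudo_reduct ::
    "('a \<Rightarrow> real poly) \<Rightarrow> nat \<Rightarrow> ('a \<Rightarrow> real poly) \<Rightarrow> nat \<Rightarrow> 'a \<Rightarrow> real poly" where
  "pseudo_reduct R m P d y =
     smult ((coeff (R y) m)\<^sup>2) (P y) -
     monom (coeff (R y) m * coeff (P y) d) (d - m) * poly_cutoff (Suc m) (R y)"

text \<open>At index \<open>Suc d\<close> both terms contribute
  \<open>(coeff (R y) m)^2 * coeff (P y) (Suc d)\<close>, whether or not \<open>m\<close> is the
  degree of \<open>R y\<close>; so the bound drops uniformly in the parameter.\<close>

lemma parametric_poly_pseudo_reduct:
  assumes "parametric_poly n R" "parametric_poly (Suc d) P" "m \<le> Suc d"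
  shows "parametric_poly d (pseudo_reduct R m P (Suc d))"
  unfolding parametric_poly_def
proof (intro conjI allI impI)
  fix y i assume i: "d < i"
  show "coeff (pseudo_reduct R m P (Suc d) y) i = 0"
  proof (cases "i = Suc d")
    case True
    then show ?thesis using assms(3)
      by (auto simp: pseudo_reduct_def coeff_monom_mult coeff_poly_cutoff power2_eq_square)
  next
    case False
    then have "Suc d < i" "\<not> i - (Suc d - m) < Suc m" using i assms(3) by auto
    then show ?thesis using assms by (auto simp: pseudo_reduct_def coeff_monom_mult coeff_poly_cutoff parametric_poly_def)
  qed
next
  fix i
  have *: "real_polynomial_function (\<lambda>y. coeff (R y) j)" "real_polynomial_function (\<lambda>y. coeff (P y) j)" for j
    using assms by (auto simp: parametric_poly_def)
  have "real_polynomial_function (\<lambda>y. coeff (R y) m * coeff (R y) m * coeff (P y) i -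
      (if i < Suc d - m then 0 else coeff (R y) m * coeff (P y) (Suc d) *
        (if i - (Suc d - m) < Suc m then coeff (R y) (i - (Suc d - m)) else 0)))"
    by (cases "i < Suc d - m"; cases "i - (Suc d - m) < Suc m")
      (auto intro!: real_polynomial_function_diff real_polynomial_function.intros(2,4) *)
  then show "real_polynomial_function (\<lambda>y. coeff (pseudo_reduct R m P (Suc d) y) i)"
    by (simp add: pseudo_reduct_def coeff_monom_mult coeff_poly_cutoff power2_eq_square cong: if_cong)
qed

text \<open>At the true degree the cutoff is all of \<open>R y\<close>, so the subtracted multiple
  vanishes at its roots.\<close>

lemma sgn_pseudo_reduct:
  assumes "R y \<noteq> 0" "poly (R y) x = 0"
  shows "sgn (poly (pseudo_reduct R (degree (R y)) P d y) x) = sgn (poly (P y) x)"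
proof -
  have "poly_cutoff (Suc (degree (R y))) (R y) = R y"
    by (intro poly_eqI) (auto simp: coeff_poly_cutoff coeff_eq_0)
  moreover have "sgn ((lead_coeff (R y))\<^sup>2) = 1" using assms by (intro sgn_pos) simp
  moreover have "poly (pseudo_reduct R (degree (R y)) P d y) x = (lead_coeff (R y))\<^sup>2 * poly (P y) x"
    if "poly_cutoff (Suc (degree (R y))) (R y) = R y"
    using assms that by (simp add: pseudo_reduct_def)
  ultimately show ?thesis by (simp only: sgn_mult mult_1_left)
qed

lemma parametric_poly_pderiv:
  assumes "parametric_poly (Suc d) P"
  shows "parametric_poly d (\<lambda>y. pderiv (P y))"
  using assms by (auto simp: parametric_poly_def coeff_pderiv)

lemma parametric_poly_cutoff:
  assumes "parametric_poly (Suc d) P"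
  shows "parametric_poly d (\<lambda>y. poly_cutoff (Suc d) (P y))"
proof -
  have "real_polynomial_function (\<lambda>y. if i < Suc d then coeff (P y) i else 0)" for i
    using assms by (cases "i < Suc d") (auto simp: parametric_poly_def)
  then show ?thesis using assms by (auto simp: parametric_poly_def coeff_poly_cutoff)
qed

text \<open>Where the formal leading coefficient of \<open>P\<close> vanishes, \<open>P\<close> is
  its own cutoff. Elsewhere its derivative is nonzero, the reducts supply the signs of
  \<open>P\<close> at the marks, and \<open>sign_matching_insert\<close> adds \<open>P\<close> to
  the matching.\<close>

lemma sign_determined_step:
  fixes P :: "'a::real_normed_vector \<Rightarrow> real poly"
  assumes P: "parametric_poly (Suc d) P" and \<R>: "finite \<R>" "\<And>R. R \<in> \<R> \<Longrightarrow> parametric_poly (Suc d) R"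
    and cut: "sign_determined (insert (\<lambda>y. poly_cutoff (Suc d) (P y)) \<R>)"
    and \<R>'_def: "\<R>' = insert (\<lambda>y. pderiv (P y)) \<R>"
    and red: "sign_determined (\<R>' \<union> (\<lambda>(R, m). pseudo_reduct R m P (Suc d)) ` (\<R>' \<times> {..Suc d}))"
  shows "sign_determined (insert P \<R>)"
proof -
  have fin: "finite \<R>'" using \<R> by (simp add: \<R>'_def)
  have \<R>': "parametric_poly (Suc d) R" if "R \<in> \<R>'" for R
    using that \<R> parametric_poly_mono[OF parametric_poly_pderiv[OF P]] by (auto simp: \<R>'_def)
  obtain C1 where C1: "finite C1" "\<forall>c\<in>C1. real_polynomial_function c"
    "\<And>y y'. (\<forall>c\<in>C1. sgn (c y) = sgn (c y')) \<Longrightarrow> sign_equivalent (insert (\<lambda>y. poly_cutoff (Suc d) (P y)) \<R>) y y'"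
    using cut unfolding sign_determined_def by blast
  obtain C2 where C2: "finite C2" "\<forall>c\<in>C2. real_polynomial_function c"
    "\<And>y y'. (\<forall>c\<in>C2. sgn (c y) = sgn (c y')) \<Longrightarrow>
       sign_equivalent (\<R>' \<union> (\<lambda>(R, m). pseudo_reduct R m P (Suc d)) ` (\<R>' \<times> {..Suc d})) y y'"
    using red unfolding sign_determined_def by blast
  \<comment> \<open>The leading coefficient decides the case distinction. The other coefficient
    signs fix the degrees of all \<open>R y\<close>, so that the same \<open>m\<close> is the true
    degree at \<open>y\<close> and at \<open>y'\<close>.\<close>
  define C where "C = C1 \<union> C2 \<union> {\<lambda>y. coeff (P y) (Suc d)} \<union> (\<lambda>(R, i) y. coeff (R y) i) ` (\<R>' \<times> {..Suc d})"
  have "finite C" using C1 C2 fin by (simp add: C_def)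
  moreover have "\<forall>c\<in>C. real_polynomial_function c"
    using C1 C2 P \<R>' by (auto simp: C_def parametric_poly_def)
  moreover have "sign_equivalent (insert P \<R>) y y'" if same: "\<forall>c\<in>C. sgn (c y) = sgn (c y')" for y y'
  proof -
    have lead: "sgn (coeff (P y) (Suc d)) = sgn (coeff (P y') (Suc d))" using same by (auto simp: C_def)
    have coeffs: "sgn (coeff (R y) i) = sgn (coeff (R y') i)" if "R \<in> \<R>'" for R i
    proof (cases "i \<le> Suc d")
      case True
      then have "(\<lambda>y. coeff (R y) i) \<in> C" using that by (force simp: C_def)
      then show ?thesis using same by (auto dest: bspec)
    next
      case False
      then show ?thesis using \<R>'[OF that] by (simp add: parametric_poly_def)
    qed
    show ?thesis
    proof (cases "coeff (P y) (Suc d) = 0")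
      case True
      have "coeff (P y') (Suc d) = 0" using True lead by (simp add: sgn_zero_iff)
      then have eq: "poly_cutoff (Suc d) (P y) = P y" "poly_cutoff (Suc d) (P y') = P y'"
        using True P by (auto intro!: poly_eqI simp: coeff_poly_cutoff parametric_poly_def)
          (metis less_antisym linorder_neqE_nat)+
      have "sign_equivalent (insert (\<lambda>y. poly_cutoff (Suc d) (P y)) \<R>) y y'"
        using same by (intro C1) (auto simp: C_def)
      then show ?thesis using eq by (simp add: sign_equivalent_def)
    next
      case False
      have "sign_equivalent (\<R>' \<union> (\<lambda>(R, m). pseudo_reduct R m P (Suc d)) ` (\<R>' \<times> {..Suc d})) y y'"
        using same by (intro C2) (auto simp: C_def)
      then obtain \<theta> where \<theta>: "strict_mono \<theta>" "surj \<theta>"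
        and \<theta>1: "\<And>R x. R \<in> \<R>' \<Longrightarrow> sgn (poly (R y) x) = sgn (poly (R y') (\<theta> x))"
        and \<theta>2: "\<And>R m x. R \<in> \<R>' \<Longrightarrow> m \<le> Suc d \<Longrightarrow> sgn (poly (pseudo_reduct R m P (Suc d) y) x) =
          sgn (poly (pseudo_reduct R m P (Suc d) y') (\<theta> x))"
        unfolding sign_equivalent_def by (force simp: image_iff)
      define M where "M = (\<lambda>R. (R y, R y')) ` \<R>'"
      have "\<exists>\<eta>. strict_mono \<eta> \<and> surj \<eta> \<and>
          (\<forall>(a, b)\<in>insert (P y, P y') M. \<forall>x. sgn (poly a x) = sgn (poly b (\<eta> x)))"
      proof (rule sign_matching_insert[OF \<theta>])
        show "finite M" using fin by (simp add: M_def)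
        show "(pderiv (P y), pderiv (P y')) \<in> M" by (force simp: M_def \<R>'_def)
        have "coeff (pderiv (P y)) d \<noteq> 0" using False by (simp add: coeff_pderiv)
        then show "pderiv (P y) \<noteq> 0" by auto
        show "sgn (poly a x) = sgn (poly b (\<theta> x))" if "(a, b) \<in> M" for a b x
          using that \<theta>1 by (auto simp: M_def)
        show "sgn (poly (P y) x) = sgn (poly (P y') (\<theta> x))"
          if ab: "(a, b) \<in> M" "a \<noteq> 0" "poly a x = 0" for a b x
        proof -
          obtain R where R: "R \<in> \<R>'" "a = R y" "b = R y'" using ab(1) by (auto simp: M_def)
          have nz: "coeff a i = 0 \<longleftrightarrow> coeff b i = 0" for i
            using coeffs[OF R(1), of i] R by (metis sgn_zero_iff)
          have deg: "degree b = degree a" by (simp add: degree_def nz)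
          have b0: "b \<noteq> 0" using nz[of "degree a"] ab(2) by auto
          have "poly b (\<theta> x) = 0" using \<theta>1[OF R(1), of x] R ab(3) by (simp add: sgn_zero_iff)
          then have "sgn (poly (P y') (\<theta> x)) = sgn (poly (pseudo_reduct R (degree (R y)) P (Suc d) y') (\<theta> x))"
            using sgn_pseudo_reduct[of R y' "\<theta> x" P "Suc d"] R b0 deg by simp
          also have "\<dots> = sgn (poly (pseudo_reduct R (degree (R y)) P (Suc d) y) x)"
          proof (rule \<theta>2[OF R(1), symmetric])
            show "degree (R y) \<le> Suc d" using \<R>'[OF R(1)] by (intro degree_le) (auto simp: parametric_poly_def)
          qed
          also have "\<dots> = sgn (poly (P y) x)" using sgn_pseudo_reduct R ab by metis
          finally show ?thesis by simp
        qed
      qed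
      then obtain \<eta> where "strict_mono \<eta>" "surj \<eta>"
        "\<forall>(a, b)\<in>insert (P y, P y') M. \<forall>x. sgn (poly a x) = sgn (poly b (\<eta> x))" by blast
      then show ?thesis unfolding sign_equivalent_def M_def \<R>'_def by (intro exI[of _ \<eta>]) auto
    qed
  qed
  ultimately show ?thesis unfolding sign_determined_def by blast
qed

lemma sign_determined_0:
  assumes "finite \<P>" "\<And>P. P \<in> \<P> \<Longrightarrow> parametric_poly 0 P"
  shows "sign_determined \<P>"
proof -
  have const: "P y = [:coeff (P y) 0:]" if "P \<in> \<P>" for P y
    using assms(2)[OF that] by (intro poly_eqI) (auto simp: parametric_poly_def coeff_pCons split: nat.splits)
  have "sign_equivalent \<P> y y'" if "\<forall>c\<in>(\<lambda>P y. coeff (P y) 0) ` \<P>. sgn (c y) = sgn (c y')" for y y'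
  proof -
    have "sgn (poly (P y) x) = sgn (poly (P y') x)" if P: "P \<in> \<P>" for P x
    proof -
      have "poly (P u) x = coeff (P u) 0" for u by (subst const[OF P]) simp
      then show ?thesis using that P \<open>\<forall>c\<in>_. _\<close> by auto
    qed
    moreover have "strict_mono (\<lambda>x::real. x)" "surj (\<lambda>x::real. x)" by (auto simp: strict_mono_def)
    ultimately show ?thesis unfolding sign_equivalent_def by blast
  qed
  then show ?thesis using assms unfolding sign_determined_def
    by (intro exI[of _ "(\<lambda>P y. coeff (P y) 0) ` \<P>"]) (auto simp: parametric_poly_def)
qed

text \<open>
  Lexicographic induction on the degree bound and the number of polynomials attaining it: a step
  trades one polynomial of degree \<open>Suc d\<close> for finitely many of degree \<open>d\<close>.
\<close>

lemma sign_determined_parametric_poly: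
  assumes "finite \<P>" "\<And>P. P \<in> \<P> \<Longrightarrow> parametric_poly d P"
  shows "sign_determined \<P>"
  using assms
proof (induction d arbitrary: \<P>)
  case 0
  then show ?case by (rule sign_determined_0)
next
  case (Suc d)
  have "sign_determined (\<S> \<union> \<R>)"
    if "finite \<S>" "\<forall>P\<in>\<S>. parametric_poly (Suc d) P" "finite \<R>" "\<forall>P\<in>\<R>. parametric_poly d P"
    for \<S> \<R> :: "('a \<Rightarrow> real poly) set"
    using that
  proof (induction \<S> arbitrary: \<R> rule: finite_induct)
    case empty
    then show ?case using Suc.IH by simp
  next
    case (insert P \<S>)
    have P: "parametric_poly (Suc d) P" using insert by simp
    have all: "parametric_poly (Suc d) R" if "R \<in> \<S> \<union> \<R>" for R
      using that insert.prems parametric_poly_mono by fastforce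
    \<comment> \<open>The derivative joins the divisors, because the sign of \<open>P\<close> is
      also needed at its own critical points.\<close>
    define \<Q> where "\<Q> = insert (\<lambda>y. pderiv (P y)) (\<S> \<union> \<R>)"
    have \<Q>: "finite \<Q>" "parametric_poly (Suc d) R" if "R \<in> \<Q>" for R
      using that all insert parametric_poly_mono[OF parametric_poly_pderiv[OF P]] by (auto simp: \<Q>_def)
    have finQ: "finite \<Q>" using insert by (simp add: \<Q>_def)
    let ?red = "(\<lambda>(R, m). pseudo_reduct R m P (Suc d)) ` (\<Q> \<times> {..Suc d})"
    have "sign_determined (\<S> \<union> insert (\<lambda>y. poly_cutoff (Suc d) (P y)) \<R>)"
      using insert.prems by (intro insert.IH) (auto intro: parametric_poly_cutoff)
    then have 1: "sign_determined (insert (\<lambda>y. poly_cutoff (Suc d) (P y)) (\<S> \<union> \<R>))" by simp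
    \<comment> \<open>The derivative and all reducts have degree bound \<open>d\<close>: they
      enlarge only the second set, while \<open>P\<close> has left the first.\<close>
    have "sign_determined (\<S> \<union> (insert (\<lambda>y. pderiv (P y)) \<R> \<union> ?red))"
    proof (rule insert.IH)
      show "\<forall>P'\<in>insert (\<lambda>y. pderiv (P y)) \<R> \<union> ?red. parametric_poly d P'"
        using insert.prems parametric_poly_pderiv[OF P] parametric_poly_pseudo_reduct[OF \<Q>(2) P]
        by auto
    qed (use insert.prems finQ in auto)
    then have 2: "sign_determined (\<Q> \<union> ?red)" by (simp add: \<Q>_def Un_assoc)
    have "sign_determined (insert P (\<S> \<union> \<R>))"
      by (rule sign_determined_step[OF P _ all 1 \<Q>_def 2]) (use insert in auto)
    then show ?case by simp
  qed
  from this[of \<P> "{}"] show ?case using Suc.prems by simp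
qed

section \<open>The Tarski--Seidenberg theorem\<close>

definition basic_semialgebraic :: "('a \<Rightarrow> real) set \<times> ('a \<Rightarrow> real) set \<Rightarrow> 'a set" where
  "basic_semialgebraic i = {x. (\<forall>p\<in>fst i. p x = 0) \<and> (\<forall>q\<in>snd i. 0 < q x)}"

definition finite_polynomial_pair :: "('a::real_normed_vector \<Rightarrow> real) set \<times> ('a \<Rightarrow> real) set \<Rightarrow> bool" where
  "finite_polynomial_pair i \<longleftrightarrow>
     finite (fst i) \<and> finite (snd i) \<and> (\<forall>p\<in>fst i \<union> snd i. real_polynomial_function p)"

lemma semialgebraic_iff:
  "semialgebraic S \<longleftrightarrow> (\<exists>F. finite F \<and> (\<forall>i\<in>F. finite_polynomial_pair i) \<and> S = (\<Union>i\<in>F. basic_semialgebraic i))"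
  unfolding semialgebraic_def basic_semialgebraic_def finite_polynomial_pair_def
  by (simp add: case_prod_unfold)

lemma semialgebraic_basic: "finite_polynomial_pair i \<Longrightarrow> semialgebraic (basic_semialgebraic i)"
  unfolding semialgebraic_iff by (intro exI[of _ "{i}"]) simp

lemma semialgebraic_empty: "semialgebraic {}"
  unfolding semialgebraic_iff by (intro exI[of _ "{}"]) simp

lemma semialgebraic_UNIV: "semialgebraic UNIV"
  using semialgebraic_basic[of "({}, {})"] by (simp add: basic_semialgebraic_def finite_polynomial_pair_def)

lemma semialgebraic_Un:
  assumes "semialgebraic S" "semialgebraic T"
  shows "semialgebraic (S \<union> T)"
proof -
  obtain F G where "finite F" "\<forall>i\<in>F. finite_polynomial_pair i" "S = (\<Union>i\<in>F. basic_semialgebraic i)"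
    "finite G" "\<forall>i\<in>G. finite_polynomial_pair i" "T = (\<Union>i\<in>G. basic_semialgebraic i)"
    using assms unfolding semialgebraic_iff by auto
  then show ?thesis unfolding semialgebraic_iff
    by (intro exI[of _ "F \<union> G"]) (simp add: UN_Un ball_Un)
qed

lemma semialgebraic_UN:
  assumes "finite I" "\<And>i. i \<in> I \<Longrightarrow> semialgebraic (S i)"
  shows "semialgebraic (\<Union>i\<in>I. S i)"
  using assms by (induction I rule: finite_induct) (auto intro: semialgebraic_Un semialgebraic_empty)

lemma semialgebraic_Int:
  assumes "semialgebraic S" "semialgebraic T"
  shows "semialgebraic (S \<inter> T)"
proof -
  obtain F G where F: "finite F" "\<forall>i\<in>F. finite_polynomial_pair i" "S = (\<Union>i\<in>F. basic_semialgebraic i)"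
    and G: "finite G" "\<forall>i\<in>G. finite_polynomial_pair i" "T = (\<Union>i\<in>G. basic_semialgebraic i)"
    using assms unfolding semialgebraic_iff by auto
  have Int: "basic_semialgebraic i \<inter> basic_semialgebraic j =
      basic_semialgebraic (fst i \<union> fst j, snd i \<union> snd j)" for i j :: "('a \<Rightarrow> real) set \<times> ('a \<Rightarrow> real) set"
    by (auto simp: basic_semialgebraic_def)
  have "semialgebraic (\<Union>i\<in>F. \<Union>j\<in>G. basic_semialgebraic i \<inter> basic_semialgebraic j)"
    using F(2) G(2) unfolding Int
    by (intro semialgebraic_UN[OF F(1)] semialgebraic_UN[OF G(1)] semialgebraic_basic)
      (auto simp: finite_polynomial_pair_def)
  also have "(\<Union>i\<in>F. \<Union>j\<in>G. basic_semialgebraic i \<inter> basic_semialgebraic j) = S \<inter> T"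
    unfolding F(3) G(3) by blast
  finally show ?thesis .
qed

lemma semialgebraic_INT:
  assumes "finite I" "\<And>i. i \<in> I \<Longrightarrow> semialgebraic (S i)"
  shows "semialgebraic (\<Inter>i\<in>I. S i)"
  using assms by (induction I rule: finite_induct) (auto intro: semialgebraic_Int semialgebraic_UNIV)

lemma semialgebraic_pos: "real_polynomial_function p \<Longrightarrow> semialgebraic {x. 0 < p x}"
  using semialgebraic_basic[of "({}, {p})"] by (simp add: basic_semialgebraic_def finite_polynomial_pair_def)

lemma semialgebraic_zero: "real_polynomial_function p \<Longrightarrow> semialgebraic {x. p x = 0}"
  using semialgebraic_basic[of "({p}, {})"] by (simp add: basic_semialgebraic_def finite_polynomial_pair_def)

lemma semialgebraic_neg: "real_polynomial_function p \<Longrightarrow> semialgebraic {x. p x < 0}"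
  using semialgebraic_pos[of "\<lambda>x. - p x"] by auto

lemma semialgebraic_Compl:
  assumes "semialgebraic S"
  shows "semialgebraic (- S)"
proof -
  obtain F where F: "finite F" "\<forall>i\<in>F. finite_polynomial_pair i" "S = (\<Union>i\<in>F. basic_semialgebraic i)"
    using assms unfolding semialgebraic_iff by blast
  have Compl: "- basic_semialgebraic i =
      (\<Union>p\<in>fst i. {x. 0 < p x} \<union> {x. p x < 0}) \<union> (\<Union>q\<in>snd i. {x. q x = 0} \<union> {x. q x < 0})"
    for i :: "('a \<Rightarrow> real) set \<times> ('a \<Rightarrow> real) set"
    unfolding basic_semialgebraic_def by (auto simp: not_less le_less)
  have "semialgebraic (- basic_semialgebraic i)" if "i \<in> F" for i
    using F(2) that unfolding Compl
    by (intro semialgebraic_UN semialgebraic_Un semialgebraic_pos semialgebraic_neg semialgebraic_zero)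
      (auto simp: finite_polynomial_pair_def)
  then have "semialgebraic (\<Inter>i\<in>F. - basic_semialgebraic i)" by (rule semialgebraic_INT[OF F(1)])
  then show ?thesis unfolding F(3) by simp
qed

lemma semialgebraic_vimage:
  assumes "semialgebraic S" "polynomial_function f"
  shows "semialgebraic (f -` S)"
proof -
  obtain F where F: "finite F" "\<forall>i\<in>F. finite_polynomial_pair i" "S = (\<Union>i\<in>F. basic_semialgebraic i)"
    using assms(1) unfolding semialgebraic_iff by blast
  have vimage: "f -` basic_semialgebraic i =
      basic_semialgebraic ((\<lambda>p. p \<circ> f) ` fst i, (\<lambda>p. p \<circ> f) ` snd i)" for i
    by (auto simp: basic_semialgebraic_def)
  have "semialgebraic (\<Union>i\<in>F. f -` basic_semialgebraic i)"
    using F(2) real_polynomial_function_compose[OF assms(2)] unfolding vimage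
    by (intro semialgebraic_UN[OF F(1)] semialgebraic_basic) (auto simp: finite_polynomial_pair_def)
  then show ?thesis unfolding F(3) by (simp add: vimage_UN)
qed

lemma semialgebraic_sgn:
  assumes "real_polynomial_function c"
  shows "semialgebraic {y. sgn (c y) = s}"
proof -
  consider "s = 1" | "s = 0" | "s = -1" | "s \<notin> {1, 0, -1}" by blast
  then show ?thesis
  proof cases
    case 1
    then have "{y. sgn (c y) = s} = {y. 0 < c y}" by (auto simp: sgn_real_def)
    then show ?thesis using semialgebraic_pos assms by simp
  next
    case 2
    then have "{y. sgn (c y) = s} = {y. c y = 0}" by (auto simp: sgn_real_def)
    then show ?thesis using semialgebraic_zero assms by simp
  next
    case 3
    then have "{y. sgn (c y) = s} = {y. c y < 0}" by (auto simp: sgn_real_def)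
    then show ?thesis using semialgebraic_neg assms by simp
  next
    case 4
    then have "{y. sgn (c y) = s} = {}" by (auto simp: sgn_real_def)
    then show ?thesis using semialgebraic_empty by simp
  qed
qed

text \<open>Such a \<open>T\<close> is a union of sign cells. Patterns are restricted to
  \<open>C\<close> so that they range over a finite extensional function space.\<close>

lemma semialgebraic_if_sign_invariant:
  assumes C: "finite C" "\<And>c. c \<in> C \<Longrightarrow> real_polynomial_function c"
    and T: "\<And>y y'. y \<in> T \<Longrightarrow> (\<And>c. c \<in> C \<Longrightarrow> sgn (c y) = sgn (c y')) \<Longrightarrow> y' \<in> T"
  shows "semialgebraic T"
proof -
  define \<Sigma> where "\<Sigma> = (\<lambda>y. \<lambda>c\<in>C. sgn (c y)) ` T"
  have "sgn x \<in> {-1, 0, 1}" for x :: real by (simp add: sgn_real_def)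
  then have "\<Sigma> \<subseteq> C \<rightarrow>\<^sub>E {-1, 0, 1}" unfolding \<Sigma>_def by fastforce
  then have fin: "finite \<Sigma>" using C(1) by (meson finite.intros finite_PiE finite_subset)
  have "T = (\<Union>\<sigma>\<in>\<Sigma>. \<Inter>c\<in>C. {y. sgn (c y) = \<sigma> c})"
  proof (intro equalityI subsetI)
    fix y assume "y \<in> (\<Union>\<sigma>\<in>\<Sigma>. \<Inter>c\<in>C. {y. sgn (c y) = \<sigma> c})"
    then obtain z where "z \<in> T" "\<And>c. c \<in> C \<Longrightarrow> sgn (c z) = sgn (c y)" by (auto simp: \<Sigma>_def)
    then show "y \<in> T" by (rule T)
  next
    fix y assume "y \<in> T"
    then have "(\<lambda>c\<in>C. sgn (c y)) \<in> \<Sigma>" by (simp add: \<Sigma>_def)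
    then show "y \<in> (\<Union>\<sigma>\<in>\<Sigma>. \<Inter>c\<in>C. {y. sgn (c y) = \<sigma> c})"
      by (rule UN_I) auto
  qed
  moreover have "semialgebraic (\<Union>\<sigma>\<in>\<Sigma>. \<Inter>c\<in>C. {y. sgn (c y) = \<sigma> c})"
    using C by (intro semialgebraic_UN[OF fin] semialgebraic_INT semialgebraic_sgn) auto
  ultimately show ?thesis by simp
qed

lemma parametric_poly_mult:
  assumes "parametric_poly m P" "parametric_poly n Q"
  shows "parametric_poly (m + n) (\<lambda>y. P y * Q y)"
proof -
  have "coeff (P y * Q y) i = 0" if "m + n < i" for y i
  proof (rule coeff_eq_0)
    have "degree (P y) \<le> m" "degree (Q y) \<le> n"
      using assms by (auto simp: parametric_poly_def intro: degree_le)
    then show "degree (P y * Q y) < i" using degree_mult_le[of "P y" "Q y"] that by linarith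
  qed
  moreover have "real_polynomial_function (\<lambda>y. coeff (P y * Q y) i)" for i
    using assms unfolding coeff_mult parametric_poly_def
    by (intro real_polynomial_function_sum real_polynomial_function.intros(4)) auto
  ultimately show ?thesis by (simp add: parametric_poly_def)
qed

lemma parametric_poly_of_polynomial_function:
  fixes p :: "'a::real_normed_vector \<times> real \<Rightarrow> real"
  assumes "real_polynomial_function p"
  shows "\<exists>n P. parametric_poly n P \<and> (\<forall>y t. p (y, t) = poly (P y) t)"
  using assms
proof (induction p rule: real_polynomial_function.induct)
  case (linear f)
  have "f (y, t) = poly [:f (y, 0), f (0, 1):] t" for y t
  proof -
    have "f (y, t) = f ((y, 0) + t *\<^sub>R (0, 1))" by simp
    also have "\<dots> = f (y, 0) + t * f (0, 1)"
      using linear by (simp only: linear_simps) simp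
    finally show ?thesis by (simp only: poly_pCons poly_0) simp
  qed
  moreover have "real_polynomial_function (\<lambda>y. f (y, 0))"
    using linear by (intro real_polynomial_function.intros(1) bounded_linear_compose[OF linear] bounded_linear_Pair bounded_linear_ident bounded_linear_zero)
  then have coeff: "real_polynomial_function (\<lambda>y. coeff [:f (y, 0), f (0, 1):] i)" for i
  proof (cases i)
    case (Suc j)
    then show ?thesis by (cases j) (simp_all add: coeff_pCons real_polynomial_function.intros(2))
  qed simp
  have "parametric_poly 1 (\<lambda>y. [:f (y, 0), f (0, 1):])"
    unfolding parametric_poly_def by (intro conjI allI impI) (simp add: coeff_eq_0, rule coeff)
  ultimately show ?case by blast
next
  case (const c)
  have coeff: "real_polynomial_function (\<lambda>y::'a. coeff [:c:] i)" for i
    by (rule real_polynomial_function.intros(2))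
  have "parametric_poly 0 (\<lambda>y::'a. [:c:])"
    unfolding parametric_poly_def by (intro conjI allI impI) (simp add: coeff_eq_0, rule coeff)
  then show ?case by (intro exI[of _ 0] exI[of _ "\<lambda>y. [:c:]"]) simp
next
  case (add f g)
  then obtain m P n Q where "parametric_poly m P" "\<forall>y t. f (y, t) = poly (P y) t"
    "parametric_poly n Q" "\<forall>y t. g (y, t) = poly (Q y) t" by blast
  then show ?case
    by (intro exI[of _ "max m n"] exI[of _ "\<lambda>y. P y + Q y"])
      (auto intro!: parametric_poly_add intro: parametric_poly_mono)
next
  case (mult f g)
  then obtain m P n Q where "parametric_poly m P" "\<forall>y t. f (y, t) = poly (P y) t"
    "parametric_poly n Q" "\<forall>y t. g (y, t) = poly (Q y) t" by blast
  then show ?case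
    by (intro exI[of _ "m + n"] exI[of _ "\<lambda>y. P y * Q y"]) (auto intro: parametric_poly_mult)
qed

text \<open>The matching of sign diagrams carries a point \<open>t\<close> of the fiber over
  \<open>y\<close> to a point \<open>\<theta> t\<close> of the fiber over any \<open>y'\<close> with
  the same signs, so membership in the projection depends on these signs alone.\<close>

theorem Tarski_Seidenberg_real:
  fixes S :: "('a::euclidean_space \<times> real) set"
  assumes "semialgebraic S"
  shows "semialgebraic (fst ` S)"
proof -
  obtain F where F: "finite F" "\<forall>i\<in>F. finite_polynomial_pair i" "S = (\<Union>i\<in>F. basic_semialgebraic i)"
    using assms unfolding semialgebraic_iff by blast
  define G where "G = (\<Union>i\<in>F. fst i \<union> snd i)"
  have finG: "finite G" using F by (auto simp: G_def finite_polynomial_pair_def)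
  define N where "N p = (SOME n. \<exists>P. parametric_poly n P \<and> (\<forall>y t. p (y, t) = poly (P y) t))"
    for p :: "'a \<times> real \<Rightarrow> real"
  define R where "R p = (SOME P. parametric_poly (N p) P \<and> (\<forall>y t. p (y, t) = poly (P y) t))"
    for p :: "'a \<times> real \<Rightarrow> real"
  have NR: "parametric_poly (N p) (R p) \<and> (\<forall>y t. p (y, t) = poly (R p y) t)" if "p \<in> G" for p
  proof -
    have "real_polynomial_function p" using F(2) that by (auto simp: G_def finite_polynomial_pair_def)
    from someI_ex[OF parametric_poly_of_polynomial_function[OF this], folded N_def]
    show ?thesis unfolding R_def by (rule someI_ex)
  qed
  have R: "parametric_poly (N p) (R p)" "p (y, t) = poly (R p y) t" if "p \<in> G" for p y t
    using NR[OF that] by blast+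
  have "sign_determined (R ` G)"
  proof (rule sign_determined_parametric_poly)
    show "finite (R ` G)" using finG by simp
    fix P assume "P \<in> R ` G"
    then obtain p where p: "p \<in> G" "P = R p" by blast
    show "parametric_poly (Max (N ` G)) P"
      unfolding p(2) using p(1) finG by (intro parametric_poly_mono[OF R(1)]) simp_all
  qed
  then obtain C where C: "finite C" "\<forall>c\<in>C. real_polynomial_function c"
    "\<And>y y'. (\<forall>c\<in>C. sgn (c y) = sgn (c y')) \<Longrightarrow> sign_equivalent (R ` G) y y'"
    unfolding sign_determined_def by blast
  show ?thesis
  proof (rule semialgebraic_if_sign_invariant[OF C(1)])
    fix y y' assume y: "y \<in> fst ` S" and same: "\<And>c. c \<in> C \<Longrightarrow> sgn (c y) = sgn (c y')"
    obtain t i where t: "i \<in> F" "\<forall>p\<in>fst i. p (y, t) = 0" "\<forall>q\<in>snd i. 0 < q (y, t)"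
      using y F(3) by (auto simp: basic_semialgebraic_def)
    obtain \<theta> where \<theta>: "\<And>p x. p \<in> G \<Longrightarrow> sgn (poly (R p y) x) = sgn (poly (R p y') (\<theta> x))"
      using C(3)[of y y'] same unfolding sign_equivalent_def by blast
    have sg: "sgn (p (y, t)) = sgn (p (y', \<theta> t))" if "p \<in> fst i \<union> snd i" for p
    proof -
      have "p \<in> G" using that t(1) by (auto simp: G_def)
      then show ?thesis using \<theta>[of p t] by (simp only: R(2)[of p])
    qed
    have "p (y', \<theta> t) = 0" if "p \<in> fst i" for p
    proof -
      have "p (y, t) = 0" using t(2) that by blast
      then show ?thesis using sg[of p] that by (simp add: sgn_zero_iff)
    qed
    moreover have "0 < q (y', \<theta> t)" if "q \<in> snd i" for q
    proof -
      have "0 < q (y, t)" using t(3) that by blast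
      then show ?thesis using sg[of q] that by (simp add: sgn_real_def split: if_splits)
    qed
    ultimately have "(y', \<theta> t) \<in> S" using t(1) F(3) by (auto simp: basic_semialgebraic_def)
    then show "y' \<in> fst ` S" by force
  qed (use C in auto)
qed

section \<open>Closure under first-order definitions\<close>

lemma polynomial_function_fst: "polynomial_function f \<Longrightarrow> polynomial_function (\<lambda>x. fst (f x))"
  using polynomial_function_compose[OF _ polynomial_function_bounded_linear[OF bounded_linear_fst]]
  by (simp only: o_def)

lemma polynomial_function_snd: "polynomial_function f \<Longrightarrow> polynomial_function (\<lambda>x. snd (f x))"
  using polynomial_function_compose[OF _ polynomial_function_bounded_linear[OF bounded_linear_snd]]
  by (simp only: o_def)

lemma polynomial_function_Pair:
  assumes "polynomial_function f" "polynomial_function g"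
  shows "polynomial_function (\<lambda>x. (f x, g x))"
  unfolding polynomial_function_def o_def
proof (intro allI impI)
  fix h :: "'b \<times> 'c \<Rightarrow> real" assume h: "bounded_linear h"
  have "h (f x, g x) = h (f x, 0) + h (0, g x)" for x
    using linear_add[OF bounded_linear.linear[OF h], of "(f x, 0)" "(0, g x)"] by simp
  then have eq: "(\<lambda>x. h (f x, g x)) = (\<lambda>x. h (f x, 0) + h (0, g x))" by blast
  have "bounded_linear (\<lambda>u. h (u, 0))" "bounded_linear (\<lambda>u. h (0, u))"
    by (intro bounded_linear_compose[OF h] bounded_linear_Pair bounded_linear_ident bounded_linear_zero)+
  then have "real_polynomial_function (\<lambda>x. h (f x, 0))" "real_polynomial_function (\<lambda>x. h (0, g x))"
    using assms unfolding polynomial_function_def o_def by blast+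
  then show "real_polynomial_function (\<lambda>x. h (f x, g x))"
    unfolding eq by (rule real_polynomial_function.intros(3))
qed

lemma polynomial_function_inner:
  fixes f g :: "'a::real_normed_vector \<Rightarrow> 'b::euclidean_space"
  assumes "polynomial_function f" "polynomial_function g"
  shows "polynomial_function (\<lambda>x. f x \<bullet> g x)"
proof -
  have "real_polynomial_function (\<lambda>x. \<Sum>b\<in>Basis. (f x \<bullet> b) * (g x \<bullet> b))"
    by (intro real_polynomial_function_sum real_polynomial_function.intros(4) finite_Basis
        polynomial_function_iff_Basis_inner[THEN iffD1, rule_format] assms)
  then show ?thesis by (simp only: euclidean_inner[symmetric] real_polynomial_function_eq)
qed

lemma polynomial_function_times:
  fixes f g :: "'a::real_normed_vector \<Rightarrow> real"
  shows "polynomial_function f \<Longrightarrow> polynomial_function g \<Longrightarrow> polynomial_function (\<lambda>x. f x * g x)"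
  using polynomial_function_mult[of f g] by (simp only: real_scaleR_def)

lemma polynomial_function_power:
  fixes f :: "'a::real_normed_vector \<Rightarrow> real"
  shows "polynomial_function f \<Longrightarrow> polynomial_function (\<lambda>x. f x ^ n)"
  using real_polynomial_function_power[of f n] by (simp only: real_polynomial_function_eq)

lemmas polynomial_intros =
  polynomial_function_const polynomial_function_id polynomial_function_fst polynomial_function_snd
  polynomial_function_Pair polynomial_function_inner polynomial_function_times polynomial_function_power
  polynomial_function_add polynomial_function_diff polynomial_function_minus polynomial_function_mult

lemma semialgebraic_ex_real:
  fixes P :: "'a::euclidean_space \<Rightarrow> real \<Rightarrow> bool"
  assumes "semialgebraic {z. P (fst z) (snd z)}"
  shows "semialgebraic {x. \<exists>t. P x t}"
proof -
  have "{x. \<exists>t. P x t} = fst ` {z. P (fst z) (snd z)}" by (auto simp: image_iff)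
  then show ?thesis using Tarski_Seidenberg_real[OF assms] by simp
qed

text \<open>
  The coordinates of \<open>y\<close> are released one after the other: those outside \<open>B\<close> are pinned to those of \<open>snd z\<close>.
\<close>

theorem semialgebraic_ex:
  fixes P :: "'a::euclidean_space \<Rightarrow> 'b::euclidean_space \<Rightarrow> bool"
  assumes "semialgebraic {z. P (fst z) (snd z)}"
  shows "semialgebraic {x. \<exists>y. P x y}"
proof -
  have "semialgebraic {z. \<exists>y. (\<forall>b\<in>Basis - B. y \<bullet> b = snd z \<bullet> b) \<and> P (fst z) y}"
    if "finite B" "B \<subseteq> Basis" for B :: "'b set"
    using that
  proof (induction B rule: finite_induct)
    case empty
    have "(\<forall>b\<in>Basis. y \<bullet> b = (v::'b) \<bullet> b) \<longleftrightarrow> y = v" for y v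
      using euclidean_eqI by blast
    then show ?case using assms by simp
  next
    case (insert c B)
    let ?T = "{z. \<exists>y. (\<forall>b\<in>Basis - B. y \<bullet> b = snd z \<bullet> b) \<and> P (fst z) y}"
    have c: "c \<in> Basis" "c \<notin> B" using insert by auto
    \<comment> \<open>Unpinning the coordinate \<open>c\<close> lets the pinned vector vary along
      \<open>c\<close>, which is a single real quantifier.\<close>
    have eq: "{z. \<exists>y. (\<forall>b\<in>Basis - insert c B. y \<bullet> b = snd z \<bullet> b) \<and> P (fst z) y}
        = {z. \<exists>t. (fst z, snd z + t *\<^sub>R c) \<in> ?T}"
    proof -
      have "(\<exists>y. (\<forall>b\<in>Basis - insert c B. y \<bullet> b = v \<bullet> b) \<and> P x y) \<longleftrightarrow>
        (\<exists>t y. (\<forall>b\<in>Basis - B. y \<bullet> b = (v + t *\<^sub>R c) \<bullet> b) \<and> P x y)" for x v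
      proof
        assume "\<exists>y. (\<forall>b\<in>Basis - insert c B. y \<bullet> b = v \<bullet> b) \<and> P x y"
        then obtain y where y: "\<forall>b\<in>Basis - insert c B. y \<bullet> b = v \<bullet> b" "P x y" by blast
        have "\<forall>b\<in>Basis - B. y \<bullet> b = (v + (y \<bullet> c - v \<bullet> c) *\<^sub>R c) \<bullet> b"
          using y c by (auto simp: inner_add_left inner_Basis)
        then show "\<exists>t y. (\<forall>b\<in>Basis - B. y \<bullet> b = (v + t *\<^sub>R c) \<bullet> b) \<and> P x y" using y by blast
      next
        assume "\<exists>t y. (\<forall>b\<in>Basis - B. y \<bullet> b = (v + t *\<^sub>R c) \<bullet> b) \<and> P x y"
        then obtain t y where y: "\<forall>b\<in>Basis - B. y \<bullet> b = (v + t *\<^sub>R c) \<bullet> b" "P x y" by blast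
        have "\<forall>b\<in>Basis - insert c B. y \<bullet> b = v \<bullet> b"
          using y c by (auto simp: inner_add_left inner_Basis)
        then show "\<exists>y. (\<forall>b\<in>Basis - insert c B. y \<bullet> b = v \<bullet> b) \<and> P x y" using y by blast
      qed
      then show ?thesis by simp
    qed
    have "semialgebraic ?T" using insert by simp
    then have "semialgebraic ((\<lambda>w. (fst (fst w), snd (fst w) + snd w *\<^sub>R c)) -` ?T)"
      by (rule semialgebraic_vimage) (intro polynomial_intros)
    then show ?case unfolding eq
      by (intro semialgebraic_ex_real) (simp add: vimage_def)
  qed
  \<comment> \<open>With no coordinate pinned, the second component of \<open>z\<close> is a dummy
    and can be set to \<open>0\<close>.\<close>
  from this[of Basis] have "semialgebraic {z::'a \<times> 'b. \<exists>y. P (fst z) y}" by simp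
  then have "semialgebraic ((\<lambda>x. (x, 0)) -` {z::'a \<times> 'b. \<exists>y. P (fst z) y})"
    by (rule semialgebraic_vimage) (intro polynomial_intros)
  then show ?thesis by (simp add: vimage_def)
qed

lemma semialgebraic_conj:
  "semialgebraic {x. P x} \<Longrightarrow> semialgebraic {x. Q x} \<Longrightarrow> semialgebraic {x. P x \<and> Q x}"
  unfolding Collect_conj_eq by (rule semialgebraic_Int)

lemma semialgebraic_disj:
  "semialgebraic {x. P x} \<Longrightarrow> semialgebraic {x. Q x} \<Longrightarrow> semialgebraic {x. P x \<or> Q x}"
  unfolding Collect_disj_eq by (rule semialgebraic_Un)

lemma semialgebraic_not: "semialgebraic {x. P x} \<Longrightarrow> semialgebraic {x. \<not> P x}"
  unfolding Collect_neg_eq by (rule semialgebraic_Compl)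

lemma semialgebraic_imp:
  "semialgebraic {x. P x} \<Longrightarrow> semialgebraic {x. Q x} \<Longrightarrow> semialgebraic {x. P x \<longrightarrow> Q x}"
  unfolding imp_conv_disj by (intro semialgebraic_disj semialgebraic_not)

lemma semialgebraic_all:
  fixes P :: "'a::euclidean_space \<Rightarrow> 'b::euclidean_space \<Rightarrow> bool"
  assumes "semialgebraic {z. P (fst z) (snd z)}"
  shows "semialgebraic {x. \<forall>y. P x y}"
  using semialgebraic_not[OF semialgebraic_ex[OF semialgebraic_not[OF assms]]] by simp

lemma semialgebraic_less:
  assumes "polynomial_function p" "polynomial_function q"
  shows "semialgebraic {x. p x < (q x :: real)}"
  using semialgebraic_pos[of "\<lambda>x. q x - p x"] polynomial_function_diff[OF assms(2,1)]
  by (simp add: real_polynomial_function_eq)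

lemma semialgebraic_le:
  assumes "polynomial_function p" "polynomial_function q"
  shows "semialgebraic {x. p x \<le> (q x :: real)}"
  using semialgebraic_not[OF semialgebraic_less[OF assms(2,1)]] by (simp add: not_less)

lemma semialgebraic_eq:
  assumes "polynomial_function p" "polynomial_function q"
  shows "semialgebraic {x. p x = (q x :: real)}"
  using semialgebraic_conj[OF semialgebraic_le[OF assms] semialgebraic_le[OF assms(2,1)]]
  by (simp add: order_eq_iff)

lemma semialgebraic_mem:
  "semialgebraic S \<Longrightarrow> polynomial_function f \<Longrightarrow> semialgebraic {x. f x \<in> S}"
  using semialgebraic_vimage[of S f] by (simp add: vimage_def)

text \<open>With \<open>polynomial_intros\<close>, these rules recognise a definable set from its
  formula. Sets below are phrased accordingly: distances occur squared as inner products, quotients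
  as products, and functions through membership in their graphs.\<close>

lemmas semialgebraic_intros =
  semialgebraic_conj semialgebraic_disj semialgebraic_imp semialgebraic_not
  semialgebraic_ex semialgebraic_all semialgebraic_less semialgebraic_le semialgebraic_eq

section \<open>Semialgebraic functions of one variable\<close>

lemma real_polynomial_function_poly:
  fixes p :: "real \<Rightarrow> real"
  assumes "real_polynomial_function p"
  shows "\<exists>q. p = poly q"
proof -
  obtain a n where "p = (\<lambda>x. \<Sum>i\<le>n::nat. a i * x ^ i)"
    using assms unfolding real_polynomial_function_iff_sum by blast
  then have "p = poly (\<Sum>i\<le>n. monom (a i) i)" by (simp add: poly_sum poly_monom fun_eq_iff)
  then show ?thesis by blast
qed

lemma finite_frontier_Int:
  "finite (frontier S) \<Longrightarrow> finite (frontier T) \<Longrightarrow> finite (frontier (S \<inter> T))"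
  using frontier_Int_subset[of S T] by (meson finite_Un finite_subset)

lemma finite_frontier_Un:
  "finite (frontier S) \<Longrightarrow> finite (frontier T) \<Longrightarrow> finite (frontier (S \<union> T))"
  using frontier_Un_subset[of S T] by (meson finite_Un finite_subset)

lemma finite_frontier_INT:
  "finite I \<Longrightarrow> (\<And>i. i \<in> I \<Longrightarrow> finite (frontier (S i))) \<Longrightarrow> finite (frontier (\<Inter>i\<in>I. S i))"
  by (induction I rule: finite_induct) (simp_all add: finite_frontier_Int)

lemma finite_frontier_UN:
  "finite I \<Longrightarrow> (\<And>i. i \<in> I \<Longrightarrow> finite (frontier (S i))) \<Longrightarrow> finite (frontier (\<Union>i\<in>I. S i))"
  by (induction I rule: finite_induct) (simp_all add: finite_frontier_Un)

text \<open>The frontier of the zero set or the positivity set of a nonzero polynomial consists of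
  roots, and finite frontiers survive finite unions and intersections.\<close>

lemma finite_frontier_semialgebraic:
  fixes S :: "real set"
  assumes "semialgebraic S"
  shows "finite (frontier S)"
proof -
  obtain F where F: "finite F" "\<forall>i\<in>F. finite_polynomial_pair i" "S = (\<Union>i\<in>F. basic_semialgebraic i)"
    using assms unfolding semialgebraic_iff by blast
  have zero: "finite (frontier {x. p x = 0})" if p: "real_polynomial_function p" for p :: "real \<Rightarrow> real"
  proof -
    obtain q where q: "p = poly q" using real_polynomial_function_poly[OF p] by blast
    show ?thesis
    proof (cases "q = 0")
      case False
      then have "finite {x. p x = 0}" using q by (simp add: poly_roots_finite)
      moreover from this have "frontier {x. p x = 0} \<subseteq> {x. p x = 0}"
        by (simp add: finite_imp_closed frontier_subset_closed)
      ultimately show ?thesis by (rule rev_finite_subset)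
    qed (simp add: q)
  qed
  have pos: "finite (frontier {x. 0 < p x})" if p: "real_polynomial_function p" for p :: "real \<Rightarrow> real"
  proof -
    obtain q where q: "p = poly q" using real_polynomial_function_poly[OF p] by blast
    show ?thesis
    proof (cases "q = 0")
      case False
      have "open {x. 0 < p x}" unfolding q by (intro open_Collect_less continuous_intros)
      moreover have "closed {x. 0 \<le> p x}" unfolding q by (intro closed_Collect_le continuous_intros)
      then have "closure {x. 0 < p x} \<subseteq> {x. 0 \<le> p x}" by (intro closure_minimal) auto
      ultimately have "frontier {x. 0 < p x} \<subseteq> {x. p x = 0}"
        unfolding frontier_def by (auto simp: interior_open)
      moreover have "finite {x. p x = 0}" using q False by (simp add: poly_roots_finite)
      ultimately show ?thesis by (rule finite_subset)
    qed (simp add: q)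
  qed
  have "finite (frontier (basic_semialgebraic i))" if "i \<in> F" for i
  proof -
    have "basic_semialgebraic i = (\<Inter>p\<in>fst i. {x. p x = 0}) \<inter> (\<Inter>q\<in>snd i. {x. 0 < q x})"
      by (auto simp: basic_semialgebraic_def)
    then show ?thesis using F(2) that
      by (simp only: finite_polynomial_pair_def) (intro finite_frontier_Int finite_frontier_INT zero pos; blast)
  qed
  then show ?thesis unfolding F(3) by (rule finite_frontier_UN[OF F(1)])
qed

section \<open>One-sided dichotomies, continuity and monotonicity\<close>

text \<open>An interval starting at \<open>a\<close> that misses the finite frontier is connected,
  hence lies in \<open>S\<close> or in its complement.\<close>

lemma semialgebraic_at_right:
  fixes S :: "real set"
  assumes "semialgebraic S"
  shows "(\<forall>\<^sub>F t in at_right a. t \<in> S) \<or> (\<forall>\<^sub>F t in at_right a. t \<notin> S)"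
proof -
  have "\<exists>b>a. {a<..<b} \<inter> frontier S = {}"
  proof (cases "\<exists>b\<in>frontier S. a < b")
    case True
    then show ?thesis using finite_succ_above[OF finite_frontier_semialgebraic[OF assms], of a]
      by (auto simp: disjoint_iff not_le[symmetric])
  next
    case False
    then show ?thesis by (intro exI[of _ "a + 1"]) auto
  qed
  then obtain b where b: "a < b" "{a<..<b} \<inter> frontier S = {}" by blast
  then have "{a<..<b} \<inter> S = {} \<or> {a<..<b} - S = {}"
    using connected_Int_frontier[of "{a<..<b}" S] connected_Ioo by blast
  then show ?thesis
    unfolding eventually_at_right_field using b(1) by (metis Diff_iff Int_iff empty_iff greaterThanLessThan_iff)
qed

lemma semialgebraic_at_left:
  fixes S :: "real set"
  assumes "semialgebraic S"
  shows "(\<forall>\<^sub>F t in at_left a. t \<in> S) \<or> (\<forall>\<^sub>F t in at_left a. t \<notin> S)"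
proof -
  have "semialgebraic {t. - t \<in> S}" by (intro semialgebraic_mem[OF assms] polynomial_intros)
  from semialgebraic_at_right[OF this, of "- a"]
  show ?thesis by (simp add: at_left_minus[of a] eventually_filtermap)
qed

text \<open>Only the germ at \<open>0\<close> from the right is of interest; values of
  \<open>g\<close> outside the interval are arbitrary.\<close>

definition semialgebraic_on :: "real \<Rightarrow> (real \<Rightarrow> real) \<Rightarrow> bool" where
  "semialgebraic_on e g \<longleftrightarrow> semialgebraic {z. 0 < fst z \<and> fst z < e \<and> snd z = g (fst z)}"

text \<open>
  A discontinuity at \<open>t\<close> puts \<open>t\<close> on the boundary of a set \<open>{g > r}\<close> or \<open>{g < r}\<close> with \<open>r\<close> rational.
\<close>

lemma countable_discontinuities:
  fixes g :: "real \<Rightarrow> real"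
  assumes "semialgebraic_on e g"
  shows "countable {t. 0 < t \<and> t < e \<and> \<not> isCont g t}"
proof -
  let ?\<Gamma> = "{z. 0 < fst z \<and> fst z < e \<and> snd z = g (fst z)}"
  define U where "U r = {t. 0 < t \<and> t < e \<and> r < g t}" for r
  define L where "L r = {t. 0 < t \<and> t < e \<and> g t < r}" for r
  have \<Gamma>: "semialgebraic ?\<Gamma>" using assms by (simp add: semialgebraic_on_def)
  have "U r = {t. \<exists>s. r < s \<and> (t, s) \<in> ?\<Gamma>}" for r by (auto simp: U_def)
  moreover have "semialgebraic {t. \<exists>s. r < s \<and> (t, s) \<in> ?\<Gamma>}" for r
    by (intro semialgebraic_intros semialgebraic_mem[OF \<Gamma>] polynomial_intros)
  ultimately have U: "finite (frontier (U r))" for r by (simp add: finite_frontier_semialgebraic)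
  have "L r = {t. \<exists>s. s < r \<and> (t, s) \<in> ?\<Gamma>}" for r by (auto simp: L_def)
  moreover have "semialgebraic {t. \<exists>s. s < r \<and> (t, s) \<in> ?\<Gamma>}" for r
    by (intro semialgebraic_intros semialgebraic_mem[OF \<Gamma>] polynomial_intros)
  ultimately have L: "finite (frontier (L r))" for r by (simp add: finite_frontier_semialgebraic)
  have "{t. 0 < t \<and> t < e \<and> \<not> isCont g t} \<subseteq> (\<Union>r\<in>\<rat>. frontier (U r) \<union> frontier (L r))"
  proof
    fix t assume t: "t \<in> {t. 0 < t \<and> t < e \<and> \<not> isCont g t}"
    show "t \<in> (\<Union>r\<in>\<rat>. frontier (U r) \<union> frontier (L r))"
    proof (rule ccontr)
      assume not: "t \<notin> (\<Union>r\<in>\<rat>. frontier (U r) \<union> frontier (L r))"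
      have ev: "\<forall>\<^sub>F s in at t. s \<in> {0<..<e}" using t by (intro eventually_at_in_open') auto
      have "(g \<longlongrightarrow> g t) (at t)"
      proof (rule order_tendstoI)
        fix y assume "y < g t"
        then obtain r where r: "r \<in> \<rat>" "y < r" "r < g t" using Rats_dense_in_real by blast
        then have "t \<in> U r" "t \<notin> frontier (U r)" using t not by (auto simp: U_def)
        then have "t \<in> interior (U r)" using closure_subset by (auto simp: frontier_def)
        then have "\<forall>\<^sub>F s in at t. s \<in> U r"
          using eventually_at_in_open'[of "interior (U r)" t] interior_subset
          by (auto elim!: eventually_mono)
        then show "\<forall>\<^sub>F s in at t. y < g s" by eventually_elim (use r in \<open>auto simp: U_def\<close>)
      next
        fix y assume "g t < y"
        then obtain r where r: "r \<in> \<rat>" "g t < r" "r < y" using Rats_dense_in_real by blast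
        then have "t \<in> L r" "t \<notin> frontier (L r)" using t not by (auto simp: L_def)
        then have "t \<in> interior (L r)" using closure_subset by (auto simp: frontier_def)
        then have "\<forall>\<^sub>F s in at t. s \<in> L r"
          using eventually_at_in_open'[of "interior (L r)" t] interior_subset
          by (auto elim!: eventually_mono)
        then show "\<forall>\<^sub>F s in at t. g s < y" by eventually_elim (use r in \<open>auto simp: L_def\<close>)
      qed
      then show False using t by (simp add: isCont_def)
    qed
  qed
  moreover have "countable (\<Union>r\<in>\<rat>. frontier (U r) \<union> frontier (L r))"
    using U L by (intro countable_UN countable_rat) (auto intro: countable_finite)
  ultimately show ?thesis by (rule countable_subset)
qed

text \<open>Discontinuity is a first-order condition on the graph, so near \<open>0\<close> it holds
  at every point or at none; the former would make an interval countable.\<close>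

lemma semialgebraic_on_continuous:
  assumes "semialgebraic_on e g" "0 < e"
  shows "\<exists>d. 0 < d \<and> d \<le> e \<and> continuous_on {0<..<d} g"
proof -
  let ?\<Gamma> = "{z. 0 < fst z \<and> fst z < e \<and> snd z = g (fst z)}"
  let ?D = "{t. 0 < t \<and> t < e \<and> \<not> isCont g t}"
  have \<Gamma>: "semialgebraic ?\<Gamma>" using assms by (simp add: semialgebraic_on_def)
  \<comment> \<open>The epsilon-delta condition, in which \<open>g\<close> enters only through its
    graph.\<close>
  define R where "R t v \<longleftrightarrow> (\<forall>\<epsilon>. 0 < \<epsilon> \<longrightarrow> (\<exists>\<delta>. 0 < \<delta> \<and>
      (\<forall>s u. (s, u) \<in> ?\<Gamma> \<and> t - \<delta> < s \<and> s < t + \<delta> \<longrightarrow> v - \<epsilon> < u \<and> u < v + \<epsilon>)))" for t v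
  have cont: "isCont g t \<longleftrightarrow> R t v" if "(t, v) \<in> ?\<Gamma>" for t v
  proof -
    have t: "0 < t" "t < e" "v = g t" using that by auto
    show ?thesis
    proof
      assume cont: "isCont g t"
      show "R t v"
        unfolding R_def
      proof (intro allI impI)
        fix \<epsilon> :: real assume "0 < \<epsilon>"
        then obtain \<delta> where "\<delta> > 0" "\<And>s. dist s t < \<delta> \<Longrightarrow> dist (g s) (g t) < \<epsilon>"
          using cont unfolding continuous_at_eps_delta by blast
        then show "\<exists>\<delta>. 0 < \<delta> \<and> (\<forall>s u. (s, u) \<in> ?\<Gamma> \<and> t - \<delta> < s \<and> s < t + \<delta> \<longrightarrow> v - \<epsilon> < u \<and> u < v + \<epsilon>)"
        proof (intro exI[of _ \<delta>] conjI allI impI, goal_cases)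
          case (2 s u)
          then have "dist (g s) (g t) < \<epsilon>" "u = g s"
            using \<open>\<And>s. dist s t < \<delta> \<Longrightarrow> _\<close>[of s] by (auto simp: dist_real_def)
          then show ?case using t by (auto simp: dist_real_def)
        next
          case (3 s u)
          then have "dist (g s) (g t) < \<epsilon>" "u = g s"
            using \<open>\<And>s. dist s t < \<delta> \<Longrightarrow> _\<close>[of s] by (auto simp: dist_real_def)
          then show ?case using t by (auto simp: dist_real_def)
        qed
      qed
    next
      assume R: "R t v"
      show "isCont g t"
        unfolding continuous_at_eps_delta
      proof (intro allI impI)
        fix \<epsilon> :: real assume "0 < \<epsilon>"
        then obtain \<delta> where \<delta>: "0 < \<delta>" "\<And>s u. (s, u) \<in> ?\<Gamma> \<and> t - \<delta> < s \<and> s < t + \<delta> \<Longrightarrow> v - \<epsilon> < u \<and> u < v + \<epsilon>"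
          using R unfolding R_def by blast
        \<comment> \<open>The bounds \<open>t\<close> and \<open>e - t\<close> keep \<open>s\<close>
          inside the interval over which the graph is taken.\<close>
        have "dist (g s) (g t) < \<epsilon>" if "dist s t < min \<delta> (min t (e - t))" for s
        proof -
          have "t - \<delta> < s \<and> s < t + \<delta> \<and> 0 < s \<and> s < e" using that by (auto simp: dist_real_def)
          then have "v - \<epsilon> < g s \<and> g s < v + \<epsilon>" using \<delta>(2)[of s "g s"] by simp
          then show ?thesis using t by (auto simp: dist_real_def)
        qed
        then show "\<exists>d>0. \<forall>x'. dist x' t < d \<longrightarrow> dist (g x') (g t) < \<epsilon>"
          using \<delta> t by (intro exI[of _ "min \<delta> (min t (e - t))"]) auto
      qed
    qed
  qed
  have "?D = {t. \<exists>v. (t, v) \<in> ?\<Gamma> \<and> \<not> R t v}" using cont by fastforce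
  moreover have "semialgebraic {t. \<exists>v. (t, v) \<in> ?\<Gamma> \<and> \<not> R t v}"
    unfolding R_def
    by (intro semialgebraic_intros semialgebraic_mem[OF \<Gamma>] polynomial_intros)
  ultimately have "semialgebraic ?D" by simp
  from semialgebraic_at_right[OF this, of 0]
  show ?thesis
  proof
    assume "\<forall>\<^sub>F t in at_right 0. t \<in> ?D"
    then obtain b where b: "b > 0" "\<And>t. 0 < t \<Longrightarrow> t < b \<Longrightarrow> t \<in> ?D"
      unfolding eventually_at_right_field by blast
    then have "{0<..<b} \<subseteq> ?D" by auto
    then have "countable {0<..<b}" using countable_discontinuities[OF assms(1)] by (rule countable_subset)
    then show ?thesis using b(1) uncountable_open_interval by blast
  next
    assume "\<forall>\<^sub>F t in at_right 0. t \<notin> ?D"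
    then obtain b where b: "b > 0" "\<And>t. 0 < t \<Longrightarrow> t < b \<Longrightarrow> t \<notin> ?D"
      unfolding eventually_at_right_field by blast
    have "continuous_on {0<..<min b e} g"
      using b by (intro continuous_at_imp_continuous_on) auto
    then show ?thesis using b assms(2) by (intro exI[of _ "min b e"]) auto
  qed
qed

text \<open>A minimum over \<open>{u..v}\<close> at some \<open>c > u\<close> would be undercut just
  to the left of \<open>c\<close>, so it is attained at \<open>u\<close>. One last step to the left
  of \<open>t\<close> gives strictness.\<close>

lemma less_if_left_increasing:
  fixes g :: "real \<Rightarrow> real"
  assumes cont: "continuous_on {a<..<b} g"
    and left: "\<And>t. a < t \<Longrightarrow> t < b \<Longrightarrow> \<forall>\<^sub>F s in at_left t. g s < g t"
    and st: "a < s" "s < t" "t < b"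
  shows "g s < g t"
proof -
  have st_less: "g u \<le> g v" if uv: "a < u" "u \<le> v" "v < b" for u v
  proof -
    have "continuous_on {u..v} g" using uv by (intro continuous_on_subset[OF cont]) auto
    then obtain c where c: "c \<in> {u..v}" "\<forall>x\<in>{u..v}. g c \<le> g x"
      using continuous_attains_inf[of "{u..v}" g] uv by auto
    have "c = u"
    proof (rule ccontr)
      assume "c \<noteq> u"
      then have "u < c" using c by auto
      have "\<forall>\<^sub>F s in at_left c. g s < g c" using c uv by (intro left) auto
      moreover have "\<forall>\<^sub>F s in at_left c. u < s \<and> s < c"
        using \<open>u < c\<close> eventually_at_left_field by blast
      ultimately have "\<forall>\<^sub>F s in at_left c. g s < g c \<and> u < s \<and> s < c" by eventually_elim auto
      then obtain s where "g s < g c" "u < s" "s < c"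
        using eventually_happens trivial_limit_at_left_real by blast
      then have "s \<in> {u..v}" using c by auto
      then show False using c \<open>g s < g c\<close> by (metis not_le)
    qed
    then show ?thesis using c uv by auto
  qed
  have "\<forall>\<^sub>F r in at_left t. g r < g t" using st by (intro left) auto
  moreover have "\<forall>\<^sub>F r in at_left t. s < r \<and> r < t"
    using \<open>s < t\<close> eventually_at_left_field by blast
  ultimately have "\<forall>\<^sub>F r in at_left t. g r < g t \<and> s < r \<and> r < t" by eventually_elim auto
  then obtain r where "g r < g t" "s < r" "r < t"
    using eventually_happens trivial_limit_at_left_real by blast
  then show ?thesis using st_less[of s r] st by auto
qed

lemma le_if_left_nondecreasing:
  fixes g :: "real \<Rightarrow> real"
  assumes cont: "continuous_on {a<..<b} g"
    and left: "\<And>t. a < t \<Longrightarrow> t < b \<Longrightarrow> \<forall>\<^sub>F s in at_left t. g s \<le> g t"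
    and st: "a < s" "s \<le> t" "t < b"
  shows "g s \<le> g t"
proof (cases "s = t")
  case False
  then have "s < t" using st by simp
  show ?thesis
  proof (rule field_le_epsilon)
    fix e :: real assume e: "0 < e"
    \<comment> \<open>The tilt by \<open>\<eta>\<close> makes the left comparisons strict and costs
      exactly \<open>e\<close> over \<open>{s..t}\<close>.\<close>
    define \<eta> where "\<eta> = e / (t - s)"
    have \<eta>: "0 < \<eta>" using e \<open>s < t\<close> by (simp add: \<eta>_def)
    have "g s + \<eta> * s < g t + \<eta> * t"
    proof (rule less_if_left_increasing[of a b "\<lambda>r. g r + \<eta> * r"])
      show "continuous_on {a<..<b} (\<lambda>r. g r + \<eta> * r)" by (intro continuous_intros cont)
      fix r assume "a < r" "r < b"
      then have "\<forall>\<^sub>F s in at_left r. g s \<le> g r" by (rule left)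
      moreover have "\<forall>\<^sub>F s in at_left r. s < r" by (simp add: eventually_at_filter)
      ultimately show "\<forall>\<^sub>F s in at_left r. g s + \<eta> * s < g r + \<eta> * r"
      proof eventually_elim
        case (elim x)
        then have "\<eta> * x < \<eta> * r" using \<eta> by simp
        then show ?case using elim by linarith
      qed
    qed (use st \<open>s < t\<close> in auto)
    moreover have "\<eta> * (t - s) = e" using \<open>s < t\<close> by (simp add: \<eta>_def)
    then have "\<eta> * t - \<eta> * s = e" by (simp only: right_diff_distrib)
    ultimately show "g s \<le> g t + e" by linarith
  qed
qed simp

lemma semialgebraic_on_left_comparison:
  fixes g :: "real \<Rightarrow> real"
  assumes g: "semialgebraic_on e g"
  shows "semialgebraic {t. 0 < t \<and> t < e \<and> (\<forall>\<^sub>F s in at_left t. g s \<le> g t)}"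
proof -
  let ?\<Gamma> = "{z. 0 < fst z \<and> fst z < e \<and> snd z = g (fst z)}"
  have \<Gamma>: "semialgebraic ?\<Gamma>" using g by (simp add: semialgebraic_on_def)
  define P where "P t \<longleftrightarrow> (\<exists>v \<delta>. (t, v) \<in> ?\<Gamma> \<and> \<delta> < t \<and>
      (\<forall>s u. (s, u) \<in> ?\<Gamma> \<and> \<delta> < s \<and> s < t \<longrightarrow> u \<le> v))" for t
  have "semialgebraic {t. P t}" unfolding P_def
    by (intro semialgebraic_intros semialgebraic_mem[OF \<Gamma>] polynomial_intros)
  also have "{t. P t} = {t. 0 < t \<and> t < e \<and> (\<forall>\<^sub>F s in at_left t. g s \<le> g t)}"
  proof (intro Collect_cong iffI)
    fix t assume "P t"
    then obtain \<delta> where \<delta>: "0 < t" "t < e" "\<delta> < t"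
      "\<And>s u. (s, u) \<in> ?\<Gamma> \<and> \<delta> < s \<and> s < t \<Longrightarrow> u \<le> g t" by (auto simp: P_def)
    have "g s \<le> g t" if "max 0 \<delta> < s" "s < t" for s
      using \<delta>(4)[of s "g s"] \<delta>(2) that by simp
    then have "\<forall>\<^sub>F s in at_left t. g s \<le> g t"
      unfolding eventually_at_left_field using \<delta> by (intro exI[of _ "max 0 \<delta>"]) auto
    then show "0 < t \<and> t < e \<and> (\<forall>\<^sub>F s in at_left t. g s \<le> g t)" using \<delta> by blast
  next
    fix t assume t: "0 < t \<and> t < e \<and> (\<forall>\<^sub>F s in at_left t. g s \<le> g t)"
    then obtain \<delta> where "\<delta> < t" "\<And>s. \<delta> < s \<Longrightarrow> s < t \<Longrightarrow> g s \<le> g t"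
      unfolding eventually_at_left_field by blast
    then show "P t" unfolding P_def
      using t by (intro exI[of _ "g t"] exI[of _ \<delta>]) auto
  qed
  finally show ?thesis .
qed

lemma semialgebraic_on_at_left:
  assumes g: "semialgebraic_on e g" and t: "0 < t" "t < e"
  shows "(\<forall>\<^sub>F s in at_left t. g s \<le> g t) \<or> (\<forall>\<^sub>F s in at_left t. g t \<le> g s)"
proof -
  let ?\<Gamma> = "{z. 0 < fst z \<and> fst z < e \<and> snd z = g (fst z)}"
  have \<Gamma>: "semialgebraic ?\<Gamma>" using g by (simp add: semialgebraic_on_def)
  have "semialgebraic {s. \<exists>u. (s, u) \<in> ?\<Gamma> \<and> u \<le> g t}"
    by (intro semialgebraic_intros semialgebraic_mem[OF \<Gamma>] polynomial_intros)
  from semialgebraic_at_left[OF this, of t]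
  have "(\<forall>\<^sub>F s in at_left t. 0 < s \<and> s < e \<and> g s \<le> g t) \<or> (\<forall>\<^sub>F s in at_left t. \<not> (0 < s \<and> s < e \<and> g s \<le> g t))"
    by simp
  moreover have ev: "\<forall>\<^sub>F s in at_left t. 0 < s \<and> s < e"
    unfolding eventually_at_left_field using t by (intro exI[of _ 0]) auto
  moreover have "\<forall>\<^sub>F s in at_left t. g t \<le> g s"
    if "\<forall>\<^sub>F s in at_left t. \<not> (0 < s \<and> s < e \<and> g s \<le> g t)"
    using that ev by eventually_elim auto
  ultimately show ?thesis by (auto elim: eventually_mono)
qed

text \<open>Only comparison with points immediately to the left is tested. At each point it goes one
  way or the other, and being definable it has a fixed direction \<open>\<sigma>\<close> near
  \<open>0\<close>; continuity turns this into monotonicity.\<close>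

lemma semialgebraic_on_monotone:
  assumes g: "semialgebraic_on e g" and e: "0 < e"
  shows "\<exists>d \<sigma>. 0 < d \<and> d \<le> e \<and> continuous_on {0<..<d} g \<and> \<bar>\<sigma>\<bar> = 1 \<and>
    (\<forall>s t. 0 < s \<longrightarrow> s \<le> t \<longrightarrow> t < d \<longrightarrow> \<sigma> * g s \<le> \<sigma> * g t)"
proof -
  obtain d where d: "0 < d" "d \<le> e" "continuous_on {0<..<d} g"
    using semialgebraic_on_continuous[OF g e] by blast
  let ?A = "{t. 0 < t \<and> t < e \<and> (\<forall>\<^sub>F s in at_left t. g s \<le> g t)}"
  have "semialgebraic ?A" by (rule semialgebraic_on_left_comparison[OF g])
  from semialgebraic_at_right[OF this, of 0]
  show ?thesis
  proof
    assume "\<forall>\<^sub>F t in at_right 0. t \<in> ?A"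
    then obtain b where b: "b > 0" "\<And>t. 0 < t \<Longrightarrow> t < b \<Longrightarrow> t \<in> ?A"
      unfolding eventually_at_right_field by blast
    have "g s \<le> g t" if "0 < s" "s \<le> t" "t < min b d" for s t
    proof (rule le_if_left_nondecreasing[OF _ _ that])
      show "continuous_on {0<..<min b d} g" using d by (auto elim: continuous_on_subset)
    qed (use b in auto)
    then show ?thesis using b d
      by (intro exI[of _ "min b d"] exI[of _ 1]) (auto elim: continuous_on_subset)
  next
    assume "\<forall>\<^sub>F t in at_right 0. t \<notin> ?A"
    then obtain b where b: "b > 0" "\<And>t. 0 < t \<Longrightarrow> t < b \<Longrightarrow> t \<notin> ?A"
      unfolding eventually_at_right_field by blast
    have "- g s \<le> - g t" if "0 < s" "s \<le> t" "t < min b d" for s t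
    proof (rule le_if_left_nondecreasing[OF _ _ that])
      show "continuous_on {0<..<min b d} (\<lambda>t. - g t)"
        using d by (auto elim: continuous_on_subset intro!: continuous_on_minus)
      fix t assume t: "0 < t" "t < min b d"
      then have "\<not> (\<forall>\<^sub>F s in at_left t. g s \<le> g t)" using b(2)[of t] d by auto
      then have "\<forall>\<^sub>F s in at_left t. g t \<le> g s" using semialgebraic_on_at_left[OF g, of t] t d by auto
      then show "\<forall>\<^sub>F s in at_left t. - g s \<le> - g t" by simp
    qed
    then show ?thesis using b d
      by (intro exI[of _ "min b d"] exI[of _ "-1"]) (auto elim: continuous_on_subset)
  qed
qed

text \<open>
  The chosen point is the midpoint of the leftmost component of the fiber (up to its endpoints).
\<close>

lemma semialgebraic_choice_real:
  fixes T :: "('a::euclidean_space \<times> real) set"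
  assumes T: "semialgebraic T" and bounded: "\<And>a s. (a, s) \<in> T \<Longrightarrow> \<bar>s\<bar> \<le> R"
  shows "\<exists>C \<subseteq> T. semialgebraic C \<and> fst ` C = fst ` T \<and> (\<forall>a s s'. (a, s) \<in> C \<longrightarrow> (a, s') \<in> C \<longrightarrow> s = s')"
proof -
  define isinf where "isinf a l \<longleftrightarrow> (\<exists>s. (a, s) \<in> T) \<and> (\<forall>s. (a, s) \<in> T \<longrightarrow> l \<le> s) \<and>
    (\<forall>m. (\<forall>s. (a, s) \<in> T \<longrightarrow> m \<le> s) \<longrightarrow> m \<le> l)" for a l
  define seg where "seg a l b \<longleftrightarrow> l \<le> b \<and> (\<forall>s. l < s \<and> s < b \<longrightarrow> (a, s) \<in> T)" for a l b
  define issup where "issup a l u \<longleftrightarrow> (\<forall>b. seg a l b \<longrightarrow> b \<le> u) \<and>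
    (\<forall>m. (\<forall>b. seg a l b \<longrightarrow> b \<le> m) \<longrightarrow> u \<le> m)" for a l u
  define C where "C = {z. \<exists>l u. isinf (fst z) l \<and> issup (fst z) l u \<and> snd z * 2 = l + u}"
  have "semialgebraic C"
    unfolding C_def isinf_def issup_def seg_def
    by (intro semialgebraic_intros semialgebraic_mem[OF T] polynomial_intros)
  moreover have single: "s = s'" if "(a, s) \<in> C" "(a, s') \<in> C" for a s s'
  proof -
    obtain l u where lu: "isinf a l" "issup a l u" "s * 2 = l + u" using \<open>(a, s) \<in> C\<close> by (auto simp: C_def)
    obtain l' u' where lu': "isinf a l'" "issup a l' u'" "s' * 2 = l' + u'" using \<open>(a, s') \<in> C\<close> by (auto simp: C_def)
    have "l = l'" using lu(1) lu'(1) unfolding isinf_def by (meson order_antisym)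
    moreover from this have "u = u'" using lu(2) lu'(2) unfolding issup_def by (meson order_antisym)
    ultimately show ?thesis using lu lu' by simp
  qed
  moreover have mem: "(a, (l + u) / 2) \<in> T" if "isinf a l" "issup a l u" for a l u
  proof -
    have lb: "\<And>s. (a, s) \<in> T \<Longrightarrow> l \<le> s" using that by (auto simp: isinf_def)
    have "seg a l l" by (auto simp: seg_def)
    then have "l \<le> u" using that by (auto simp: issup_def)
    show ?thesis
    proof (cases "l < u")
      case True
      then have "\<not> (\<forall>b. seg a l b \<longrightarrow> b \<le> (l + u) / 2)" using that(2) unfolding issup_def by fastforce
      then obtain b where "seg a l b" "(l + u) / 2 < b" by auto
      then show ?thesis using True by (auto simp: seg_def)
    next
      case False
      then have "u = l" using \<open>l \<le> u\<close> by simp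
      \<comment> \<open>For \<open>u = l\<close> no interval starting at \<open>l\<close> lies in
        the fiber, so by the one-sided dichotomy the points just right of \<open>l\<close> are
        outside it; being the infimum, \<open>l\<close> then belongs to the fiber.\<close>
      have "(a, l) \<in> T"
      proof (rule ccontr)
        assume l: "(a, l) \<notin> T"
        have "semialgebraic {s. (a, s) \<in> T}" by (intro semialgebraic_mem[OF T] polynomial_intros)
        from semialgebraic_at_right[OF this, of l]
        show False
        proof
          assume "\<forall>\<^sub>F s in at_right l. s \<in> {s. (a, s) \<in> T}"
          then obtain b where "l < b" "\<And>s. l < s \<Longrightarrow> s < b \<Longrightarrow> (a, s) \<in> T"
            unfolding eventually_at_right_field by blast
          then have "seg a l b" by (simp add: seg_def)
          then show False using that(2) \<open>l < b\<close> \<open>u = l\<close> by (auto simp: issup_def)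
        next
          assume "\<forall>\<^sub>F s in at_right l. s \<notin> {s. (a, s) \<in> T}"
          then obtain b where b: "l < b" "\<And>s. l < s \<Longrightarrow> s < b \<Longrightarrow> (a, s) \<notin> T"
            unfolding eventually_at_right_field by blast
          then have "\<forall>s. (a, s) \<in> T \<longrightarrow> b \<le> s" using lb l by (metis not_le order_le_less)
          then have "b \<le> l" using that(1) by (auto simp: isinf_def)
          then show False using b by simp
        qed
      qed
      then show ?thesis using \<open>u = l\<close> by simp
    qed
  qed
  moreover have "C \<subseteq> T"
  proof
    fix z assume "z \<in> C"
    then obtain l u where "isinf (fst z) l" "issup (fst z) l u" "snd z = (l + u) / 2" by (auto simp: C_def)
    then show "z \<in> T" using mem[of "fst z" l u] by (metis prod.collapse)
  qed
  moreover have "fst ` T \<subseteq> fst ` C"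
  proof
    fix a assume "a \<in> fst ` T"
    then obtain s0 where s0: "(a, s0) \<in> T" by auto
    define l where "l = Inf {s. (a, s) \<in> T}"
    have bb: "bdd_below {s. (a, s) \<in> T}"
    proof (rule bdd_belowI)
      fix s assume "s \<in> {s. (a, s) \<in> T}"
      then show "- R \<le> s" using bounded[of a s] by auto
    qed
    have l: "isinf a l" unfolding isinf_def l_def
      using s0 bb by (auto intro: cInf_lower cInf_greatest)
    define u where "u = Sup {b. seg a l b}"
    have "b \<le> max l R" if "seg a l b" for b
    proof (rule ccontr)
      assume "\<not> b \<le> max l R"
      then have "l < b" "R < b" by auto
      \<comment> \<open>This midpoint would lie in the fiber but beyond its bound
        \<open>R\<close>.\<close>
      then have "l < (max l R + b) / 2 \<and> (max l R + b) / 2 < b" by (auto simp: max_def)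
      then have "(a, (max l R + b) / 2) \<in> T" using that unfolding seg_def by blast
      then show False using bounded[of a "(max l R + b) / 2"] \<open>\<not> b \<le> max l R\<close> by auto
    qed
    then have ba: "bdd_above {b. seg a l b}" by (intro bdd_aboveI[of _ "max l R"]) auto
    have "seg a l l" by (auto simp: seg_def)
    then have "issup a l u" unfolding issup_def u_def
      using ba by (auto intro: cSup_upper cSup_least)
    then have "(a, (l + u) / 2) \<in> C" using l by (auto simp: C_def)
    then show "a \<in> fst ` C" by force
  qed
  ultimately show ?thesis by (intro exI[of _ C]) blast
qed

text \<open>Coordinates are fixed one at a time: the choice on the line is applied to the values of
  the next coordinate, and only the points attaining the chosen value are kept.\<close>

lemma semialgebraic_choice:
  fixes T :: "('a::euclidean_space \<times> 'b::euclidean_space) set"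
  assumes T: "semialgebraic T" and bounded: "\<And>a x. (a, x) \<in> T \<Longrightarrow> norm x \<le> R"
  shows "\<exists>C \<subseteq> T. semialgebraic C \<and> fst ` C = fst ` T \<and> (\<forall>a x x'. (a, x) \<in> C \<longrightarrow> (a, x') \<in> C \<longrightarrow> x = x')"
proof -
  have "\<exists>C \<subseteq> T. semialgebraic C \<and> fst ` C = fst ` T \<and>
      (\<forall>a x x'. (a, x) \<in> C \<longrightarrow> (a, x') \<in> C \<longrightarrow> (\<forall>b\<in>B. x \<bullet> b = x' \<bullet> b))"
    if "finite B" "B \<subseteq> Basis" for B :: "'b set"
    using that
  proof (induction B rule: finite_induct)
    case empty
    then show ?case using T by blast
  next
    case (insert c B)
    then have "B \<subseteq> Basis" by simp
    from insert.IH[OF this]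
    obtain C where C: "C \<subseteq> T" "semialgebraic C" "fst ` C = fst ` T"
      "\<forall>a x x'. (a, x) \<in> C \<longrightarrow> (a, x') \<in> C \<longrightarrow> (\<forall>b\<in>B. x \<bullet> b = x' \<bullet> b)" by (elim exE conjE)
    define S where "S = {z. \<exists>x. (fst z, x) \<in> C \<and> x \<bullet> c = snd z}"
    have S: "semialgebraic S" unfolding S_def
      by (intro semialgebraic_intros semialgebraic_mem[OF C(2)] polynomial_intros)
    have bound: "\<bar>s\<bar> \<le> R" if s: "(a, s) \<in> S" for a s
    proof -
      obtain x where "(a, x) \<in> T" "x \<bullet> c = s" using s C(1) by (auto simp: S_def)
      then show ?thesis using bounded Basis_le_norm[of c x] insert.prems by fastforce
    qed
    have "\<exists>D \<subseteq> S. semialgebraic D \<and> fst ` D = fst ` S \<and>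
        (\<forall>a s s'. (a, s) \<in> D \<longrightarrow> (a, s') \<in> D \<longrightarrow> s = s')"
      using S bound by (rule semialgebraic_choice_real)
    then obtain D where D: "D \<subseteq> S" "semialgebraic D" "fst ` D = fst ` S"
      "\<forall>a s s'. (a, s) \<in> D \<longrightarrow> (a, s') \<in> D \<longrightarrow> s = s'" by (elim exE conjE)
    define E where "E = {z. z \<in> C \<and> (fst z, snd z \<bullet> c) \<in> D}"
    have "semialgebraic E" unfolding E_def
      by (intro semialgebraic_intros semialgebraic_mem[OF C(2)] semialgebraic_mem[OF D(2)] polynomial_intros)
    moreover have "E \<subseteq> T" using C by (auto simp: E_def)
    moreover have "fst ` E = fst ` T"
    proof
      show "fst ` E \<subseteq> fst ` T" using \<open>E \<subseteq> T\<close> by blast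
      show "fst ` T \<subseteq> fst ` E"
      proof
        fix a assume "a \<in> fst ` T"
        then have "a \<in> fst ` C" using C(3) by simp
        then obtain x where "(a, x) \<in> C" by auto
        then have "(a, x \<bullet> c) \<in> S" by (auto simp: S_def)
        then have "a \<in> fst ` D" unfolding D(3) by force
        then obtain s where s: "(a, s) \<in> D" by auto
        then obtain y where "(a, y) \<in> C" "y \<bullet> c = s" using D(1) by (auto simp: S_def)
        then have "(a, y) \<in> E" using s by (simp add: E_def)
        then show "a \<in> fst ` E" by force
      qed
    qed
    moreover have "x \<bullet> b = x' \<bullet> b" if "(a, x) \<in> E" "(a, x') \<in> E" "b \<in> insert c B" for a x x' b
    proof -
      have "(a, x) \<in> C" "(a, x') \<in> C" "(a, x \<bullet> c) \<in> D" "(a, x' \<bullet> c) \<in> D" using that by (auto simp: E_def)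
      then show ?thesis using that(3) C(4) D(4) by blast
    qed
    ultimately show ?case by (intro exI[of _ E]) blast
  qed
  from this[OF finite_Basis subset_refl]
  obtain C where C: "C \<subseteq> T" "semialgebraic C" "fst ` C = fst ` T"
    "\<forall>a x x'. (a, x) \<in> C \<longrightarrow> (a, x') \<in> C \<longrightarrow> (\<forall>b\<in>Basis. x \<bullet> b = x' \<bullet> b)" by (elim exE conjE)
  have "\<forall>a x x'. (a, x) \<in> C \<longrightarrow> (a, x') \<in> C \<longrightarrow> x = x'"
    using C(4) by (blast intro: euclidean_eqI)
  then show ?thesis using C(1-3) by (intro exI[of _ C] conjI)
qed

section \<open>Slopes of continuous semialgebraic functions\<close>

text \<open>The outer variable of \<open>P\<close> is \<open>t\<close>, inserted as the constant
  polynomial \<open>[:t:]\<close>, and the inner one is \<open>s\<close>; so powers of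
  \<open>t\<close> can be divided out first.\<close>

lemma bivariate_polynomial_representation:
  fixes p :: "real \<times> real \<Rightarrow> real"
  assumes "real_polynomial_function p"
  shows "\<exists>P. \<forall>t s. p (t, s) = poly (poly P [:t:]) s"
  using assms
proof (induction p rule: real_polynomial_function.induct)
  case (linear f)
  have "f (t, s) = poly (poly [:[:0, f (0, 1):], [:f (1, 0):]:] [:t:]) s" for t s
  proof -
    have "f (t, s) = f (t *\<^sub>R (1, 0) + s *\<^sub>R (0, 1))" by simp
    also have "\<dots> = t * f (1, 0) + s * f (0, 1)" using linear by (simp only: linear_simps) simp
    also have "\<dots> = poly (poly [:[:0, f (0, 1):], [:f (1, 0):]:] [:t:]) s" by simp
    finally show ?thesis .
  qed
  then show ?case by blast
next
  case (const c)
  have "c = poly (poly [:[:c:]:] [:t:]) s" for t s by simp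
  then show ?case by blast
next
  case (add f g)
  then obtain P Q where "\<forall>t s. f (t, s) = poly (poly P [:t:]) s" "\<forall>t s. g (t, s) = poly (poly Q [:t:]) s"
    by blast
  then have "\<forall>t s. f (t, s) + g (t, s) = poly (poly (P + Q) [:t:]) s" by (simp only: poly_add) simp
  then show ?case by blast
next
  case (mult f g)
  then obtain P Q where "\<forall>t s. f (t, s) = poly (poly P [:t:]) s" "\<forall>t s. g (t, s) = poly (poly Q [:t:]) s"
    by blast
  then have "\<forall>t s. f (t, s) * g (t, s) = poly (poly (P * Q) [:t:]) s" by (simp only: poly_mult) simp
  then show ?case by blast
qed

lemma poly_factor_zero:
  fixes p :: "'a::idom poly"
  assumes "p \<noteq> 0"
  shows "\<exists>n q. p = [:0, 1:] ^ n * q \<and> poly q 0 \<noteq> 0"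
proof -
  obtain q where "p = [:- 0, 1:] ^ order 0 p * q" "\<not> [:- 0, 1:] dvd q"
    using order_decomp[OF assms] by blast
  then show ?thesis using poly_eq_0_iff_dvd[of q 0] by (intro exI[of _ "order 0 p"] exI[of _ q]) simp
qed

lemma tendsto_bivariate_poly:
  fixes u :: "'a \<Rightarrow> real"
  assumes "(t \<longlongrightarrow> (0::real)) F" "(u \<longlongrightarrow> 0) F"
  shows "((\<lambda>x. poly (poly Q [:t x:]) (u x)) \<longlongrightarrow> poly (poly Q 0) 0) F"
proof (induction Q)
  case (pCons a Q)
  have "((\<lambda>x. poly a (u x) + t x * poly (poly Q [:t x:]) (u x)) \<longlongrightarrow> poly a 0 + 0 * poly (poly Q 0) 0) F"
    by (intro tendsto_intros tendsto_poly assms pCons)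
  then show ?case by simp
qed simp

text \<open>After division by a power of \<open>t\<close> the equation reads
  \<open>u^m * r(u) + t * R(t) = 0\<close> with \<open>r(0) \<noteq> 0\<close> and \<open>R\<close>
  bounded near \<open>0\<close>, so \<open>u^m\<close> is at most a constant times
  \<open>t\<close>.\<close>

lemma power_le_if_bivariate_root:
  fixes u :: "real \<Rightarrow> real" and P :: "real poly poly"
  assumes P: "P \<noteq> 0" and root: "\<forall>\<^sub>F t in at_right 0. poly (poly P [:t:]) (u t) = 0"
    and pos: "\<forall>\<^sub>F t in at_right 0. 0 < u t" and lim: "(u \<longlongrightarrow> 0) (at_right 0)"
  shows "\<exists>N\<ge>1. \<forall>\<^sub>F t in at_right 0. u t ^ N \<le> t"
proof -
  obtain n Q where Q: "P = [:0, 1:] ^ n * Q" "poly Q 0 \<noteq> 0" using poly_factor_zero[OF P] by blast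
  obtain q Q' where Q': "Q = pCons q Q'" by (metis pCons_cases)
  have "q \<noteq> 0" using Q(2) Q' by simp
  then obtain m r where r: "q = [:0, 1:] ^ m * r" "poly r 0 \<noteq> 0" using poly_factor_zero by blast
  define R where "R t = poly (poly Q' [:t:]) (u t)" for t
  define K where "K = \<bar>poly (poly Q' 0) 0\<bar> + 1"
  define c where "c = \<bar>poly r 0\<bar> / 2"
  have c: "0 < c" using r by (simp add: c_def)
  have t0: "((\<lambda>t::real. t) \<longlongrightarrow> 0) (at_right 0)" by (simp add: tendsto_ident_at)
  have tpos: "\<forall>\<^sub>F t::real in at_right 0. 0 < t" by (simp add: eventually_at_filter)
  have "((\<lambda>t. \<bar>R t\<bar>) \<longlongrightarrow> \<bar>poly (poly Q' 0) 0\<bar>) (at_right 0)"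
    unfolding R_def by (intro tendsto_rabs tendsto_bivariate_poly t0 lim)
  then have RK: "\<forall>\<^sub>F t in at_right 0. \<bar>R t\<bar> < K" by (rule order_tendstoD) (simp add: K_def)
  have "((\<lambda>t. \<bar>poly r (u t)\<bar>) \<longlongrightarrow> \<bar>poly r 0\<bar>) (at_right 0)"
    by (intro tendsto_rabs tendsto_poly lim)
  then have rc: "\<forall>\<^sub>F t in at_right 0. c < \<bar>poly r (u t)\<bar>" by (rule order_tendstoD) (use r in \<open>simp add: c_def\<close>)
  have "((\<lambda>t. u t * K) \<longlongrightarrow> 0 * K) (at_right 0)" by (intro tendsto_intros lim)
  then have uc: "\<forall>\<^sub>F t in at_right 0. u t * K < c" by (rule order_tendstoD) (use c in simp)
  have "\<forall>\<^sub>F t in at_right 0. u t ^ Suc m \<le> t"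
    using root pos tpos RK rc uc
  proof eventually_elim
    case (elim t)
    have "poly (poly P [:t:]) (u t) = t ^ n * (u t ^ m * poly r (u t) + t * R t)"
      by (simp add: Q(1) Q' r(1) R_def algebra_simps)
    then have "u t ^ m * poly r (u t) = - t * R t" using elim by auto
    then have "\<bar>u t ^ m * poly r (u t)\<bar> = \<bar>t * R t\<bar>" by simp
    then have eq: "u t ^ m * \<bar>poly r (u t)\<bar> = t * \<bar>R t\<bar>" using elim by (simp add: abs_mult)
    have "u t ^ m * c \<le> u t ^ m * \<bar>poly r (u t)\<bar>" using elim by (intro mult_left_mono) auto
    also have "\<dots> \<le> t * K" unfolding eq using elim by (intro mult_left_mono) auto
    \<comment> \<open>One more factor \<open>u t\<close>, which tends to \<open>0\<close>, absorbs
      the constant \<open>K / c\<close>; hence the exponent \<open>Suc m\<close>.\<close>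
    finally have "u t * (u t ^ m * c) \<le> u t * (t * K)" using elim by (intro mult_left_mono) auto
    also have "\<dots> = t * (u t * K)" by simp
    also have "\<dots> \<le> t * c" using elim by (intro mult_left_mono) auto
    finally have "u t ^ Suc m * c \<le> t * c" by (simp add: mult.assoc)
    then show ?case using c by simp
  qed
  then show ?thesis by (intro exI[of _ "Suc m"]) simp
qed

text \<open>Near \<open>0\<close> the graph stays in one basic set. If all equations of that set
  were trivial, its vertical slices would be open, but they are single points; so \<open>u\<close>
  is a root of a nonzero polynomial.\<close>

lemma semialgebraic_on_power_le:
  assumes u: "semialgebraic_on e u" and e: "0 < e"
    and pos: "\<And>t. 0 < t \<Longrightarrow> t < e \<Longrightarrow> 0 < u t" and lim: "(u \<longlongrightarrow> 0) (at_right 0)"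
  shows "\<exists>N\<ge>1. \<forall>\<^sub>F t in at_right 0. u t ^ N \<le> t"
proof -
  let ?\<Gamma> = "{z. 0 < fst z \<and> fst z < e \<and> snd z = u (fst z)}"
  have \<Gamma>: "semialgebraic ?\<Gamma>" using u by (simp add: semialgebraic_on_def)
  then obtain F where F: "finite F" "\<forall>i\<in>F. finite_polynomial_pair i" "?\<Gamma> = (\<Union>i\<in>F. basic_semialgebraic i)"
    unfolding semialgebraic_iff by blast
  have ev: "\<forall>\<^sub>F t in at_right 0. 0 < t \<and> t < e"
    unfolding eventually_at_right_field using e by blast
  have "\<exists>i\<in>F. \<forall>\<^sub>F t in at_right 0. (t, u t) \<in> basic_semialgebraic i"
  proof (rule ccontr)
    assume not: "\<not> (\<exists>i\<in>F. \<forall>\<^sub>F t in at_right 0. (t, u t) \<in> basic_semialgebraic i)"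
    have "\<forall>\<^sub>F t in at_right 0. (t, u t) \<notin> basic_semialgebraic i" if i: "i \<in> F" for i
    proof -
      have B: "semialgebraic (basic_semialgebraic i)" using F(2) i by (intro semialgebraic_basic) blast
      have sub: "z \<in> basic_semialgebraic i \<Longrightarrow> snd z = u (fst z)" for z using F(3) i by blast
      have "semialgebraic {t. \<exists>s. (t, s) \<in> basic_semialgebraic i}"
        by (intro semialgebraic_intros semialgebraic_mem[OF B] polynomial_intros)
      also have "{t. \<exists>s. (t, s) \<in> basic_semialgebraic i} = {t. (t, u t) \<in> basic_semialgebraic i}"
        using sub by fastforce
      finally show ?thesis using semialgebraic_at_right[of _ 0] not i by fastforce
    qed
    then have "\<forall>\<^sub>F t in at_right 0. \<forall>i\<in>F. (t, u t) \<notin> basic_semialgebraic i"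
      using F(1) by (simp add: eventually_ball_finite_distrib)
    with ev have "\<forall>\<^sub>F t in at_right (0::real). False"
    proof eventually_elim
      case (elim t)
      then have "(t, u t) \<in> ?\<Gamma>" by simp
      then show ?case using elim unfolding F(3) by blast
    qed
    then show False by (simp add: trivial_limit_at_right_real eventually_False)
  qed
  then obtain i where i: "i \<in> F" "\<forall>\<^sub>F t in at_right 0. (t, u t) \<in> basic_semialgebraic i" by blast
  have fin: "finite (snd i)" and rpf: "\<And>p. p \<in> fst i \<union> snd i \<Longrightarrow> real_polynomial_function p"
    using F(2) i(1) by (auto simp: finite_polynomial_pair_def)
  have "\<exists>p\<in>fst i. \<exists>z. p z \<noteq> 0"
  proof (rule ccontr)
    assume not: "\<not> (\<exists>p\<in>fst i. \<exists>z. p z \<noteq> 0)"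
    obtain t where t: "(t, u t) \<in> basic_semialgebraic i"
      using eventually_happens[OF i(2)] trivial_limit_at_right_real by blast
    define S where "S = (\<Inter>q\<in>snd i. {s. 0 < q (t, s)})"
    have "open S" unfolding S_def
    proof (intro open_INT fin ballI open_Collect_less continuous_on_const)
      fix q assume "q \<in> snd i"
      then have "\<And>z. isCont q z" using rpf continuous_real_polymonial_function by blast
      then have "continuous_on UNIV q" by (simp add: continuous_at_imp_continuous_on)
      then show "continuous_on UNIV (\<lambda>s. q (t, s))"
        by (rule continuous_on_compose2) (auto intro!: continuous_intros)
    qed
    moreover have "S = {u t}"
    proof
      show "{u t} \<subseteq> S" using t by (auto simp: S_def basic_semialgebraic_def)
      show "S \<subseteq> {u t}"
      proof
        fix s assume "s \<in> S"
        then have "(t, s) \<in> basic_semialgebraic i" using not by (auto simp: S_def basic_semialgebraic_def)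
        then have "(t, s) \<in> ?\<Gamma>" unfolding F(3) using i(1) by blast
        then show "s \<in> {u t}" by simp
      qed
    qed
    ultimately show False using not_open_singleton by blast
  qed
  then obtain p a b where p: "p \<in> fst i" "p (a, b) \<noteq> 0" by auto
  obtain P where P: "\<And>t s. p (t, s) = poly (poly P [:t:]) s"
    using bivariate_polynomial_representation[of p] rpf p(1) by blast
  show ?thesis
  proof (rule power_le_if_bivariate_root[OF _ _ _ lim])
    show "P \<noteq> 0" using P[of a b] p(2) by auto
    show "\<forall>\<^sub>F t in at_right 0. poly (poly P [:t:]) (u t) = 0"
      using i(2) by eventually_elim (use p P in \<open>auto simp: basic_semialgebraic_def\<close>)
    show "\<forall>\<^sub>F t in at_right 0. 0 < u t" using ev by eventually_elim (use pos in auto)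
  qed
qed

section \<open>Slopes on levels near a point\<close>

text \<open>This is the condition on \<open>\<epsilon>\<close> in \<open>slope\<close>, with the
  sign of \<open>\<epsilon>\<close> left free; it keeps extended reals out of the estimates.\<close>

definition locally_minimal :: "'a::metric_space set \<Rightarrow> ('a \<Rightarrow> real) \<Rightarrow> 'a \<Rightarrow> real \<Rightarrow> bool" where
  "locally_minimal X F x \<epsilon> \<longleftrightarrow> (\<exists>r>0. \<forall>y\<in>X. dist y x < r \<longrightarrow> F x \<le> F y + \<epsilon> * dist x y)"

lemma locally_minimal_mono:
  assumes "locally_minimal X F x \<epsilon>" "\<epsilon> \<le> \<delta>"
  shows "locally_minimal X F x \<delta>"
proof -
  have "F x \<le> F y + \<delta> * dist x y" if "F x \<le> F y + \<epsilon> * dist x y" for y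
    using that mult_right_mono[OF assms(2), of "dist x y"] by simp
  then show ?thesis using assms(1) unfolding locally_minimal_def by blast
qed

text \<open>For \<open>c\<close> a multiple of a Euclidean distance, the right side involves only
  the squared distance, which is polynomial.\<close>

lemma le_add_iff_squares:
  fixes c :: real
  assumes "0 \<le> c"
  shows "v \<le> s + c \<longleftrightarrow> v \<le> s \<or> (v - s) * (v - s) \<le> c * c"
proof
  assume *: "v \<le> s + c"
  show "v \<le> s \<or> (v - s) * (v - s) \<le> c * c"
  proof (cases "v \<le> s")
    case False
    then have "(v - s) * (v - s) \<le> c * c" using * by (intro mult_mono) auto
    then show ?thesis ..
  qed simp
next
  assume "v \<le> s \<or> (v - s) * (v - s) \<le> c * c"
  then show "v \<le> s + c"
  proof
    assume "(v - s) * (v - s) \<le> c * c"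
    then have "\<bar>v - s\<bar> \<le> \<bar>c\<bar>" by (simp add: abs_le_square_iff power2_eq_square)
    then show ?thesis using assms by linarith
  qed (use assms in simp)
qed

lemma dist_less_iff_inner:
  fixes x y :: "'a::euclidean_space"
  assumes "0 < r"
  shows "dist x y < r \<longleftrightarrow> (x - y) \<bullet> (x - y) < r * r"
proof -
  have "dist x y < r \<longleftrightarrow> (dist x y)\<^sup>2 < r\<^sup>2"
    using assms power_less_imp_less_base[of "dist x y" 2 r] power_strict_mono[of "dist x y" r 2] by auto
  then show ?thesis by (simp only: dist_norm power2_norm_eq_inner) (simp only: power2_eq_square)
qed

lemma semialgebraic_locally_minimal:
  fixes X :: "'a::euclidean_space set"
  assumes G: "semialgebraic {z. fst z \<in> X \<and> snd z = F (fst z)}"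
  shows "semialgebraic {z. fst z \<in> X \<and> 0 < snd z \<and> locally_minimal X F (fst z) (snd z)}"
proof -
  let ?G = "{z. fst z \<in> X \<and> snd z = F (fst z)}"
  define P where "P z \<longleftrightarrow> (\<exists>v r. (fst z, v) \<in> ?G \<and> 0 < snd z \<and> 0 < r \<and>
      (\<forall>y s. (y, s) \<in> ?G \<and> (y - fst z) \<bullet> (y - fst z) < r * r \<longrightarrow>
        v \<le> s \<or> (v - s) * (v - s) \<le> (snd z * snd z) * ((fst z - y) \<bullet> (fst z - y))))" for z
  have "P z \<longleftrightarrow> fst z \<in> X \<and> 0 < snd z \<and> locally_minimal X F (fst z) (snd z)" for z
  proof -
    have "(F x \<le> F y \<or> (F x - F y) * (F x - F y) \<le> (\<epsilon> * \<epsilon>) * ((x - y) \<bullet> (x - y))) \<longleftrightarrow> F x \<le> F y + \<epsilon> * dist x y"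
      if "0 < \<epsilon>" for x y \<epsilon>
    proof -
      have "(\<epsilon> * \<epsilon>) * ((x - y) \<bullet> (x - y)) = (\<epsilon> * dist x y) * (\<epsilon> * dist x y)"
        by (simp add: dist_norm power2_norm_eq_inner[symmetric] power2_eq_square)
      then show ?thesis using le_add_iff_squares[of "\<epsilon> * dist x y" "F x" "F y"] that by (simp only:) simp
    qed
    note * = this
    show ?thesis
    proof
      assume "P z"
      then obtain r where z: "fst z \<in> X" "0 < snd z" and r: "0 < r"
        "\<And>y. y \<in> X \<Longrightarrow> (y - fst z) \<bullet> (y - fst z) < r * r \<Longrightarrow>
        F (fst z) \<le> F y \<or> (F (fst z) - F y) * (F (fst z) - F y) \<le> (snd z * snd z) * ((fst z - y) \<bullet> (fst z - y))"
        unfolding P_def by auto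
      then show "fst z \<in> X \<and> 0 < snd z \<and> locally_minimal X F (fst z) (snd z)"
        unfolding locally_minimal_def using dist_less_iff_inner[OF r(1)] *[OF z(2)] by blast
    next
      assume z: "fst z \<in> X \<and> 0 < snd z \<and> locally_minimal X F (fst z) (snd z)"
      then obtain r where r: "0 < r" "\<And>y. y \<in> X \<Longrightarrow> dist y (fst z) < r \<Longrightarrow> F (fst z) \<le> F y + snd z * dist (fst z) y"
        unfolding locally_minimal_def by blast
      have "F (fst z) \<le> F y \<or> (F (fst z) - F y) * (F (fst z) - F y) \<le> (snd z * snd z) * ((fst z - y) \<bullet> (fst z - y))"
        if "y \<in> X" "(y - fst z) \<bullet> (y - fst z) < r * r" for y
        using that r(2)[of y] dist_less_iff_inner[OF r(1), of y "fst z"] *[of "snd z" "fst z" y] z by blast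
      then show "P z" unfolding P_def using z r(1)
        by (intro exI[of _ "F (fst z)"] exI[of _ r]) auto
    qed
  qed
  moreover have "semialgebraic {z. P z}"
    unfolding P_def by (intro semialgebraic_intros semialgebraic_mem[OF G] polynomial_intros)
  ultimately show ?thesis by simp
qed

lemma semialgebraic_no_small_slopes:
  fixes X :: "'a::euclidean_space set"
  assumes G: "semialgebraic {z. fst z \<in> X \<and> snd z = F (fst z)}" and C: "0 < C"
  shows "\<forall>\<^sub>F t in at_right 0. \<forall>x\<in>X. dist x x0 \<le> 1 \<and> F x = v0 + t \<longrightarrow> \<not> locally_minimal X F x (C * t)"
proof -
  let ?G = "{z. fst z \<in> X \<and> snd z = F (fst z)}"
  let ?L = "{z. fst z \<in> X \<and> 0 < snd z \<and> locally_minimal X F (fst z) (snd z)}"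
  define A where "A = {z. 0 < fst z \<and> (snd z, v0 + fst z) \<in> ?G \<and> (snd z - x0) \<bullet> (snd z - x0) \<le> 1 \<and> (snd z, C * fst z) \<in> ?L}"
  have A: "semialgebraic A" unfolding A_def
    by (intro semialgebraic_intros semialgebraic_mem[OF G] semialgebraic_mem[OF semialgebraic_locally_minimal[OF G]]
        polynomial_intros)
  have Ad: "0 < t \<and> x \<in> X \<and> F x = v0 + t \<and> dist x x0 \<le> 1 \<and> locally_minimal X F x (C * t)" if "(t, x) \<in> A" for t x
  proof -
    have "(dist x x0)\<^sup>2 \<le> 1" using that by (simp add: A_def dist_norm power2_norm_eq_inner)
    then show ?thesis using that by (auto simp: A_def abs_square_le_1)
  qed
  have "semialgebraic {t. \<exists>x. (t, x) \<in> A}"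
    by (intro semialgebraic_intros semialgebraic_mem[OF A] polynomial_intros)
  from semialgebraic_at_right[OF this, of 0]
  show ?thesis
  proof
    assume "\<forall>\<^sub>F t in at_right 0. t \<notin> {t. \<exists>x. (t, x) \<in> A}"
    moreover have "\<forall>\<^sub>F t::real in at_right 0. 0 < t" by (simp add: eventually_at_filter)
    ultimately show ?thesis
    proof eventually_elim
      case (elim t)
      show ?case
      proof (intro ballI impI notI)
        fix x assume x: "x \<in> X" "dist x x0 \<le> 1 \<and> F x = v0 + t" "locally_minimal X F x (C * t)"
        then have "(dist x x0)\<^sup>2 \<le> 1" by (simp add: abs_square_le_1)
        then have "(x - x0) \<bullet> (x - x0) \<le> 1" by (simp add: dist_norm power2_norm_eq_inner)
        then have "(t, x) \<in> A" using x elim C by (simp add: A_def)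
        then show False using elim by blast
      qed
    qed
  next
    assume "\<forall>\<^sub>F t in at_right 0. t \<in> {t. \<exists>x. (t, x) \<in> A}"
    then obtain e where e: "0 < e" "\<And>t. 0 < t \<Longrightarrow> t < e \<Longrightarrow> \<exists>x. (t, x) \<in> A"
      unfolding eventually_at_right_field by blast
    have bound: "norm x \<le> norm x0 + 1" if "(t, x) \<in> A" for t x
      using Ad[OF that] norm_triangle_sub[of x x0] by (simp add: dist_norm)
    have "\<exists>D \<subseteq> A. semialgebraic D \<and> fst ` D = fst ` A \<and> (\<forall>a x x'. (a, x) \<in> D \<longrightarrow> (a, x') \<in> D \<longrightarrow> x = x')"
      using A bound by (rule semialgebraic_choice)
    then obtain D where D: "D \<subseteq> A" "semialgebraic D" "fst ` D = fst ` A"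
      "\<forall>a x x'. (a, x) \<in> D \<longrightarrow> (a, x') \<in> D \<longrightarrow> x = x'" by (elim exE conjE)
    define \<xi> where "\<xi> t = (THE x. (t, x) \<in> D)" for t
    have \<xi>_eq: "\<xi> t = x" if "(t, x) \<in> D" for t x
      unfolding \<xi>_def using that D(4) by (intro the_equality) blast+
    have \<xi>D: "(t, \<xi> t) \<in> D" if "0 < t" "t < e" for t
    proof -
      have "t \<in> fst ` A" using e(2)[OF that] by force
      then obtain x where "(t, x) \<in> D" unfolding D(3)[symmetric] by auto
      then show ?thesis using \<xi>_eq by simp
    qed
    have sa: "semialgebraic_on e (\<lambda>t. \<xi> t \<bullet> b)" for b
    proof -
      have "semialgebraic {z. 0 < fst z \<and> fst z < e \<and> (\<exists>x. (fst z, x) \<in> D \<and> snd z = x \<bullet> b)}"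
        by (intro semialgebraic_intros semialgebraic_mem[OF D(2)] polynomial_intros)
      also have "{z. 0 < fst z \<and> fst z < e \<and> (\<exists>x. (fst z, x) \<in> D \<and> snd z = x \<bullet> b)} =
          {z. 0 < fst z \<and> fst z < e \<and> snd z = \<xi> (fst z) \<bullet> b}"
      proof (intro Collect_cong conj_cong refl)
        fix z :: "real \<times> real" assume "0 < fst z" "fst z < e"
        from \<xi>D[OF this] show "(\<exists>x. (fst z, x) \<in> D \<and> snd z = x \<bullet> b) = (snd z = \<xi> (fst z) \<bullet> b)"
          using \<xi>_eq[of "fst z"] by blast
      qed
      finally show ?thesis unfolding semialgebraic_on_def .
    qed
    have "\<forall>b. \<exists>d \<sigma>. 0 < d \<and> d \<le> e \<and> continuous_on {0<..<d} (\<lambda>t. \<xi> t \<bullet> b) \<and> \<bar>\<sigma>\<bar> = 1 \<and>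
      (\<forall>s t. 0 < s \<longrightarrow> s \<le> t \<longrightarrow> t < d \<longrightarrow> \<sigma> * (\<xi> s \<bullet> b) \<le> \<sigma> * (\<xi> t \<bullet> b))"
      using semialgebraic_on_monotone[OF sa e(1)] by blast
    then obtain d \<sigma> where d: "\<And>b. 0 < d b" "\<And>b. d b \<le> e" "\<And>b. continuous_on {0<..<d b} (\<lambda>t. \<xi> t \<bullet> b)"
      and \<sigma>: "\<And>b. \<bar>\<sigma> b :: real\<bar> = 1"
      "\<And>b s t. 0 < s \<Longrightarrow> s \<le> t \<Longrightarrow> t < d b \<Longrightarrow> \<sigma> b * (\<xi> s \<bullet> b) \<le> \<sigma> b * (\<xi> t \<bullet> b)"
      by metis
    define a where "a = Min (d ` Basis)"
    have a: "0 < a" using d(1) by (simp add: a_def)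
    have ad: "a \<le> d b" if "b \<in> Basis" for b using that by (simp add: a_def)
    have ae: "a \<le> e" using ad[OF SOME_Basis] d(2) order_trans by blast
    \<comment> \<open>The signs make every summand nondecreasing, so increments of \<open>V\<close>
      dominate distances along the curve: \<open>V\<close> stands in for arc length.\<close>
    define V where "V t = (\<Sum>b\<in>Basis. \<sigma> b * (\<xi> t \<bullet> b))" for t
    have contb: "continuous_on {0<..<a} (\<lambda>t. \<xi> t \<bullet> b)" if "b \<in> Basis" for b
      using d(3)[of b] ad[OF that] by (auto elim: continuous_on_subset)
    have contV: "continuous_on {0<..<a} V" unfolding V_def
      by (intro continuous_on_sum continuous_on_mult continuous_on_const contb)
    have cont\<xi>: "continuous_on {0<..<a} \<xi>"
      unfolding continuous_on_componentwise[of _ \<xi>] using contb by blast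
    have dist\<xi>: "dist (\<xi> t) (\<xi> s) \<le> V t - V s" if "0 < s" "s \<le> t" "t < a" for s t
    proof -
      have "dist (\<xi> t) (\<xi> s) \<le> (\<Sum>b\<in>Basis. \<bar>(\<xi> t - \<xi> s) \<bullet> b\<bar>)"
        unfolding dist_norm by (rule norm_le_l1)
      also have "\<dots> = (\<Sum>b\<in>Basis. \<sigma> b * (\<xi> t \<bullet> b) - \<sigma> b * (\<xi> s \<bullet> b))"
      proof (rule sum.cong[OF refl])
        fix b :: 'a assume b: "b \<in> Basis"
        have "\<bar>(\<xi> t - \<xi> s) \<bullet> b\<bar> = \<bar>\<sigma> b * ((\<xi> t - \<xi> s) \<bullet> b)\<bar>" using \<sigma>(1) by (simp add: abs_mult)
        also have "\<dots> = \<sigma> b * (\<xi> t \<bullet> b) - \<sigma> b * (\<xi> s \<bullet> b)"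
          using \<sigma>(2)[of s t b] that ad[OF b] by (simp add: inner_diff_left right_diff_distrib)
        finally show "\<bar>(\<xi> t - \<xi> s) \<bullet> b\<bar> = \<sigma> b * (\<xi> t \<bullet> b) - \<sigma> b * (\<xi> s \<bullet> b)" .
      qed
      also have "\<dots> = V t - V s" by (simp add: V_def sum_subtractf)
      finally show ?thesis .
    qed
    have Vbound: "\<bar>V t\<bar> \<le> DIM('a) * (norm x0 + 1)" if "0 < t" "t < a" for t
    proof -
      have "(t, \<xi> t) \<in> A" using \<xi>D[of t] that ae D(1) by auto
      then have n: "norm (\<xi> t) \<le> norm x0 + 1" by (rule bound)
      have "\<bar>V t\<bar> \<le> (\<Sum>b\<in>(Basis::'a set). \<bar>\<sigma> b * (\<xi> t \<bullet> b)\<bar>)" unfolding V_def by (rule sum_abs)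
      also have "\<dots> \<le> (\<Sum>b\<in>(Basis::'a set). norm x0 + 1)"
      proof (rule sum_mono)
        fix b :: 'a assume "b \<in> Basis"
        then show "\<bar>\<sigma> b * (\<xi> t \<bullet> b)\<bar> \<le> norm x0 + 1"
          using \<sigma>(1) n Basis_le_norm[of b "\<xi> t"] by (simp add: abs_mult)
      qed
      finally show ?thesis by simp
    qed
    \<comment> \<open>The curve satisfies \<open>t - s \<le> C * t * (V t - V s)\<close>, so
      \<open>ln t\<close> grows at most \<open>2 * C\<close> times as fast as \<open>V\<close>; the
      factor 2 pays for replacing \<open>1 / s\<close> by \<open>1 / t\<close> when
      \<open>s > t / 2\<close>.\<close>
    define W where "W t = 2 * C * V t - ln t" for t
    have W: "W s \<le> W t" if st: "0 < s" "s \<le> t" "t < a" for s t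
    proof (rule le_if_left_nondecreasing[OF _ _ st])
      show "continuous_on {0<..<a} W" unfolding W_def
        by (intro continuous_intros contV) auto
      fix t assume t: "0 < t" "t < a"
      have "(t, \<xi> t) \<in> A" using \<xi>D[of t] t ae D(1) by auto
      from Ad[OF this] obtain r where Ft: "F (\<xi> t) = v0 + t" and r: "0 < r"
        "\<And>y. y \<in> X \<Longrightarrow> dist y (\<xi> t) < r \<Longrightarrow> F (\<xi> t) \<le> F y + C * t * dist (\<xi> t) y"
        unfolding locally_minimal_def by blast
      have "isCont \<xi> t" using cont\<xi> t by (simp add: continuous_on_eq_continuous_at)
      then have "(\<xi> \<longlongrightarrow> \<xi> t) (at_left t)" by (simp add: isCont_def filterlim_at_split)
      then have "\<forall>\<^sub>F s in at_left t. dist (\<xi> s) (\<xi> t) < r" using r(1) by (simp add: tendsto_iff)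
      moreover have "\<forall>\<^sub>F s in at_left t. t / 2 < s \<and> s < t"
        unfolding eventually_at_left_field using t by (intro exI[of _ "t / 2"]) auto
      ultimately show "\<forall>\<^sub>F s in at_left t. W s \<le> W t"
      proof eventually_elim
        case (elim s)
        then have s: "0 < s" "s < t" "t < 2 * s" using t by auto
        have "(s, \<xi> s) \<in> A" using \<xi>D[of s] s t ae D(1) by auto
        then have "\<xi> s \<in> X" "F (\<xi> s) = v0 + s" using Ad by blast+
        \<comment> \<open>The point \<open>\<xi> s\<close> competes with \<open>\<xi> t\<close> in
          the local minimality, and their values differ by exactly \<open>t - s\<close>.\<close>
        then have "t - s \<le> C * t * dist (\<xi> t) (\<xi> s)" using r(2)[of "\<xi> s"] elim Ft by simp
        also have "\<dots> \<le> C * t * (V t - V s)" using dist\<xi>[of s t] s t C by (intro mult_left_mono) auto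
        finally have "t - s \<le> C * t * (V t - V s)" .
        moreover have "ln t - ln s \<le> (t - s) / s" using ln_diff_le[of t s] s t by simp
        moreover have "(t - s) / s \<le> 2 * (t - s) / t"
        proof -
          have "(t - s) * t \<le> (t - s) * (2 * s)" using s by (intro mult_left_mono) auto
          then show ?thesis using s t by (simp add: field_simps)
        qed
        moreover have "2 * (t - s) / t \<le> 2 * C * (V t - V s)"
          using \<open>t - s \<le> C * t * (V t - V s)\<close> t by (simp add: field_simps)
        ultimately show ?case by (simp add: W_def right_diff_distrib)
      qed
    qed
    define K where "K = DIM('a) * (norm x0 + 1)"
    \<comment> \<open>Bounded \<open>V\<close> sends \<open>W\<close> to infinity at
      \<open>0\<close>, against monotonicity: already \<open>- ln s \<ge> M\<close> yields
      \<open>W s \<ge> W (a / 2) + 1\<close>.\<close>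
    define M where "M = W (a / 2) + 2 * C * K + 1"
    define s where "s = min (a / 2) (exp (- M))"
    have s: "0 < s" "s \<le> a / 2" using a by (auto simp: s_def)
    have "ln s \<le> ln (exp (- M))" using s by (subst ln_le_cancel_iff) (auto simp: s_def)
    then have "M \<le> - ln s" by simp
    moreover have "- K \<le> V s" using Vbound[of s] s a by (simp add: K_def)
    then have "- (2 * C * K) \<le> 2 * C * V s" using mult_left_mono[of "-K" "V s" "2 * C"] C by simp
    ultimately have "W (a / 2) + 1 \<le> W s" by (simp add: W_def M_def)
    moreover have "W s \<le> W (a / 2)" using s a by (intro W) auto
    ultimately show ?thesis by simp
  qed
qed

section \<open>Roots as desingularizers and the KL property\<close>

lemma concave_tangent:
  fixes \<phi> :: "real \<Rightarrow> real"
  assumes conc: "concave_on {0..} \<phi>" and der: "(\<phi> has_real_derivative \<phi>') (at a)" and "0 < a" "0 \<le> b"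
  shows "\<phi>' * (a - b) \<le> \<phi> a - \<phi> b"
proof -
  have "(- \<phi>') * (b - a) \<le> - \<phi> b - - \<phi> a"
  proof (rule convex_on_imp_above_tangent[where A = "{0..}"])
    show "convex_on {0..} (\<lambda>x. - \<phi> x)" using conc by (simp add: concave_on_def)
    show "((\<lambda>x. - \<phi> x) has_real_derivative - \<phi>') (at a within {0..})"
      by (rule has_field_derivative_at_within, rule DERIV_minus, rule der)
    show "a \<in> interior {0..}" using assms by (simp add: interior_real_atLeast)
  qed (use assms in auto)
  then show ?thesis by (simp add: algebra_simps)
qed

lemma concave_on_root:
  assumes "0 < n"
  shows "concave_on {0..} (root n)"
proof -
  have conv: "convex_on {0..} (\<lambda>x::real. x ^ n)"
    using convex_power_even[of n] convex_power_odd[of n] convex_on_subset[OF _ subset_UNIV convex_real_interval(1)]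
    by (cases "even n") auto
  have "u * root n x + v * root n y \<le> root n (u * x + v * y)"
    if "0 \<le> x" "0 \<le> y" "0 \<le> u" "0 \<le> v" "u + v = 1" for x y u v
  proof -
    have "(u * root n x + v * root n y) ^ n \<le> u * root n x ^ n + v * root n y ^ n"
      using conv[unfolded convex_on_def, THEN conjunct2, rule_format, of "root n x" "root n y" u v] that assms by simp
    also have "\<dots> = u * x + v * y" using assms that by simp
    finally have "root n ((u * root n x + v * root n y) ^ n) \<le> root n (u * x + v * y)"
      using assms by simp
    then show ?thesis using assms that by (simp add: real_root_power_cancel)
  qed
  then show ?thesis unfolding concave_on_iff by (auto simp: convex_real_interval)
qed

text \<open>The factor \<open>N\<close> cancels in the derivative, which becomes
  \<open>t powr (1 / N - 1)\<close> for \<open>t > 0\<close>. The cut at negative arguments is the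
  required extension by zero.\<close>

definition root_desingularizer :: "nat \<Rightarrow> real \<Rightarrow> real" where
  "root_desingularizer N t = (if t < 0 then 0 else N * root N t)"

lemma root_desingularizer_deriv:
  assumes "1 \<le> N" "0 < t"
  shows "(root_desingularizer N has_real_derivative inverse (root N t ^ (N - 1))) (at t)"
proof -
  have "((\<lambda>t. N * root N t) has_real_derivative N * inverse (N * root N t ^ (N - 1))) (at t)"
    using DERIV_cmult[OF DERIV_real_root[of N t], of "real N"] assms by simp
  then have "((\<lambda>t. N * root N t) has_real_derivative inverse (root N t ^ (N - 1))) (at t)"
    using assms by (simp add: field_simps)
  then show ?thesis
    by (rule has_field_derivative_transform_within_open[where S = "{0<..}"])
      (use assms in \<open>auto simp: root_desingularizer_def\<close>)
qed

lemma concave_on_root_desingularizer: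
  assumes "1 \<le> N"
  shows "concave_on {0..} (root_desingularizer N)"
proof -
  have "concave_on {0..} (\<lambda>t. real N * root N t)"
    unfolding concave_on_def minus_mult_right
    by (rule convex_on_cmul) (use concave_on_root[of N] assms in \<open>auto simp: concave_on_def\<close>)
  moreover have "0 \<le> u * x + v * y" if "0 \<le> x" "0 \<le> y" "0 \<le> u" "0 \<le> v" for x y u v :: real
    using that by simp
  ultimately show ?thesis by (auto simp: concave_on_iff root_desingularizer_def not_less[symmetric])
qed

lemma desingularizer_root_desingularizer:
  assumes N: "1 \<le> N"
  shows "desingularizer (root_desingularizer N)"
proof -
  have "continuous_on {0..} (\<lambda>t. real N * root N t)" by (intro continuous_intros)
  then have "continuous_on {0..} (root_desingularizer N)"
    by (rule continuous_on_eq) (simp add: root_desingularizer_def)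
  moreover have "continuous_on {0<..} (\<lambda>t. inverse (root N t ^ (N - 1)))"
    by (intro continuous_intros) (use N in auto)
  moreover have "0 < inverse (root N t ^ (N - 1))" if "0 < t" for t using that N by simp
  ultimately show ?thesis
    unfolding desingularizer_def using root_desingularizer_deriv[OF N] N
    by (auto simp: root_desingularizer_def)
qed

lemma lower_semicontinuous_on_if_continuous_on:
  "continuous_on X F \<Longrightarrow> lower_semicontinuous_on X F"
  unfolding lower_semicontinuous_on_def continuous_on_def by (blast intro: order_tendstoD(1))

text \<open>This is a Lojasiewicz inequality with exponent \<open>1 - 1 / N\<close>, stated for
  every positive upper bound \<open>r\<close> of the slope that local minimality provides.\<close>

lemma semialgebraic_minimal_slope:
  fixes X :: "'a::euclidean_space set" and F :: "'a \<Rightarrow> real"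
  assumes G: "semialgebraic {z. fst z \<in> X \<and> snd z = F (fst z)}"
  shows "\<exists>N\<ge>1. \<exists>\<rho>>0. \<forall>x\<in>X. \<forall>r>0. dist x x0 \<le> 1 \<longrightarrow> v0 < F x \<longrightarrow> F x < v0 + \<rho> \<longrightarrow>
    locally_minimal X F x r \<longrightarrow> root N (F x - v0) ^ (N - 1) \<le> r"
proof -
  let ?G = "{z. fst z \<in> X \<and> snd z = F (fst z)}"
  let ?L = "{z. fst z \<in> X \<and> 0 < snd z \<and> locally_minimal X F (fst z) (snd z)}"
  \<comment> \<open>The value \<open>1\<close> is added over every \<open>t\<close> so that the
    infimum below is over a nonempty set. It does not disturb the lower bounds, because
    \<open>C * t < 1\<close> for small \<open>t\<close>.\<close>
  define S where "S = {z. snd z = 1 \<or> (\<exists>x. (x, v0 + fst z) \<in> ?G \<and> (x - x0) \<bullet> (x - x0) \<le> 1 \<and> (x, snd z) \<in> ?L)}"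
  have S: "semialgebraic S" unfolding S_def
    by (intro semialgebraic_intros semialgebraic_mem[OF G] semialgebraic_mem[OF semialgebraic_locally_minimal[OF G]]
        polynomial_intros)
  have norm_iff: "(x - x0) \<bullet> (x - x0) \<le> 1 \<longleftrightarrow> dist x x0 \<le> 1" for x
    using abs_square_le_1[of "dist x x0"] by (simp add: dist_norm power2_norm_eq_inner)
  have Smem: "(t, r) \<in> S \<longleftrightarrow> r = 1 \<or> (\<exists>x\<in>X. 0 < r \<and> dist x x0 \<le> 1 \<and> F x = v0 + t \<and> locally_minimal X F x r)" for t r
    unfolding S_def norm_iff by auto
  define M where "M t = Inf {r. (t, r) \<in> S}" for t
  have bdd: "bdd_below {r. (t, r) \<in> S}" for t by (intro bdd_belowI[of _ 0]) (auto simp: Smem)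
  have ne: "{r. (t, r) \<in> S} \<noteq> {}" for t using Smem[of t 1] by blast
  have M_lower: "M t \<le> r" if "(t, r) \<in> S" for t r
    unfolding M_def using that bdd by (intro cInf_lower) auto
  have M_large: "\<forall>\<^sub>F t in at_right 0. C * t \<le> M t" if C: "0 < C" for C
  proof -
    have "\<forall>\<^sub>F t in at_right 0. 0 < t \<and> t < 1 / C"
      unfolding eventually_at_right_field using C by (intro exI[of _ "1 / C"]) auto
    with semialgebraic_no_small_slopes[OF G C, of x0 v0] show ?thesis
    proof eventually_elim
      case (elim t)
      show ?case unfolding M_def
      proof (rule cInf_greatest[OF ne])
        fix r assume "r \<in> {r. (t, r) \<in> S}"
        then consider "r = 1" | x where "x \<in> X" "dist x x0 \<le> 1" "F x = v0 + t" "locally_minimal X F x r"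
          by (auto simp: Smem)
        then show "C * t \<le> r"
        proof cases
          case 1
          then show ?thesis using elim C by (simp add: field_simps)
        next
          case 2
          then have "\<not> r \<le> C * t" using elim locally_minimal_mono by blast
          then show ?thesis by simp
        qed
      qed
    qed
  qed
  \<comment> \<open>The case \<open>C = 1\<close> makes \<open>M\<close> positive, so that the
    quotient \<open>t / M t\<close> is determined by a polynomial equation.\<close>
  obtain e where e: "0 < e" "\<And>t. 0 < t \<Longrightarrow> t < e \<Longrightarrow> t \<le> M t"
    using M_large[of 1] unfolding eventually_at_right_field by auto
  have "\<exists>N\<ge>1. \<forall>\<^sub>F t in at_right 0. (t / M t) ^ N \<le> t"
  proof (rule semialgebraic_on_power_le[OF _ e(1)])
    define isInf where "isInf t m \<longleftrightarrow> (\<forall>r. (t, r) \<in> S \<longrightarrow> m \<le> r) \<and> (\<forall>m'. (\<forall>r. (t, r) \<in> S \<longrightarrow> m' \<le> r) \<longrightarrow> m' \<le> m)" for t m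
    have "m \<le> M t" if "\<forall>r. (t, r) \<in> S \<longrightarrow> m \<le> r" for t m
      unfolding M_def using that by (intro cInf_greatest[OF ne]) auto
    then have "isInf t (M t)" for t unfolding isInf_def using M_lower by blast
    then have isInf: "isInf t m \<longleftrightarrow> m = M t" for t m
      unfolding isInf_def by (meson order_antisym)
    have "semialgebraic {z. 0 < fst z \<and> fst z < e \<and> (\<exists>m. isInf (fst z) m \<and> snd z * m = fst z)}"
      unfolding isInf_def by (intro semialgebraic_intros semialgebraic_mem[OF S] polynomial_intros)
    also have "{z. 0 < fst z \<and> fst z < e \<and> (\<exists>m. isInf (fst z) m \<and> snd z * m = fst z)} =
        {z. 0 < fst z \<and> fst z < e \<and> snd z = fst z / M (fst z)}"
    proof (intro Collect_cong conj_cong refl)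
      fix z :: "real \<times> real" assume "0 < fst z" "fst z < e"
      then have "M (fst z) > 0" using e(2)[of "fst z"] by simp
      then show "(\<exists>m. isInf (fst z) m \<and> snd z * m = fst z) = (snd z = fst z / M (fst z))"
        by (auto simp: isInf field_simps)
    qed
    finally show "semialgebraic_on e (\<lambda>t. t / M t)" by (simp add: semialgebraic_on_def)
    show "0 < t / M t" if "0 < t" "t < e" for t using e(2)[OF that] that by simp
    show "((\<lambda>t. t / M t) \<longlongrightarrow> 0) (at_right 0)"
    proof (rule order_tendstoI)
      have pos: "\<forall>\<^sub>F t in at_right 0. 0 < t \<and> t \<le> M t"
        unfolding eventually_at_right_field using e by (intro exI[of _ e]) auto
      fix a :: real
      show "\<forall>\<^sub>F t in at_right 0. a < t / M t" if "a < 0"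
        using pos
      proof eventually_elim
        case (elim t)
        then have "0 \<le> t / M t" by simp
        then show ?case using that by linarith
      qed
      show "\<forall>\<^sub>F t in at_right 0. t / M t < a" if "0 < a"
      proof -
        have "\<forall>\<^sub>F t in at_right 0. 2 / a * t \<le> M t" using that by (intro M_large) simp
        with pos show ?thesis
        proof eventually_elim
          case (elim t)
          then have "2 * t \<le> a * M t" using that by (simp add: field_simps)
          moreover have "0 < M t" "0 < t" using elim by auto
          ultimately show ?case by (simp add: field_simps)
        qed
      qed
    qed
  qed
  then obtain N where N: "1 \<le> N" "\<forall>\<^sub>F t in at_right 0. (t / M t) ^ N \<le> t" by blast
  then obtain d where d: "0 < d" "\<And>t. 0 < t \<Longrightarrow> t < d \<Longrightarrow> (t / M t) ^ N \<le> t"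
    unfolding eventually_at_right_field by auto
  have "root N (F x - v0) ^ (N - 1) \<le> r"
    if x: "x \<in> X" "0 < r" "dist x x0 \<le> 1" "v0 < F x" "F x < v0 + min d e" "locally_minimal X F x r" for x r
  proof -
    define t where "t = F x - v0"
    have t: "0 < t" "t < d" "t < e" using x by (auto simp: t_def)
    have "(t, r) \<in> S" unfolding Smem using x by (auto simp: t_def)
    then have "M t \<le> r" by (rule M_lower)
    have M: "0 < M t" using e(2)[of t] t by simp
    define w where "w = root N t"
    have w: "0 < w" "w ^ N = t" using t N(1) by (auto simp: w_def)
    have "t / M t = root N ((t / M t) ^ N)" using N(1) M t by (simp add: real_root_power_cancel)
    also have "\<dots> \<le> w" using N(1) d(2)[of t] t by (simp add: w_def)
    finally have "t \<le> w * M t" using M by (simp add: field_simps)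
    \<comment> \<open>Cancelling \<open>w = root N t\<close> in \<open>t \<le> w * M t\<close>
      leaves exactly the power \<open>w ^ (N - 1)\<close>.\<close>
    moreover have "w * w ^ (N - 1) = t" using w(2) N(1) by (simp add: power_eq_if)
    ultimately have "w * w ^ (N - 1) \<le> w * M t" by simp
    then have "w ^ (N - 1) \<le> M t" using w(1) by simp
    then show ?thesis using \<open>M t \<le> r\<close> by (simp add: w_def t_def)
  qed
  then show ?thesis using N(1) d(1) e(1) by (intro exI[of _ N] conjI exI[of _ "min d e"]) auto
qed

text \<open>Local minimality with constant \<open>\<epsilon>\<close> for the desingularized function
  gives it with \<open>\<epsilon> * w\<close> for \<open>F\<close>, where \<open>1 / w\<close> is
  the derivative of the desingularizer. The Lojasiewicz inequality bounds this constant below by the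
  same \<open>w\<close>, so \<open>\<epsilon> \<ge> 1\<close>.\<close>

theorem KL_function_semialgebraic:
  fixes X :: "'a::euclidean_space set" and F :: "'a \<Rightarrow> real"
  assumes cont: "continuous_on X F" and G: "semialgebraic {z. fst z \<in> X \<and> snd z = F (fst z)}"
  shows "KL_function X F"
  unfolding KL_function_def
proof (intro conjI ballI)
  show "lower_semicontinuous_on X F" using cont by (rule lower_semicontinuous_on_if_continuous_on)
  fix x0 assume "x0 \<in> X"
  obtain N \<rho> where N: "1 \<le> N" and \<rho>: "0 < \<rho>"
    "\<And>x r. x \<in> X \<Longrightarrow> 0 < r \<Longrightarrow> dist x x0 \<le> 1 \<Longrightarrow> F x0 < F x \<Longrightarrow> F x < F x0 + \<rho> \<Longrightarrow>
      locally_minimal X F x r \<Longrightarrow> root N (F x - F x0) ^ (N - 1) \<le> r"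
    using semialgebraic_minimal_slope[OF G, of x0 "F x0"] by blast
  let ?\<phi> = "root_desingularizer N"
  have "1 \<le> slope X (\<lambda>y. ?\<phi> (F y - F x0)) x"
    if x: "x \<in> X" "dist x x0 < min 1 \<rho>" "0 < F x - F x0" "F x - F x0 < min 1 \<rho>" for x
    unfolding slope_def
  proof (rule Inf_greatest, clarify)
    fix \<epsilon> r :: real
    assume \<epsilon>: "0 < \<epsilon>" and r: "0 < r" "\<forall>y\<in>X \<inter> ball x r. ?\<phi> (F x - F x0) + \<epsilon> * dist x x \<le> ?\<phi> (F y - F x0) + \<epsilon> * dist x y"
    define w where "w = root N (F x - F x0) ^ (N - 1)"
    have w: "0 < w" using x N by (simp add: w_def)
    have "\<forall>\<^sub>F y in at x within X. F x0 < F y"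
      using cont x by (intro order_tendstoD(1)[of F "F x"]) (auto simp: continuous_on_def)
    then obtain d where d: "0 < d" "\<And>y. y \<in> X \<Longrightarrow> y \<noteq> x \<Longrightarrow> dist y x < d \<Longrightarrow> F x0 < F y"
      unfolding eventually_at by blast
    have "F x \<le> F y + (\<epsilon> * w) * dist x y" if y: "y \<in> X" "dist y x < min d r" for y
    proof -
      have "F x0 < F y" using d(2)[of y] y x by (cases "y = x") auto
      \<comment> \<open>The tangent is taken at \<open>F x - F x0\<close>; continuity has kept
        \<open>F y - F x0\<close> in the domain of concavity.\<close>
      then have "inverse w * ((F x - F x0) - (F y - F x0)) \<le> ?\<phi> (F x - F x0) - ?\<phi> (F y - F x0)"
        unfolding w_def using x N
        by (intro concave_tangent concave_on_root_desingularizer root_desingularizer_deriv) auto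
      also have "\<dots> \<le> \<epsilon> * dist x y" using bspec[OF r(2), of y] y by (simp add: dist_commute)
      finally show ?thesis using w by (simp add: field_simps)
    qed
    then have "locally_minimal X F x (\<epsilon> * w)"
      unfolding locally_minimal_def using d(1) r(1) by (intro exI[of _ "min d r"]) auto
    then have "w \<le> \<epsilon> * w" unfolding w_def using \<rho>(2)[of x "\<epsilon> * w"] \<epsilon> w x by (auto simp: w_def)
    then show "1 \<le> ereal \<epsilon>" using w by simp
  qed
  then show "\<exists>\<phi> \<rho>. desingularizer \<phi> \<and> concave_on {0..} \<phi> \<and> 0 < \<rho> \<and>
      (\<forall>x\<in>X. dist x x0 < \<rho> \<and> 0 < F x - F x0 \<and> F x - F x0 < \<rho> \<longrightarrow> 1 \<le> slope X (\<lambda>y. \<phi> (F y - F x0)) x)"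
    using desingularizer_root_desingularizer[OF N] concave_on_root_desingularizer[OF N] \<rho>(1)
    by (intro exI[of _ ?\<phi>] exI[of _ "min 1 \<rho>"]) auto
qed

section \<open>Majorization-minimization\<close>

lemma continuous_on_if_locally_lipschitz_on:
  assumes "locally_lipschitz_on S g"
  shows "continuous_on S g"
  unfolding continuous_on_eq_continuous_within
proof
  fix p assume p: "p \<in> S"
  then obtain r L where r: "0 < r" "L-lipschitz_on (S \<inter> ball p r) g"
    using assms unfolding locally_lipschitz_on_def by blast
  then have "continuous (at p within S \<inter> ball p r) g"
    using p by (intro lipschitz_on_continuous_within) auto
  moreover have "at p within (S \<inter> ball p r) = at p within S"
    by (rule at_within_nhd[of p "ball p r"]) (use r(1) in auto)
  ultimately show "continuous (at p within S) g" by (simp only: continuous_within)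
qed

locale majorization_minimization =
  fixes X :: "'a::metric_space set" and f :: "'a \<Rightarrow> real" and D :: "'a \<Rightarrow> 'a set"
    and \<mu> :: real and h :: "'a \<Rightarrow> 'a \<Rightarrow> real"
  assumes mm: "mm_assumption X f D \<mu> h"
begin

abbreviation F :: "'a \<Rightarrow> real" where "F \<equiv> envelope D h"

lemma compact_cball: "x \<in> X \<Longrightarrow> compact (X \<inter> cball x r)"
  using mm by (auto simp: mm_assumption_def proper_metric_def)

lemma D_subset: "x \<in> X \<Longrightarrow> y \<in> D x \<Longrightarrow> y \<in> X"
  and D_self: "x \<in> X \<Longrightarrow> x \<in> D x"
  and D_closed: "x \<in> X \<Longrightarrow> closed (D x)"
  and D_convex: "x \<in> X \<Longrightarrow> geodesically_convex (D x)"
  using mm by (auto simp: mm_assumption_def)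

lemma \<mu>_pos: "0 < \<mu>" using mm by (simp add: mm_assumption_def)

lemma f_le_h: "x \<in> X \<Longrightarrow> y \<in> D x \<Longrightarrow> f y \<le> h x y"
  and h_self: "x \<in> X \<Longrightarrow> h x x = f x"
  using mm by (auto simp: mm_assumption_def)

lemma f_lower: obtains m where "\<And>x. x \<in> X \<Longrightarrow> m \<le> f x"
  using mm by (auto simp: mm_assumption_def bdd_below_def)

lemma h_continuous: "continuous_on (X \<times> X) (\<lambda>(x, y). h x y)"
  using mm by (auto simp: mm_assumption_def approximator_def intro: continuous_on_if_locally_lipschitz_on)

lemma infdist_continuous: "continuous_on (X \<times> X) (\<lambda>(x, y). infdist y (D x))"
  using mm by (auto simp: mm_assumption_def approximator_def intro: continuous_on_if_locally_lipschitz_on)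

lemma h_tendsto:
  assumes "(u \<longlongrightarrow> x) G" "(v \<longlongrightarrow> y) G" "x \<in> X" "y \<in> X" "\<And>n. u n \<in> X" "\<And>n. v n \<in> X"
  shows "((\<lambda>n. h (u n) (v n)) \<longlongrightarrow> h x y) G"
  using continuous_on_tendsto_compose[OF h_continuous, of "\<lambda>n. (u n, v n)" "(x, y)" G] assms
  by (auto intro: tendsto_Pair)

lemma infdist_tendsto:
  assumes "(u \<longlongrightarrow> x) G" "(v \<longlongrightarrow> y) G" "x \<in> X" "y \<in> X" "\<And>n. u n \<in> X" "\<And>n. v n \<in> X"
  shows "((\<lambda>n. infdist (v n) (D (u n))) \<longlongrightarrow> infdist y (D x)) G"
  using continuous_on_tendsto_compose[OF infdist_continuous, of "\<lambda>n. (u n, v n)" "(x, y)" G] assms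
  by (auto intro: tendsto_Pair)

lemma f_continuous: "continuous_on X f"
proof -
  have "continuous_on X (\<lambda>x. (\<lambda>(x, y). h x y) (x, x))"
    by (rule continuous_on_compose2[OF h_continuous]) (auto intro!: continuous_intros)
  then show ?thesis by (rule continuous_on_eq) (simp add: h_self)
qed

section \<open>Minimizers and continuity of the envelope\<close>

lemma bdd_below_h: "x \<in> X \<Longrightarrow> bdd_below (h x ` D x)"
proof -
  assume x: "x \<in> X"
  obtain m where m: "\<And>x. x \<in> X \<Longrightarrow> m \<le> f x" using f_lower by blast
  show ?thesis
  proof (rule bdd_belowI2)
    fix y assume "y \<in> D x"
    then show "m \<le> h x y" using m[of y] f_le_h[of x y] D_subset[of x y] x by auto
  qed
qed

lemma F_le: "x \<in> X \<Longrightarrow> y \<in> D x \<Longrightarrow> F x \<le> h x y"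
  unfolding envelope_def by (rule cINF_lower[OF bdd_below_h])

lemma F_greatest: "x \<in> X \<Longrightarrow> (\<And>y. y \<in> D x \<Longrightarrow> c \<le> h x y) \<Longrightarrow> c \<le> F x"
  unfolding envelope_def using D_self by (intro cINF_greatest) auto

lemma F_le_f: "x \<in> X \<Longrightarrow> F x \<le> f x"
  using F_le[of x x] D_self h_self by simp

text \<open>The infimum \<open>F x\<close> is used as a lower bound at the midpoint of a geodesic,
  so no minimizer is presupposed. The estimate serves twice: as coercivity in the existence of
  minimizers, and as the bound on a step.\<close>

lemma strong_convexity_midpoint:
  assumes x: "x \<in> X" and y: "y \<in> D x"
  shows "\<mu> / 4 * (dist x y)\<^sup>2 \<le> f x + h x y - 2 * F x"
proof -
  obtain a b \<gamma> where \<gamma>: "geodesic a b \<gamma>" "\<gamma> a = x" "\<gamma> b = y"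
    using mm unfolding mm_assumption_def geodesic_space_def by blast
  have ab: "a \<le> b" using \<gamma>(1) by (simp add: geodesic_def)
  have "dist (\<gamma> a) (\<gamma> b) = \<bar>a - b\<bar>" using \<gamma>(1) ab by (simp add: geodesic_def)
  then have d: "dist x y = b - a" using \<gamma> ab by simp
  have sub: "\<gamma> ` {a..b} \<subseteq> D x" using D_convex[OF x] \<gamma> D_self[OF x] y unfolding geodesically_convex_def by blast
  have "geodesically_strongly_convex_on \<mu> (D x) (h x)" using mm x by (simp add: mm_assumption_def)
  then have "convex_on {a..b} (\<lambda>t. h x (\<gamma> t) - \<mu> / 2 * t\<^sup>2)"
    using \<gamma>(1) sub unfolding geodesically_strongly_convex_on_def by blast
  from this[unfolded convex_on_def, THEN conjunct2, rule_format, of a b "1/2" "1/2"]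
  have "h x (\<gamma> ((a + b) / 2)) - \<mu> / 2 * ((a + b) / 2)\<^sup>2 \<le>
      (h x x - \<mu> / 2 * a\<^sup>2) / 2 + (h x y - \<mu> / 2 * b\<^sup>2) / 2"
    using ab \<gamma> by (simp add: add_divide_distrib)
  moreover have "F x \<le> h x (\<gamma> ((a + b) / 2))" using ab sub by (intro F_le x) auto
  ultimately have "2 * F x \<le> f x + h x y + \<mu> * ((a + b) / 2)\<^sup>2 - \<mu> / 2 * a\<^sup>2 - \<mu> / 2 * b\<^sup>2"
    using h_self[OF x] by (simp add: field_simps)
  also have "\<mu> * ((a + b) / 2)\<^sup>2 - \<mu> / 2 * a\<^sup>2 - \<mu> / 2 * b\<^sup>2 = - (\<mu> / 4 * (b - a)\<^sup>2)"
    by (simp add: power2_eq_square field_simps)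
  ultimately show ?thesis unfolding d by linarith
qed

lemma minimizer_exists:
  assumes x: "x \<in> X"
  shows "\<exists>y\<in>D x. h x y = F x"
proof -
  \<comment> \<open>The radius satisfies \<open>\<mu> / 4 * R^2 = 2 * (f x - F x)\<close>, so by the
    midpoint estimate points beyond it have model value at least \<open>f x = h x x\<close>.\<close>
  define R where "R = sqrt (8 * (f x - F x) / \<mu>)"
  define K where "K = D x \<inter> (X \<inter> cball x R)"
  have R: "0 \<le> R" "R\<^sup>2 = 8 * (f x - F x) / \<mu>" using F_le_f[OF x] \<mu>_pos by (simp_all add: R_def)
  have "compact K" unfolding K_def by (rule closed_Int_compact[OF D_closed[OF x] compact_cball[OF x]])
  moreover have xK: "x \<in> K" using x D_self R by (simp add: K_def)
  moreover have "continuous_on K (\<lambda>y. (\<lambda>(x, y). h x y) (x, y))"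
    by (rule continuous_on_compose2[OF h_continuous]) (use x in \<open>auto simp: K_def intro!: continuous_intros\<close>)
  ultimately obtain y where y: "y \<in> K" "\<And>z. z \<in> K \<Longrightarrow> h x y \<le> h x z"
    using continuous_attains_inf[of K "h x"] by auto
  have "h x y \<le> F x"
  proof (rule F_greatest[OF x])
    fix z assume z: "z \<in> D x"
    show "h x y \<le> h x z"
    proof (cases "z \<in> K")
      case False
      then have "R < dist x z" using z D_subset[OF x z] by (auto simp: K_def)
      then have "R\<^sup>2 \<le> (dist x z)\<^sup>2" using R by (intro power_mono) auto
      then have le: "\<mu> / 4 * R\<^sup>2 \<le> \<mu> / 4 * (dist x z)\<^sup>2" using \<mu>_pos by (intro mult_left_mono) auto
      have "2 * (f x - F x) = \<mu> / 4 * R\<^sup>2" unfolding R(2) using \<mu>_pos by simp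
      also note le
      also note strong_convexity_midpoint[OF x z]
      finally have "2 * (f x - F x) \<le> f x + h x z - 2 * F x" .
      then have "f x \<le> h x z" by simp
      moreover have "h x y \<le> f x" using y(2)[OF xK] h_self[OF x] by simp
      ultimately show ?thesis by simp
    qed (use y in blast)
  qed
  then show ?thesis using y F_le[OF x] by (auto simp: K_def intro!: bexI[of _ y] antisym)
qed

text \<open>The factor 2 makes \<open>\<mu> / 4 * (gap x)^2\<close> equal to
  \<open>f x - F x\<close>, matching the constant of
  \<open>strong_convexity_midpoint\<close>.\<close>

definition gap :: "'a \<Rightarrow> real" where "gap x = 2 * sqrt ((f x - F x) / \<mu>)"

lemma gap_nonneg: "x \<in> X \<Longrightarrow> 0 \<le> gap x"
  using F_le_f \<mu>_pos by (simp add: gap_def)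

lemma gap_squared: "x \<in> X \<Longrightarrow> \<mu> / 4 * (gap x)\<^sup>2 = f x - F x"
  using F_le_f[of x] \<mu>_pos by (simp add: gap_def power_mult_distrib)

lemma dist_minimizer:
  assumes x: "x \<in> X" and y: "y \<in> D x" "h x y = F x"
  shows "dist x y \<le> gap x"
proof -
  have "\<mu> / 4 * (dist x y)\<^sup>2 \<le> \<mu> / 4 * (gap x)\<^sup>2"
    using strong_convexity_midpoint[OF x y(1)] y(2) gap_squared[OF x] by simp
  then have "(dist x y)\<^sup>2 \<le> (gap x)\<^sup>2" using \<mu>_pos by simp
  then show ?thesis using gap_nonneg[OF x] by (rule power2_le_imp_le)
qed

text \<open>The point \<open>x\<close> of \<open>D x\<close> limits the search to a closed ball,
  which is compact in the proper space \<open>X\<close>.\<close>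

lemma projection_exists:
  assumes x: "x \<in> X" and y: "y \<in> X"
  shows "\<exists>w\<in>D x. dist y w = infdist y (D x)"
proof -
  define K where "K = D x \<inter> (X \<inter> cball y (dist y x))"
  have "compact K" unfolding K_def by (rule closed_Int_compact[OF D_closed[OF x] compact_cball[OF y]])
  moreover have "x \<in> K" using x D_self by (simp add: K_def)
  moreover have "continuous_on K (dist y)" by (intro continuous_intros)
  ultimately obtain w where w: "w \<in> K" "\<And>z. z \<in> K \<Longrightarrow> dist y w \<le> dist y z"
    using continuous_attains_inf[of K "dist y"] by auto
  have ne: "D x \<noteq> {}" using D_self[OF x] by blast
  have "dist y w \<le> infdist y (D x)"
    unfolding infdist_notempty[OF ne]
  proof (rule cINF_greatest[OF ne])
    fix z assume z: "z \<in> D x"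
    show "dist y w \<le> dist y z"
    proof (cases "z \<in> K")
      case False
      then have "dist y x < dist y z" using z D_subset[OF x z] by (auto simp: K_def)
      then show ?thesis using w(2)[OF \<open>x \<in> K\<close>] by simp
    qed (rule w)
  qed
  moreover have "infdist y (D x) \<le> dist y w" using w(1) by (intro infdist_le) (simp add: K_def)
  ultimately show ?thesis using w(1) by (auto simp: K_def)
qed

text \<open>A minimizer \<open>y\<close> at \<open>a\<close> is projected onto the sets
  \<open>D (u n)\<close>. Continuity of the distance function makes the projections converge to
  \<open>y\<close>, and their model values bound \<open>F (u n)\<close> from above.\<close>

lemma F_upper_limit:
  assumes a: "a \<in> X" and u: "\<And>n. u n \<in> X" "u \<longlonglongrightarrow> a" and e: "F a < c"
  shows "\<forall>\<^sub>F n in sequentially. F (u n) < c"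
proof -
  obtain y where y: "y \<in> D a" "h a y = F a" using minimizer_exists[OF a] by blast
  have yX: "y \<in> X" using D_subset[OF a y(1)] .
  have "\<exists>w. \<forall>n. w n \<in> D (u n) \<and> dist y (w n) = infdist y (D (u n))"
    using projection_exists[OF u(1) yX] by (intro choice) blast
  then obtain w where w: "\<And>n. w n \<in> D (u n)" "\<And>n. dist y (w n) = infdist y (D (u n))" by blast
  have "(\<lambda>n. infdist y (D (u n))) \<longlonglongrightarrow> infdist y (D a)"
    by (rule infdist_tendsto[OF u(2) tendsto_const a yX u(1) yX])
  also have "infdist y (D a) = 0" using y(1) by (rule infdist_zero)
  finally have "(\<lambda>n. dist (w n) y) \<longlonglongrightarrow> 0" by (simp add: w(2)[symmetric] dist_commute)
  then have wy: "w \<longlonglongrightarrow> y" by (rule tendsto_dist_iff[THEN iffD2])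
  have "(\<lambda>n. h (u n) (w n)) \<longlonglongrightarrow> h a y"
    by (rule h_tendsto[OF u(2) wy a yX u(1) D_subset[OF u(1) w(1)]])
  then have "\<forall>\<^sub>F n in sequentially. h (u n) (w n) < c" using e y(2) by (intro order_tendstoD(2)) auto
  then show ?thesis by eventually_elim (use F_le[OF u(1) w(1)] in \<open>auto intro: le_less_trans\<close>)
qed

text \<open>Minimizers at \<open>u n\<close> stay in a compact set because the gap is bounded along
  a convergent sequence. A cluster point belongs to \<open>D a\<close>, since its distance to
  \<open>D a\<close> is a limit of zeros.\<close>

lemma F_lower_limit:
  assumes a: "a \<in> X" and u: "\<And>n. u n \<in> X" "u \<longlonglongrightarrow> a" and c: "\<And>n. F (u n) \<le> c"
  shows "F a \<le> c"
proof -
  have "\<exists>y. \<forall>n. y n \<in> D (u n) \<and> h (u n) (y n) = F (u n)"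
    using minimizer_exists[OF u(1)] by (intro choice) blast
  then obtain y where y: "\<And>n. y n \<in> D (u n)" "\<And>n. h (u n) (y n) = F (u n)" by blast
  have yX: "y n \<in> X" for n using D_subset[OF u(1) y(1)] .
  obtain m where m: "\<And>x. x \<in> X \<Longrightarrow> m \<le> f x" using f_lower by blast
  have "(\<lambda>n. f (u n)) \<longlonglongrightarrow> f a" using continuous_on_tendsto_compose[OF f_continuous u(2) a] u(1) by simp
  then have "bounded (range (\<lambda>n. f (u n)))" by (rule convergent_imp_bounded)
  then obtain B where B: "\<And>n. f (u n) \<le> B" by (auto simp: bounded_iff abs_le_iff)
  have "bounded (range u)" using u(2) by (rule convergent_imp_bounded)
  then obtain B' where B': "\<And>n. dist a (u n) \<le> B'" by (auto simp: bounded_any_center[where a=a])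
  \<comment> \<open>\<open>B'\<close> bounds the distance from \<open>a\<close> to
    \<open>u n\<close>; the square root term bounds the gap there, since \<open>f\<close> is at most
    \<open>B\<close> along the sequence and \<open>F\<close> at least \<open>m\<close>.\<close>
  define R where "R = B' + 2 * sqrt ((B - m) / \<mu>)"
  have "y n \<in> X \<inter> cball a R" for n
  proof -
    have "m \<le> F (u n)" using m f_le_h[OF u(1)] D_subset[OF u(1)] by (intro F_greatest u) (meson order_trans)
    then have "gap (u n) \<le> 2 * sqrt ((B - m) / \<mu>)"
      unfolding gap_def using B[of n] \<mu>_pos by (auto intro: divide_right_mono)
    then have "dist (u n) (y n) \<le> 2 * sqrt ((B - m) / \<mu>)" using dist_minimizer[OF u(1) y] by (meson order_trans)
    then have "dist a (y n) \<le> R" using B'[of n] dist_triangle[of a "y n" "u n"] by (simp add: R_def)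
    then show ?thesis using yX by simp
  qed
  then obtain l k where l: "l \<in> X \<inter> cball a R" "strict_mono k" "(y \<circ> k) \<longlonglongrightarrow> l"
    using compact_cball[OF a] unfolding compact_def by blast
  have uk: "(u \<circ> k) \<longlonglongrightarrow> a" using u(2) l(2) by (rule LIMSEQ_subseq_LIMSEQ)
  have "(\<lambda>n. infdist ((y \<circ> k) n) (D ((u \<circ> k) n))) \<longlonglongrightarrow> infdist l (D a)"
    by (rule infdist_tendsto[OF uk l(3) a]) (use l u yX in auto)
  moreover have "infdist ((y \<circ> k) n) (D ((u \<circ> k) n)) = 0" for n using y(1) by (simp add: infdist_zero)
  ultimately have "infdist l (D a) = 0" by (simp add: LIMSEQ_const_iff)
  then have "l \<in> D a" using in_closed_iff_infdist_zero[OF D_closed[OF a]] D_self[OF a] by blast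
  then have "F a \<le> h a l" by (rule F_le[OF a])
  also have "h a l \<le> c"
  proof (rule LIMSEQ_le_const2)
    show "(\<lambda>n. h ((u \<circ> k) n) ((y \<circ> k) n)) \<longlonglongrightarrow> h a l"
      by (rule h_tendsto[OF uk l(3) a]) (use l u yX in auto)
  qed (use y c in auto)
  finally show ?thesis .
qed

lemma F_continuous: "continuous_on X F"
  unfolding continuous_on_sequentially
proof (intro ballI allI impI)
  fix u a assume a: "a \<in> X" and "(\<forall>n. u n \<in> X) \<and> u \<longlonglongrightarrow> a"
  then have u: "\<And>n. u n \<in> X" "u \<longlonglongrightarrow> a" by auto
  show "(F \<circ> u) \<longlonglongrightarrow> F a"
  proof (rule order_tendstoI)
    show "\<forall>\<^sub>F n in sequentially. (F \<circ> u) n < c" if "F a < c" for c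
      using F_upper_limit[OF a u that] by simp
    show "\<forall>\<^sub>F n in sequentially. c < (F \<circ> u) n" if c: "c < F a" for c
    proof (rule ccontr)
      assume "\<not> (\<forall>\<^sub>F n in sequentially. c < (F \<circ> u) n)"
      then have "\<exists>\<^sub>F n in sequentially. F (u n) \<le> c" by (simp add: not_eventually not_less)
      then have "infinite {n. F (u n) \<le> c}" by (simp add: frequently_cofinite[symmetric] cofinite_eq_sequentially)
      then obtain k :: "nat \<Rightarrow> nat" where k: "strict_mono k" "\<And>n. k n \<in> {n. F (u n) \<le> c}"
        using infinite_enumerate by blast
      have "F a \<le> c"
      proof (rule F_lower_limit[OF a])
        show "(u \<circ> k) \<longlonglongrightarrow> a" using u(2) k(1) by (rule LIMSEQ_subseq_LIMSEQ)
      qed (use u k in auto)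
      then show False using c by simp
    qed
  qed
qed

lemma gap_continuous: "continuous_on X gap"
  unfolding gap_def using \<mu>_pos by (intro continuous_intros f_continuous F_continuous) auto

end

section \<open>From the KL inequality to convergence\<close>

text \<open>A one-sided chain rule: were \<open>p * A < 1\<close>, the slope of the composition
  would be below \<open>1\<close>, because the derivative of \<open>\<phi>\<close> varies
  continuously and \<open>A\<close> bounds the slope of \<open>F\<close> at
  \<open>x\<close>.\<close>

lemma KL_desingularizer_derivative:
  assumes \<phi>: "desingularizer \<phi>" "concave_on {0..} \<phi>" and cont: "continuous_on X F"
    and x: "x \<in> X" "v < F x" and slope: "1 \<le> slope X (\<lambda>y. \<phi> (F y - v)) x"
    and A: "0 \<le> A" "\<And>\<eta>. 0 < \<eta> \<Longrightarrow> locally_minimal X F x (A + \<eta>)"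
  shows "\<exists>p>0. (\<phi> has_real_derivative p) (at (F x - v)) \<and> 1 \<le> p * A"
proof -
  obtain \<phi>' where \<phi>': "continuous_on {0<..} \<phi>'" "\<And>t. 0 < t \<Longrightarrow> (\<phi> has_real_derivative \<phi>' t) (at t)" "\<And>t. 0 < t \<Longrightarrow> 0 < \<phi>' t"
    using \<phi>(1) unfolding desingularizer_def by blast
  define a where "a = F x - v"
  define p where "p = \<phi>' a"
  have a: "0 < a" using x by (simp add: a_def)
  have p: "0 < p" using \<phi>'(3) a by (simp add: p_def)
  have "1 \<le> p * A"
  proof (rule ccontr)
    assume not: "\<not> 1 \<le> p * A"
    \<comment> \<open>This lies strictly between \<open>p * A\<close> and \<open>1\<close>; then
      \<open>\<eta>\<close> places \<open>p * (A + \<eta>)\<close> halfway between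
      \<open>p * A\<close> and \<open>\<epsilon>\<close>.\<close>
    define \<epsilon> where "\<epsilon> = (p * A + 1) / 2"
    have "p * A < 1" "0 \<le> p * A" using not p A(1) by auto
    then have \<epsilon>: "p * A < \<epsilon>" "\<epsilon> < 1" "0 < \<epsilon>" by (simp_all add: \<epsilon>_def mult.commute)
    define \<eta> where "\<eta> = (\<epsilon> - p * A) / (2 * p)"
    have \<eta>: "0 < \<eta>" using \<epsilon> p by (simp add: \<eta>_def)
    have "p * (A + \<eta>) = (\<epsilon> + p * A) / 2" using p by (simp add: \<eta>_def field_simps)
    then have pA: "p * (A + \<eta>) < \<epsilon>" using \<epsilon> by simp
    obtain r where r: "0 < r" "\<And>y. y \<in> X \<Longrightarrow> dist y x < r \<Longrightarrow> F x \<le> F y + (A + \<eta>) * dist x y"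
      using A(2)[OF \<eta>] unfolding locally_minimal_def by blast
    have Ft: "(F \<longlongrightarrow> F x) (at x within X)" using cont x by (simp add: continuous_on_def)
    then have at: "((\<lambda>y. F y - v) \<longlongrightarrow> a) (at x within X)" unfolding a_def by (intro tendsto_intros)
    have pos: "\<forall>\<^sub>F y in at x within X. 0 < F y - v" using order_tendstoD(1)[OF at a] .
    have "((\<lambda>y. \<phi>' (F y - v)) \<longlongrightarrow> \<phi>' a) (at x within X)"
      using continuous_on_tendsto_compose[OF \<phi>'(1) at] a pos by simp
    then have "((\<lambda>y. \<phi>' (F y - v) * (A + \<eta>)) \<longlongrightarrow> p * (A + \<eta>)) (at x within X)"
      unfolding p_def by (intro tendsto_intros)
    then have "\<forall>\<^sub>F y in at x within X. \<phi>' (F y - v) * (A + \<eta>) < \<epsilon>" using pA by (rule order_tendstoD(2))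
    with pos have "\<forall>\<^sub>F y in at x within X. 0 < F y - v \<and> \<phi>' (F y - v) * (A + \<eta>) < \<epsilon>"
      by eventually_elim auto
    then obtain d where d: "0 < d" "\<And>y. y \<in> X \<Longrightarrow> y \<noteq> x \<Longrightarrow> dist y x < d \<Longrightarrow>
        0 < F y - v \<and> \<phi>' (F y - v) * (A + \<eta>) < \<epsilon>"
      unfolding eventually_at by blast
    have "\<phi> (F x - v) + \<epsilon> * dist x x \<le> \<phi> (F y - v) + \<epsilon> * dist x y" if y: "y \<in> X \<inter> ball x (min d r)" for y
    proof (cases "y = x")
      case False
      have yd: "dist y x < d" "dist y x < r" using y by (auto simp: dist_commute)
      define b where "b = F y - v"
      have b: "0 < b" "\<phi>' b * (A + \<eta>) < \<epsilon>" using d(2)[of y] False y yd by (auto simp: b_def)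
      \<comment> \<open>The tangent is taken at \<open>b\<close>, the value belonging to
        \<open>y\<close>: the one at \<open>a\<close> bounds \<open>\<phi> a - \<phi> b\<close> only
        from below.\<close>
      have "\<phi>' b * (b - a) \<le> \<phi> b - \<phi> a"
        using a b by (intro concave_tangent[OF \<phi>(2) \<phi>'(2)]) auto
      then have "\<phi> a - \<phi> b \<le> \<phi>' b * (a - b)" by (simp add: algebra_simps)
      also have "\<dots> \<le> \<phi>' b * ((A + \<eta>) * dist x y)"
        using r(2)[of y] y yd \<phi>'(3)[OF b(1)] by (intro mult_left_mono) (auto simp: a_def b_def)
      also have "\<dots> = \<phi>' b * (A + \<eta>) * dist x y" by simp
      also have "\<dots> \<le> \<epsilon> * dist x y" using b by (intro mult_right_mono) auto
      finally show ?thesis by (simp add: a_def b_def)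
    qed simp
    then have "slope X (\<lambda>y. \<phi> (F y - v)) x \<le> ereal \<epsilon>"
      unfolding slope_def using \<epsilon>(3) d(1) r(1)
      by (intro Inf_lower CollectI exI[of _ \<epsilon>] conjI exI[of _ "min d r"]) auto
    then have "(1::ereal) \<le> ereal \<epsilon>" using slope by (rule order_trans[rotated])
    then show False using \<epsilon>(2) by simp
  qed
  then show ?thesis using p \<phi>'(2)[OF a] unfolding p_def a_def by blast
qed

lemma slope_eq_0I:
  assumes "\<And>\<eta>. 0 < \<eta> \<Longrightarrow> locally_minimal X f x \<eta>"
  shows "slope X f x = 0"
proof (rule antisym)
  show "slope X f x \<le> 0"
  proof (rule ereal_le_epsilon2)
    fix e :: real assume e: "0 < e"
    obtain r where "0 < r" "\<And>y. y \<in> X \<Longrightarrow> dist y x < r \<Longrightarrow> f x \<le> f y + e * dist x y"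
      using assms[OF e] unfolding locally_minimal_def by blast
    then have "slope X f x \<le> ereal e"
      unfolding slope_def using e
      by (intro Inf_lower CollectI exI[of _ e] conjI exI[of _ r]) (auto simp: dist_commute)
    then show "slope X f x \<le> 0 + ereal e" by simp
  qed
  show "0 \<le> slope X f x" unfolding slope_def by (rule Inf_greatest) auto
qed

context majorization_minimization
begin

text \<open>The hypothesis \<open>f z = F z\<close> says that the gap vanishes at \<open>z\<close>.
  By continuity minimizers at nearby \<open>x'\<close> then stay near \<open>z\<close>, within reach
  of both approximator inequalities, which are local.\<close>

lemma local_estimate:
  assumes z: "z \<in> X" "f z = F z"
  shows "\<exists>C>0. \<exists>\<delta>>0. \<forall>x\<in>X. \<forall>x'\<in>X. dist x z < \<delta> \<longrightarrow> dist x' z < \<delta> \<longrightarrow>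
    F x \<le> F x' + C * (dist x x' * (dist x x' + 2 * gap x'))"
proof -
  have appr: "approximator X h" "approximator X (\<lambda>x y. infdist y (D x))"
    using mm by (auto simp: mm_assumption_def)
  obtain \<gamma>1 r1 where \<gamma>1: "0 \<le> \<gamma>1" "0 < r1" "\<And>x y w. x \<in> X \<inter> ball z r1 \<Longrightarrow> y \<in> X \<inter> ball z r1 \<Longrightarrow> w \<in> X \<inter> ball z r1 \<Longrightarrow>
      \<bar>h x y - h w y\<bar> \<le> \<gamma>1 * dist x w * (dist x y + dist w y)"
    using appr(1) z(1) unfolding approximator_def by blast
  obtain \<gamma>2 r2 where \<gamma>2: "0 \<le> \<gamma>2" "0 < r2" "\<And>x y w. x \<in> X \<inter> ball z r2 \<Longrightarrow> y \<in> X \<inter> ball z r2 \<Longrightarrow> w \<in> X \<inter> ball z r2 \<Longrightarrow>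
      \<bar>infdist y (D x) - infdist y (D w)\<bar> \<le> \<gamma>2 * dist x w * (dist x y + dist w y)"
    using appr(2) z(1) unfolding approximator_def by blast
  obtain r3 L where L: "0 < r3" "L-lipschitz_on ((X \<times> X) \<inter> ball (z, z) r3) (\<lambda>(x, y). h x y)"
    using appr(1) z(1) unfolding approximator_def locally_lipschitz_on_def by blast
  have L0: "0 \<le> L" using L(2) by (rule lipschitz_on_nonneg)
  \<comment> \<open>Half of \<open>r3\<close> suffices for pairs, as the product distance is at most
    the sum of the two distances.\<close>
  define r where "r = min r1 (min r2 (r3 / 2))"
  have r: "0 < r" "r \<le> r1" "r \<le> r2" "r \<le> r3 / 2" using \<gamma>1 \<gamma>2 L by (auto simp: r_def)
  have pair: "(x, y) \<in> (X \<times> X) \<inter> ball (z, z) r3" if "x \<in> X" "y \<in> X" "dist x z < r" "dist y z < r" for x y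
  proof -
    have "dist (z, z) (x, y) \<le> dist z x + dist z y" by (simp add: dist_Pair_Pair sqrt_sum_squares_le_sum)
    also have "\<dots> < r3" using that r(4) by (simp add: dist_commute)
    finally show ?thesis using that by simp
  qed
  have "gap z = 0" using z(2) by (simp add: gap_def)
  then have "(gap \<longlongrightarrow> 0) (at z within X)" using gap_continuous z(1) by (metis continuous_on_def)
  then have "\<forall>\<^sub>F x in at z within X. gap x < r / 8" using r(1) by (intro order_tendstoD(2)) auto
  then obtain d where d: "0 < d" "\<And>x. x \<in> X \<Longrightarrow> x \<noteq> z \<Longrightarrow> dist x z < d \<Longrightarrow> gap x < r / 8"
    unfolding eventually_at by blast
  have gap_small: "gap x < r / 8" if "x \<in> X" "dist x z < d" for x
    using d(2)[of x] that \<open>gap z = 0\<close> r(1) by (cases "x = z") auto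
  \<comment> \<open>\<open>\<gamma>1\<close> is the cost of changing the model from
    \<open>x'\<close> to \<open>x\<close>, and \<open>L * \<gamma>2\<close> that of moving the
    minimizer to its projection; the \<open>1\<close> ensures positivity.\<close>
  define C where "C = \<gamma>1 + L * \<gamma>2 + 1"
  \<comment> \<open>With base points and gaps below \<open>r / 8\<close>, the minimizer
    \<open>y\<close> is within \<open>r / 4\<close> of \<open>z\<close> and its projection
    \<open>w\<close> within \<open>5 * r / 8\<close>.\<close>
  define \<delta> where "\<delta> = min d (r / 8)"
  have C: "0 < C" using \<gamma>1 \<gamma>2 L0 by (simp add: C_def add_nonneg_pos)
  have "F x \<le> F x' + C * (dist x x' * (dist x x' + 2 * gap x'))"
    if x: "x \<in> X" "x' \<in> X" "dist x z < \<delta>" "dist x' z < \<delta>" for x x'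
  proof -
    obtain y where y: "y \<in> D x'" "h x' y = F x'" using minimizer_exists[OF x(2)] by blast
    have yX: "y \<in> X" using D_subset[OF x(2) y(1)] .
    obtain w where w: "w \<in> D x" "dist y w = infdist y (D x)" using projection_exists[OF x(1) yX] by blast
    have wX: "w \<in> X" using D_subset[OF x(1) w(1)] .
    have x'y: "dist x' y \<le> gap x'" using dist_minimizer[OF x(2) y] .
    have gx: "gap x' < r / 8" using gap_small x by (simp add: \<delta>_def)
    have xd: "dist x z < r / 8" "dist x' z < r / 8" using x by (auto simp: \<delta>_def)
    have yz: "dist y z < r / 4" using dist_triangle[of y z x'] x'y gx xd by (simp add: dist_commute)
    have xy: "dist x y < 3 * r / 8" using dist_triangle2[of x y z] yz xd by simp
    have yw: "dist y w \<le> dist x y" unfolding w(2) using infdist_le[OF D_self[OF x(1)], of y] by (simp add: dist_commute)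
    have wz: "dist w z < r" using dist_triangle[of w z y] yw xy yz r(1) dist_commute[of w y] by linarith
    have ball: "x \<in> X \<inter> ball z r'" "x' \<in> X \<inter> ball z r'" "y \<in> X \<inter> ball z r'" if "r \<le> r'" for r'
      using x yX xd yz that r(1) by (auto simp: dist_commute)
    define Q where "Q = dist x x' * (dist x y + dist x' y)"
    have "infdist y (D x') = 0" using y(1) by (rule infdist_zero)
    then have "dist y w \<le> \<gamma>2 * Q" using \<gamma>2(3)[OF ball[OF r(3)]] \<gamma>2(3)[of x y x'] ball[OF r(3)] w(2) by (simp add: Q_def mult.assoc)
    then have Lw: "L * dist y w \<le> L * \<gamma>2 * Q" using L0 mult_left_mono by (simp add: mult.assoc mult_left_mono)
    have "\<bar>h x w - h x y\<bar> \<le> L * dist y w"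
      using lipschitz_onD[OF L(2) pair[OF x(1) wX] pair[OF x(1) yX]] xd wz yz r(1)
      by (simp add: dist_Pair_Pair dist_real_def dist_commute)
    moreover have "\<bar>h x y - h x' y\<bar> \<le> \<gamma>1 * Q" using \<gamma>1(3)[of x y x'] ball[OF r(2)] by (simp add: Q_def mult.assoc)
    moreover have "F x \<le> h x w" using F_le[OF x(1) w(1)] .
    moreover have Q: "Q \<le> dist x x' * (dist x x' + 2 * gap x')" unfolding Q_def
      using dist_triangle[of x y x'] x'y by (intro mult_left_mono) auto
    moreover have "0 \<le> Q" by (simp add: Q_def)
    ultimately have "F x \<le> F x' + C * Q" using Lw y(2) by (simp add: C_def algebra_simps)
    also have "C * Q \<le> C * (dist x x' * (dist x x' + 2 * gap x'))" using Q C by simp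
    finally show ?thesis by simp
  qed
  then show ?thesis using C d(1) r(1) by (intro exI[of _ C] exI[of _ \<delta>] conjI) (auto simp: \<delta>_def)
qed

text \<open>After a factor \<open>dist x y\<close> is split off, the remaining coefficient tends to
  \<open>2 * C * gap x\<close> by continuity of the gap; \<open>\<eta>\<close> absorbs the
  error.\<close>

lemma locally_minimal_F:
  assumes C: "0 < C" and \<delta>: "0 < \<delta>"
    and est: "\<And>x x'. x \<in> X \<Longrightarrow> x' \<in> X \<Longrightarrow> dist x z < \<delta> \<Longrightarrow> dist x' z < \<delta> \<Longrightarrow>
      F x \<le> F x' + C * (dist x x' * (dist x x' + 2 * gap x'))"
    and x: "x \<in> X" "dist x z < \<delta>" and \<eta>: "0 < \<eta>"
  shows "locally_minimal X F x (2 * C * gap x + \<eta>)"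
proof -
  have gapt: "(gap \<longlongrightarrow> gap x) (at x within X)" using gap_continuous x(1) by (simp add: continuous_on_def)
  have "((\<lambda>y. C * (dist x y + 2 * gap y)) \<longlongrightarrow> C * (dist x x + 2 * gap x)) (at x within X)"
    by (intro tendsto_intros gapt)
  then have "\<forall>\<^sub>F y in at x within X. C * (dist x y + 2 * gap y) < 2 * C * gap x + \<eta>"
    using \<eta> by (intro order_tendstoD(2)) auto
  then obtain d where d: "0 < d" "\<And>y. y \<in> X \<Longrightarrow> y \<noteq> x \<Longrightarrow> dist y x < d \<Longrightarrow> C * (dist x y + 2 * gap y) < 2 * C * gap x + \<eta>"
    unfolding eventually_at by blast
  have "F x \<le> F y + (2 * C * gap x + \<eta>) * dist x y" if y: "y \<in> X" "dist y x < min d (\<delta> - dist x z)" for y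
  proof (cases "y = x")
    case False
    have "dist y z < \<delta>" using dist_triangle[of y z x] y by simp
    then have "F x \<le> F y + C * (dist x y * (dist x y + 2 * gap y))" using est x y by blast
    also have "C * (dist x y * (dist x y + 2 * gap y)) = C * (dist x y + 2 * gap y) * dist x y" by simp
    also have "\<dots> \<le> (2 * C * gap x + \<eta>) * dist x y"
      using d(2)[of y] False y by (intro mult_right_mono) auto
    finally show ?thesis by simp
  qed simp
  then show ?thesis unfolding locally_minimal_def using d(1) x(2)
    by (intro exI[of _ "min d (\<delta> - dist x z)"]) auto
qed

theorem mm_sequence_converges:
  assumes KL: "KL_function X F" and seq: "mm_sequence X D h x" and bdd: "bounded (range x)"
  shows "\<exists>z\<in>X. x \<longlonglongrightarrow> z \<and> slope X f z = 0"
proof -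
  have xX: "x n \<in> X" for n using seq by (simp add: mm_sequence_def)
  have xD: "x (Suc n) \<in> D (x n)" and xh: "h (x n) (x (Suc n)) = F (x n)" for n
  proof -
    have *: "is_arg_min (h (x n)) (\<lambda>y. y \<in> D (x n)) (x (Suc n))"
      using seq by (simp add: mm_sequence_def iteration_map_def)
    then show "x (Suc n) \<in> D (x n)" by (simp add: is_arg_min_def)
    show "h (x n) (x (Suc n)) = F (x n)"
    proof (rule antisym)
      show "h (x n) (x (Suc n)) \<le> F (x n)" using * xX by (intro F_greatest) (auto simp: is_arg_min_def not_less)
      show "F (x n) \<le> h (x n) (x (Suc n))" using * xX by (intro F_le) (auto simp: is_arg_min_def)
    qed
  qed
  have step: "dist (x n) (x (Suc n)) \<le> gap (x n)" for n using dist_minimizer[OF xX xD xh] .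
  have f_step: "f (x (Suc n)) \<le> F (x n)" for n using f_le_h[OF xX xD, of n] xh by simp
  have F_step: "F (x (Suc n)) + \<mu> / 4 * (gap (x (Suc n)))\<^sup>2 \<le> F (x n)" for n
    using f_step[of n] gap_squared[OF xX, of "Suc n"] by linarith
  have dec: "decseq (\<lambda>n. F (x n))"
    unfolding decseq_Suc_iff using f_step F_le_f[OF xX] order_trans by blast
  obtain R where R: "\<And>n. dist (x 0) (x n) \<le> R" using bdd by (auto simp: bounded_any_center[where a = "x 0"])
  have "\<forall>n. x n \<in> X \<inter> cball (x 0) R" using xX R by simp
  then obtain z k where z: "z \<in> X \<inter> cball (x 0) R" and k: "strict_mono k" "(x \<circ> k) \<longlonglongrightarrow> z"
    using compact_cball[OF xX[of 0], of R] unfolding compact_def by blast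
  have zX: "z \<in> X" using z by simp
  have Fk: "(\<lambda>n. F (x (k n))) \<longlonglongrightarrow> F z"
    using continuous_on_tendsto_compose[OF F_continuous k(2) zX] xX by simp
  have fk: "(\<lambda>n. f (x (k n))) \<longlonglongrightarrow> f z"
    using continuous_on_tendsto_compose[OF f_continuous k(2) zX] xX by simp
  obtain m where m: "\<And>x. x \<in> X \<Longrightarrow> m \<le> f x" using f_lower by blast
  have "m \<le> F (x n)" for n
    using m f_le_h[OF xX] D_subset[OF xX] by (intro F_greatest xX) (meson order_trans)
  then obtain v where v: "(\<lambda>n. F (x n)) \<longlonglongrightarrow> v" using decseq_convergent[OF dec, of m] by blast
  have "(\<lambda>n. F (x (k n))) \<longlonglongrightarrow> v" using LIMSEQ_subseq_LIMSEQ[OF v k(1)] by (simp add: o_def)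
  then have "v = F z" using Fk LIMSEQ_unique by blast
  then have Flim: "(\<lambda>n. F (x n)) \<longlonglongrightarrow> F z" using v by simp
  have Fz: "F z \<le> F (x n)" for n using decseq_ge[OF dec Flim] .
  \<comment> \<open>Majorization squeezes \<open>f\<close> between consecutive values of
    \<open>F\<close>, so that \<open>f z = F z\<close> at the cluster point, as
    \<open>local_estimate\<close> requires.\<close>
  have "(\<lambda>n. f (x (Suc n))) \<longlonglongrightarrow> F z"
  proof (rule tendsto_sandwich[OF _ _ LIMSEQ_Suc[OF Flim] Flim])
    show "\<forall>\<^sub>F n in sequentially. F (x (Suc n)) \<le> f (x (Suc n))" using F_le_f[OF xX] by simp
    show "\<forall>\<^sub>F n in sequentially. f (x (Suc n)) \<le> F (x n)" using f_step by simp
  qed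
  then have flim: "(\<lambda>n. f (x n)) \<longlonglongrightarrow> F z" by (rule LIMSEQ_imp_Suc)
  then have "(\<lambda>n. f (x (k n))) \<longlonglongrightarrow> F z" using LIMSEQ_subseq_LIMSEQ[OF _ k(1)] by (fastforce simp: o_def)
  then have fz: "f z = F z" using fk LIMSEQ_unique by blast
  have "(\<lambda>n. 2 * sqrt ((f (x n) - F (x n)) / \<mu>)) \<longlonglongrightarrow> 2 * sqrt ((F z - F z) / \<mu>)"
    using \<mu>_pos by (intro tendsto_intros flim Flim) auto
  then have gaplim: "(\<lambda>n. gap (x n)) \<longlonglongrightarrow> 0" by (simp add: gap_def)
  obtain C \<delta> where C: "0 < C" and \<delta>: "0 < \<delta>" and est: "\<And>x x'. x \<in> X \<Longrightarrow> x' \<in> X \<Longrightarrow> dist x z < \<delta> \<Longrightarrow> dist x' z < \<delta> \<Longrightarrow>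
      F x \<le> F x' + C * (dist x x' * (dist x x' + 2 * gap x'))"
    using local_estimate[OF zX fz] by blast
  have minimal: "locally_minimal X F y (2 * C * gap y + \<eta>)" if "y \<in> X" "dist y z < \<delta>" "0 < \<eta>" for y \<eta>
    using C \<delta> est that by (rule locally_minimal_F)
  obtain \<phi> \<rho> where \<phi>: "desingularizer \<phi>" "concave_on {0..} \<phi>" and \<rho>: "0 < \<rho>"
    "\<And>x. x \<in> X \<Longrightarrow> dist x z < \<rho> \<Longrightarrow> 0 < F x - F z \<Longrightarrow> F x - F z < \<rho> \<Longrightarrow> 1 \<le> slope X (\<lambda>y. \<phi> (F y - F z)) x"
    using KL zX unfolding KL_function_def by blast
  \<comment> \<open>Chosen so that \<open>\<mu> / 4 * g'^2 \<le> \<Delta> * (2 * C * g)\<close>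
    becomes \<open>g'^2 \<le> g * (B * \<Delta>)\<close> for successive gaps \<open>g\<close> and
    \<open>g'\<close>.\<close>
  define B where "B = 8 * C / \<mu>"
  have B: "0 < B" using C \<mu>_pos by (simp add: B_def)
  define e where "e n = F (x n) - F z" for n
  define \<Psi> where "\<Psi> n = 2 * gap (x n) + B * \<phi> (e n)" for n
  have e0: "0 \<le> e n" for n using Fz by (simp add: e_def)
  have \<Psi>0: "0 \<le> \<Psi> n" for n
    using \<phi>(1) e0[of n] gap_nonneg[OF xX] B by (simp add: \<Psi>_def desingularizer_def)
  have elim: "e \<longlonglongrightarrow> 0" unfolding e_def using tendsto_diff[OF Flim tendsto_const, of "F z"] by simp
  have "(\<lambda>n. \<phi> (e n)) \<longlonglongrightarrow> \<phi> 0"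
    by (rule continuous_on_tendsto_compose[where s = "{0..}"])
      (use \<phi>(1) elim e0 in \<open>auto simp: desingularizer_def\<close>)
  moreover have "\<phi> 0 = 0" using \<phi>(1) by (simp add: desingularizer_def)
  ultimately have "(\<lambda>n. 2 * gap (x n) + B * \<phi> (e n)) \<longlonglongrightarrow> 2 * 0 + B * 0"
    by (intro tendsto_intros gaplim) simp
  then have \<Psi>lim: "\<Psi> \<longlonglongrightarrow> 0" by (simp add: \<Psi>_def[abs_def])
  have key: "gap (x n) \<le> \<Psi> n - \<Psi> (Suc n)" if n: "dist (x n) z < min \<delta> \<rho>" "e n < \<rho>" for n
  proof -
    have drop: "\<mu> / 4 * (gap (x (Suc n)))\<^sup>2 \<le> e n - e (Suc n)" using F_step[of n] by (simp add: e_def)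
    have g: "0 \<le> gap (x n)" "0 \<le> gap (x (Suc n))" using gap_nonneg[OF xX] by auto
    have "2 * gap (x (Suc n)) \<le> gap (x n) + B * (\<phi> (e n) - \<phi> (e (Suc n)))"
    \<comment> \<open>The KL inequality is available only above the limit value. At that value the
      next gap is zero already by the decrease of \<open>F\<close>.\<close>
    proof (cases "e n = 0")
      case True
      have sq: "0 \<le> \<mu> / 4 * (gap (x (Suc n)))\<^sup>2" using \<mu>_pos by simp
      then have "e (Suc n) = 0" using drop True e0[of "Suc n"] by linarith
      then have "\<mu> / 4 * (gap (x (Suc n)))\<^sup>2 = 0" using drop sq True by linarith
      then have "gap (x (Suc n)) = 0" using \<mu>_pos by simp
      then show ?thesis using g True \<open>e (Suc n) = 0\<close> by simp
    next
      case False
      then have en: "0 < e n" using e0[of n] by simp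
      obtain p where p: "0 < p" "(\<phi> has_real_derivative p) (at (F (x n) - F z))" "1 \<le> p * (2 * C * gap (x n))"
        using KL_desingularizer_derivative[OF \<phi> F_continuous xX, of "F z" n "2 * C * gap (x n)"]
          \<rho>(2)[OF xX, of n] minimal[OF xX, of n] n en C g by (auto simp: e_def)
      define \<Delta> where "\<Delta> = \<phi> (e n) - \<phi> (e (Suc n))"
      have tangent: "p * (e n - e (Suc n)) \<le> \<Delta>"
        unfolding \<Delta>_def using p(2) en e0 by (intro concave_tangent[OF \<phi>(2)]) (auto simp: e_def)
      have diff0: "0 \<le> e n - e (Suc n)" using decseqD[OF dec, of n "Suc n"] by (simp add: e_def)
      have \<Delta>0: "0 \<le> \<Delta>" using tangent p(1) diff0 by (meson mult_nonneg_nonneg less_imp_le order_trans)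
      have "e n - e (Suc n) \<le> (e n - e (Suc n)) * (p * (2 * C * gap (x n)))"
        using mult_left_mono[OF p(3) diff0] by simp
      also have "\<dots> = p * (e n - e (Suc n)) * (2 * C * gap (x n))" by simp
      also have "\<dots> \<le> \<Delta> * (2 * C * gap (x n))" using tangent C g by (intro mult_right_mono) auto
      finally have "\<mu> / 4 * (gap (x (Suc n)))\<^sup>2 \<le> \<Delta> * (2 * C * gap (x n))" using drop by linarith
      then have sq: "(gap (x (Suc n)))\<^sup>2 \<le> gap (x n) * (B * \<Delta>)" using \<mu>_pos by (simp add: B_def field_simps)
      have "(2 * gap (x (Suc n)))\<^sup>2 \<le> 4 * (gap (x n) * (B * \<Delta>))" using sq by (simp add: power_mult_distrib)
      \<comment> \<open>Arithmetic and geometric means; adding \<open>gap (x n)\<close> to the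
        result gives the decrease of \<open>\<Psi>\<close>, whence its factor 2.\<close>
      also have "\<dots> \<le> (gap (x n) + B * \<Delta>)\<^sup>2"
        using zero_le_power2[of "gap (x n) - B * \<Delta>"] by (simp add: power2_eq_square algebra_simps)
      finally show ?thesis unfolding \<Delta>_def[symmetric]
        by (rule power2_le_imp_le) (use g B \<Delta>0 in simp)
    qed
    then show ?thesis by (simp add: \<Psi>_def algebra_simps)
  qed
  have "x \<longlonglongrightarrow> z"
  proof (rule metric_LIMSEQ_I)
    fix r :: real assume r: "0 < r"
    define r' where "r' = min r (min \<delta> \<rho>)"
    have r': "0 < r'" using r \<delta> \<rho> by (simp add: r'_def)
    have "\<forall>\<^sub>F n in sequentially. e n < \<rho> \<and> \<Psi> n < r' / 2"
      using order_tendstoD(2)[OF elim \<rho>(1)] order_tendstoD(2)[OF \<Psi>lim, of "r' / 2"] r' by (auto intro: eventually_conj)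
    then obtain n0 where n0: "\<And>n. n0 \<le> n \<Longrightarrow> e n < \<rho> \<and> \<Psi> n < r' / 2"
      unfolding eventually_sequentially by blast
    have "\<forall>\<^sub>F j in sequentially. dist (x (k j)) z < r' / 2"
      using tendstoD[OF k(2), of "r' / 2"] r' by simp
    then obtain j0 where j0: "\<And>j. j0 \<le> j \<Longrightarrow> dist (x (k j)) z < r' / 2"
      unfolding eventually_sequentially by blast
    define N where "N = k (max n0 j0)"
    have N: "n0 \<le> N" "dist (x N) z < r' / 2"
      using seq_suble[OF k(1), of "max n0 j0"] j0[of "max n0 j0"] by (auto simp: N_def)
    \<comment> \<open>The bound is its own safeguard: it keeps \<open>x n\<close> within
      \<open>r'\<close> of \<open>z\<close>, where \<open>key\<close> applies and pays for the next
      step out of \<open>\<Psi>\<close>.\<close>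
    have "dist (x n) z \<le> dist (x N) z + \<Psi> N - \<Psi> n" if "N \<le> n" for n
      using that
    proof (induction n rule: dec_induct)
      case (step n)
      then have "dist (x n) z < r'" using N n0[of N] \<Psi>0[of n] by linarith
      then have "gap (x n) \<le> \<Psi> n - \<Psi> (Suc n)" using step N n0[of n] by (intro key) (auto simp: r'_def)
      moreover have "dist (x (Suc n)) z \<le> dist (x n) (x (Suc n)) + dist (x n) z"
        using dist_triangle[of "x (Suc n)" z "x n"] by (simp add: dist_commute)
      ultimately show ?case using step \<open>dist (x n) (x (Suc n)) \<le> gap (x n)\<close> by linarith
    qed simp
    then have "dist (x n) z < r" if "N \<le> n" for n
      using that N n0[of N] \<Psi>0[of n] unfolding r'_def by fastforce
    then show "\<exists>no. \<forall>n\<ge>no. dist (x n) z < r" by blast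
  qed
  moreover have "slope X f z = 0"
  proof (rule slope_eq_0I)
    fix \<eta> :: real assume "0 < \<eta>"
    then have "locally_minimal X F z (2 * C * gap z + \<eta>)" using minimal[OF zX] \<delta> by simp
    moreover have "gap z = 0" using fz by (simp add: gap_def)
    ultimately have "locally_minimal X F z \<eta>" by simp
    \<comment> \<open>Since \<open>F\<close> lies below \<open>f\<close> and they agree at
      \<open>z\<close>, local minimality passes from \<open>F\<close> to \<open>f\<close>.\<close>
    then show "locally_minimal X f z \<eta>"
      unfolding locally_minimal_def fz using F_le_f by (meson add_right_mono order_trans)
  qed
  ultimately show ?thesis using zX by blast
qed

end

text \<open>Because minimizers exist, the envelope value is the attained lower bound of the model, a
  condition on the graphs of \<open>D\<close> and \<open>h\<close> alone.\<close>

lemma semialgebraic_envelope: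
  fixes X :: "'e::euclidean_space set"
  assumes mm: "mm_assumption X f D \<mu> h"
    and D: "semialgebraic_mapping X D" and h: "semialgebraic_function2 X h"
  shows "semialgebraic {z. fst z \<in> X \<and> snd z = envelope D h (fst z)}"
proof -
  interpret majorization_minimization X f D \<mu> h by unfold_locales (rule mm)
  let ?D = "{(x, y). x \<in> X \<and> y \<in> D x}"
  let ?H = "{((x, y), t). x \<in> X \<and> y \<in> X \<and> t = h x y}"
  have D': "semialgebraic ?D" and H': "semialgebraic ?H"
    using D h by (auto simp: semialgebraic_mapping_def semialgebraic_function2_def)
  define P where "P z \<longleftrightarrow> (\<exists>y. (fst z, y) \<in> ?D \<and> ((fst z, y), snd z) \<in> ?H) \<and>
      (\<forall>y s. (fst z, y) \<in> ?D \<and> ((fst z, y), s) \<in> ?H \<longrightarrow> snd z \<le> s)" for z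
  have "semialgebraic {z. P z}" unfolding P_def
    by (intro semialgebraic_intros semialgebraic_mem[OF D'] semialgebraic_mem[OF H'] polynomial_intros)
  also have "{z. P z} = {z. fst z \<in> X \<and> snd z = F (fst z)}"
  proof (intro Collect_cong iffI)
    fix z assume "P z"
    then obtain y where z: "fst z \<in> X" "y \<in> D (fst z)" "snd z = h (fst z) y"
      "\<And>y. y \<in> D (fst z) \<Longrightarrow> snd z \<le> h (fst z) y" unfolding P_def using D_subset by auto
    then have "snd z = F (fst z)" using F_le[OF z(1,2)] F_greatest[OF z(1), of "snd z"] by simp
    then show "fst z \<in> X \<and> snd z = F (fst z)" using z by simp
  next
    fix z assume z: "fst z \<in> X \<and> snd z = F (fst z)"
    then obtain y where "y \<in> D (fst z)" "h (fst z) y = F (fst z)" using minimizer_exists by blast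
    then show "P z" unfolding P_def
      using z D_subset[of "fst z" y] F_le[of "fst z"] by auto
  qed
  finally show ?thesis .
qed

theorem theorem7p25:
  shows
    "(\<forall>(X :: 'a::metric_space set) f D \<mu> h.
        mm_assumption X f D \<mu> h \<and> KL_function X (envelope D h) \<longrightarrow>
        (\<forall>x. mm_sequence X D h x \<and> bounded (range x) \<longrightarrow>
          (\<exists>x'\<in>X. x \<longlonglongrightarrow> x' \<and> slope X f x' = 0)))
     \<and>
     (\<forall>(X :: 'e::euclidean_space set) f D \<mu> h.
        mm_assumption X f D \<mu> h \<and>
        semialgebraic X \<and> semialgebraic_mapping X D \<and> semialgebraic_function2 X h \<longrightarrow>
        KL_function X (envelope D h))"
proof (intro conjI allI impI)
  fix X :: "'a set" and f D \<mu> h x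
  assume "mm_assumption X f D \<mu> h \<and> KL_function X (envelope D h)" "mm_sequence X D h x \<and> bounded (range x)"
  then show "\<exists>x'\<in>X. x \<longlonglongrightarrow> x' \<and> slope X f x' = 0"
    by (intro majorization_minimization.mm_sequence_converges[of X f D \<mu> h]) (auto intro: majorization_minimization.intro)
next
  fix X :: "'e set" and f D \<mu> h
  assume *: "mm_assumption X f D \<mu> h \<and> semialgebraic X \<and> semialgebraic_mapping X D \<and> semialgebraic_function2 X h"
  then interpret majorization_minimization X f D \<mu> h by (intro majorization_minimization.intro) blast
  show "KL_function X F"
    using * by (intro KL_function_semialgebraic F_continuous semialgebraic_envelope) blast+
qed

end
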